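(* Let $Q$ satisfy the summability condition $\sum_{\ell=0}^{\infty} A_\ell\, \ell^{1+\eta} < \infty$ for some $\eta > 0$. Then the isotropic $Q$-fractional Brownian motion $B_{Q}^{H}$ with Hurst parameter $H\in(0,1)$ has a continuous modification on $\mathbb{T} \times \mathbb{S}^{2}$ which is in $C^{H^-, (\eta/2)^-}(\mathbb{T}\times \mathbb{S}^{2})$.
   Context: All processes are defined on a probability space $(\Omega,\mathcal{A},\mathbb{P})$ and on a finite time interval $\mathbb{T}=[0,T]$. $\mathbb{S}^2=\{x\in\mathbb{R}^3 : x_1^2+x_2^2+x_3^2=1\}$ is the unit sphere with geodesic distance $d_{\mathbb{S}^2}(x,y)=\arccos(\langle x,y\rangle_{\mathbb{R}^3})$, and $(Y_{\ell,m},\ \ell\in\mathbb{N}_0,\ m=-\ell,\dots,\ell)$ are the real-valued spherical harmonics, an orthonormal basis of $L^2(\mathbb{S}^2)$. $Q$ is a nonnegative self-adjoint covariance operator on $L^2(\mathbb{S}^2)$ with $QY_{\ell,m}=A_\ell Y_{\ell,m}$, where $(A_\ell,\ \ell\in\mathbb{N}_0)$, $A_\ell\ge 0$, is its angular power spectrum. A real-valued fractional Brownian motion $\beta^H$ with Hurst parameter $H\in(0,1)$ is a continuous centered Gaussian process with covariance $\phi_H(s,t)=\frac12(t^{2H}+s^{2H}-|t-s|^{2H})$. An isotropic $Q$-fractional Brownian motion $B_Q^H$ is an $L^2(\mathbb{S}^2)$-valued continuous centered Gaussian process with $\mathbb{E}[\langle B_Q^H(t),u\rangle\langle B_Q^H(s),v\rangle]=\phi_H(t,s)\langle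 Qu,v\rangle$ for all $u,v\in L^2(\mathbb{S}^2)$, $s,t\in\mathbb{T}$; it has the expansion $B_Q^H(t,x)=\sum_{\ell=0}^\infty\sum_{m=-\ell}^{\ell}\sqrt{A_\ell}\,\beta^H_{\ell,m}(t)Y_{\ell,m}(x)$ with independent real-valued fractional Brownian motions $\beta^H_{\ell,m}$, and is viewed as a space-time process on $\mathbb{T}\times\mathbb{S}^2$. $C^{\alpha,\beta}(\mathbb{T}\times \mathbb{S}^{2})$ denotes the subspace of functions $f \in C^{\min\{\alpha,\beta\}}(\mathbb{T}\times \mathbb{S}^{2})$ such that $f(\cdot,x)\in C^\alpha(\mathbb{T})$ for all $x\in\mathbb{S}^2$ and $f(t,\cdot)\in C^\beta(\mathbb{S}^2)$ for all $t\in\mathbb{T}$; a superscript $\alpha^-$ means Hölder continuity of every order strictly less than $\alpha$ (and $\min\{\alpha^-,\beta^-\}$ is read as $\min\{\alpha,\beta\}^-$). For $\eta>2$ the standard extension of Hölder spaces to orders greater than 1 is used. *)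

theory Defs
  imports "HOL-Probability.Probability" "HOL-Computational_Algebra.Polynomial"
begin

definition S2 :: "(real^3) set" where
  "S2 = {x. x$1 ^ 2 + x$2 ^ 2 + x$3 ^ 2 = 1}"

definition sph_dist :: "real^3 \<Rightarrow> real^3 \<Rightarrow> real" where
  "sph_dist x y = arccos (x \<bullet> y)"

text \<open>Legendre polynomial via Rodrigues' formula.\<close>
definition legendre_poly :: "nat \<Rightarrow> real poly" where
  "legendre_poly l = smult (1 / (2 ^ l * fact l)) ((pderiv ^^ l) ([:-1, 0, 1:] ^ l))"

text \<open>Real spherical harmonics Y(l,m), |m| \<le> l, in Cartesian coordinates, with
  x3 = cos theta and x1 + i x2 = sin theta e^(i phi); orthonormal w.r.t. the surface
  measure of S2.\<close>
definition sph_harm :: "nat \<Rightarrow> int \<Rightarrow> real^3 \<Rightarrow> real" where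
  "sph_harm l m x =
     (let k = nat \<bar>m\<bar>;
          c = sqrt ((2 * real l + 1) / (4 * pi) * fact (l - k) / fact (l + k));
          d = poly ((pderiv ^^ k) (legendre_poly l)) (x$3);
          w = (Complex (x$1) (x$2)) ^ k
      in if m = 0 then c * d
         else if m > 0 then sqrt 2 * c * d * Re w
         else sqrt 2 * c * d * Im w)"

definition fbm_cov :: "real \<Rightarrow> real \<Rightarrow> real \<Rightarrow> real" where
  "fbm_cov H s t = (t powr (2*H) + s powr (2*H) - \<bar>t - s\<bar> powr (2*H)) / 2"

definition centered_gaussian :: "'w measure \<Rightarrow> ('w \<Rightarrow> real) \<Rightarrow> bool" where
  "centered_gaussian M X \<longleftrightarrow>
     (X \<in> borel_measurable M \<and> (AE \<omega> in M. X \<omega> = 0)) \<or>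
     (\<exists>\<sigma>>0. distributed M lborel X (normal_density 0 \<sigma>))"

definition is_fbm :: "'w measure \<Rightarrow> real \<Rightarrow> real \<Rightarrow> (real \<Rightarrow> 'w \<Rightarrow> real) \<Rightarrow> bool" where
  "is_fbm M T H \<beta> \<longleftrightarrow>
     (\<forall>F c. finite F \<and> F \<subseteq> {0..T} \<longrightarrow>
        centered_gaussian M (\<lambda>\<omega>. \<Sum>t\<in>F. c t * \<beta> t \<omega>)) \<and>
     (\<forall>s\<in>{0..T}. \<forall>t\<in>{0..T}. (\<integral>\<omega>. \<beta> s \<omega> * \<beta> t \<omega> \<partial>M) = fbm_cov H s t) \<and>
     (\<forall>\<omega>\<in>space M. continuous_on {0..T} (\<lambda>t. \<beta> t \<omega>))"

definition holder_on :: "('a \<Rightarrow> 'a \<Rightarrow> real) \<Rightarrow> 'a set \<Rightarrow> real \<Rightarrow> ('a \<Rightarrow> real) \<Rightarrow> bool" where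
  "holder_on d S \<gamma> f \<longleftrightarrow> (\<exists>C. \<forall>p\<in>S. \<forall>q\<in>S. \<bar>f p - f q\<bar> \<le> C * d p q powr \<gamma>)"

primrec Ck_holder :: "nat \<Rightarrow> real \<Rightarrow> (real^3 \<Rightarrow> real) \<Rightarrow> bool" where
  "Ck_holder 0 \<gamma> F = holder_on sph_dist S2 \<gamma> F"
| "Ck_holder (Suc k) \<gamma> F =
     (\<exists>DF. (\<forall>y. y \<noteq> 0 \<longrightarrow> (F has_derivative DF y) (at y)) \<and>
           (\<forall>i. Ck_holder k \<gamma> (\<lambda>y. DF y (axis i 1))))"

text \<open>C^beta(S2) for beta > 0, beta = k + gamma with k integer and gamma in (0,1],
  via the 0-homogeneous extension y \<mapsto> g(y/|y|) to R^3 minus 0.\<close>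
definition sphere_holder :: "real \<Rightarrow> (real^3 \<Rightarrow> real) \<Rightarrow> bool" where
  "sphere_holder \<beta> g =
     (let k = nat (\<lceil>\<beta>\<rceil> - 1) in Ck_holder k (\<beta> - real k) (\<lambda>y. g (y /\<^sub>R norm y)))"

definition holder_minus_space ::
  "real \<Rightarrow> real \<Rightarrow> real \<Rightarrow> (real \<Rightarrow> real^3 \<Rightarrow> real) \<Rightarrow> bool" where
  "holder_minus_space T \<alpha> \<beta> f \<longleftrightarrow>
     (\<forall>a. 0 < a \<and> a < \<alpha> \<longrightarrow> (\<forall>x\<in>S2. holder_on (\<lambda>s t. \<bar>s - t\<bar>) {0..T} a (\<lambda>t. f t x))) \<and>
     (\<forall>b. 0 < b \<and> b < \<beta> \<longrightarrow> (\<forall>t\<in>{0..T}. sphere_holder b (f t))) \<and>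
     (\<forall>g. 0 < g \<and> g < min \<alpha> \<beta> \<longrightarrow>
        holder_on (\<lambda>(s, x) (t, y). \<bar>s - t\<bar> + sph_dist x y) ({0..T} \<times> S2) g
          (\<lambda>(t, x). f t x))"

definition qfbm_partial ::
  "(nat \<Rightarrow> real) \<Rightarrow> (nat \<Rightarrow> int \<Rightarrow> real \<Rightarrow> 'w \<Rightarrow> real) \<Rightarrow> nat \<Rightarrow> real \<Rightarrow> real^3 \<Rightarrow> 'w \<Rightarrow> real" where
  "qfbm_partial A \<beta> L t x \<omega> =
     (\<Sum>l<L. \<Sum>m\<in>{- int l..int l}. sqrt (A l) * \<beta> l m t \<omega> * sph_harm l m x)"

end

theory Submission
  imports Defs
begin

text \<open>
  Split the expansion into dyadic blocks of degrees \<open>l + 1 \<in> [2\<^sup>j, 2\<^sup>j\<^sup>+\<^sup>1)\<close>. The rotation fields act on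
  the vector \<open>(Y(l,m))\<close> of harmonics of degree \<open>l\<close> by band matrices with entries \<open>O(l)\<close>, and the
  squared length of this vector is constant on the sphere; hence a partial derivative of order \<open>k\<close>
  of the 0-homogeneous extensions satisfies \<open>\<Sum>m. (\<partial>Y(l,m))\<^sup>2 = O(l^(1+2k))\<close>, and a time increment of
  the \<open>k\<close>-th derivative of the \<open>j\<close>-th block is Gaussian of standard deviation
  \<open>O(2^(j(k - \<eta>/2)) |t - s|^H)\<close>. Kolmogorov's dyadic chaining in time, applied simultaneously on a
  sphere net of polynomial size in \<open>2\<^sup>j\<close>, makes this bound almost surely uniform in the space variable
  at the price of an arbitrarily small loss in the exponents. Summing over \<open>j\<close>, with
  interpolation between consecutive derivatives, gives all Hoelder estimates, and the sum of the
  blocks is the required modification.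
\<close>

section \<open>Legendre polynomials and the sum of squares of the harmonics\<close>

text \<open>The order \<open>\<eta> / 2\<close> may exceed 1, so regularity in space asks for
  genuine derivatives and not just for increments. They are taken on finite blocks, where everything
  is smooth, and the block series is then differentiated term by term. Closed formulas for iterated
  derivatives of harmonics are avoided: the proof tracks a class of functions that is closed under
  differentiation and carries a growth exponent in l. The main obstacle is uniformity in space. A
  moment bound at each point has to become a bound at all points with one random constant. A net
  fine enough for block j has about 2^(3jR) points; giving away a factor 2^(j \<epsilon>) in the
  bound gains 2^(-2 q \<epsilon> j) in the moments of order 2q, and q may be taken as large as
  needed because Gaussian variables have all moments. The loss \<epsilon> is harmless, as only
  orders strictly below \<open>H\<close> and \<open>\<eta> / 2\<close> are claimed. One family of
  block bounds, uniform in space and Hoelder in time, thus yields all three conditions of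
  \<open>holder_minus_space\<close>.\<close>

definition legendre_deriv :: "nat \<Rightarrow> nat \<Rightarrow> real \<Rightarrow> real" where
  "legendre_deriv l k z = poly ((pderiv ^^ k) (legendre_poly l)) z"

lemma DERIV_legendre_deriv: "(legendre_deriv l k has_real_derivative legendre_deriv l (Suc k) z) (at z)"
  unfolding legendre_deriv_def using poly_DERIV by simp

text \<open>The equation (z^2 - 1) w' = 2 l z w differentiated n + 1 times by Leibniz' rule.
  Polynomial identities are compared through their values at z, where ring normalisation
  applies.\<close>

lemma pderiv_funpow_ode:
  fixes l n :: nat
  defines "w \<equiv> [:-1, 0, 1:] ^ l :: real poly"
  shows "[:-1, 0, 1:] * (pderiv ^^ Suc (Suc n)) w =
    smult (2 * (real l - real n - 1)) ([:0, 1:] * (pderiv ^^ Suc n) w) +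
    smult ((real n + 1) * (2 * real l - real n)) ((pderiv ^^ n) w)"
proof (induction n)
  have ode: "[:-1, 0, 1:] * pderiv w = smult (2 * real l) ([:0, 1:] * w)"
    unfolding w_def
    by (cases l) (simp_all only: poly_eq_poly_eq_iff[symmetric] fun_eq_iff pderiv_power_Suc,
        simp_all add: pderiv_pCons algebra_simps)
  case 0
  have "pderiv ([:-1, 0, 1:] * pderiv w) = pderiv (smult (2 * real l) ([:0, 1:] * w))"
    using ode by simp
  then have *: "poly (pderiv ([:-1, 0, 1:] * pderiv w)) z = poly (pderiv (smult (2 * real l) ([:0, 1:] * w))) z" for z
    by simp
  have "poly ([:-1, 0, 1:] * (pderiv ^^ Suc (Suc 0)) w) z =
    poly (smult (2 * (real l - real 0 - 1)) ([:0, 1:] * (pderiv ^^ Suc 0) w) +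
    smult ((real 0 + 1) * (2 * real l - real 0)) ((pderiv ^^ 0) w)) z" for z
    using *[of z] unfolding pderiv_mult pderiv_smult
    by (simp add: pderiv_pCons) (simp add: algebra_simps)
  then show ?case by (simp only: poly_eq_poly_eq_iff[symmetric] fun_eq_iff) simp
next
  case (Suc n)
  then have "pderiv ([:-1, 0, 1:] * (pderiv ^^ Suc (Suc n)) w) = pderiv
    (smult (2 * (real l - real n - 1)) ([:0, 1:] * (pderiv ^^ Suc n) w) +
    smult ((real n + 1) * (2 * real l - real n)) ((pderiv ^^ n) w))" by simp
  then have "poly (pderiv ([:-1, 0, 1:] * (pderiv ^^ Suc (Suc n)) w)) z = poly (pderiv
    (smult (2 * (real l - real n - 1)) ([:0, 1:] * (pderiv ^^ Suc n) w) +
    smult ((real n + 1) * (2 * real l - real n)) ((pderiv ^^ n) w))) z" for z by simp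
  note * = this
  have "poly ([:-1, 0, 1:] * (pderiv ^^ Suc (Suc (Suc n))) w) z =
    poly (smult (2 * (real l - real (Suc n) - 1)) ([:0, 1:] * (pderiv ^^ Suc (Suc n)) w) +
    smult ((real (Suc n) + 1) * (2 * real l - real (Suc n))) ((pderiv ^^ Suc n) w)) z" for z
    using *[of z] unfolding pderiv_add pderiv_mult pderiv_smult
    by (simp add: pderiv_pCons) (simp add: algebra_simps)
  then show ?case by (simp only: poly_eq_poly_eq_iff[symmetric] fun_eq_iff) simp
qed

text \<open>By Rodrigues' formula this is the case n = k + l of the preceding identity, that is,
  Legendre's equation differentiated k times. It links three consecutive orders and drives both the
  telescoping and the ladder relations.\<close>

lemma legendre_deriv_ode:
  "(z\<^sup>2 - 1) * legendre_deriv l (Suc (Suc k)) z =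
     - 2 * (real k + 1) * z * legendre_deriv l (Suc k) z + (real l + real k + 1) * (real l - real k) * legendre_deriv l k z"
proof -
  let ?w = "[:-1, 0, 1:] ^ l :: real poly"
  define c :: real where "c = 1 / (2 ^ l * fact l)"
  have legendre_deriv: "legendre_deriv l j z = c * poly ((pderiv ^^ (j + l)) ?w) z" for j
    by (simp add: legendre_deriv_def legendre_poly_def higher_pderiv_smult funpow_add c_def)
  have "poly ([:-1, 0, 1:] * (pderiv ^^ Suc (Suc (k + l))) ?w) z = poly (
    smult (2 * (real l - real (k + l) - 1)) ([:0, 1:] * (pderiv ^^ Suc (k + l)) ?w) +
    smult ((real (k + l) + 1) * (2 * real l - real (k + l))) ((pderiv ^^ (k + l)) ?w)) z"
    by (simp only: pderiv_funpow_ode)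
  then have "(z\<^sup>2 - 1) * poly ((pderiv ^^ Suc (Suc (k + l))) ?w) z =
     - 2 * (real k + 1) * z * poly ((pderiv ^^ Suc (k + l)) ?w) z +
     (real l + real k + 1) * (real l - real k) * poly ((pderiv ^^ (k + l)) ?w) z"
    by (simp add: algebra_simps power2_eq_square)
  then have "c * ((z\<^sup>2 - 1) * poly ((pderiv ^^ Suc (Suc (k + l))) ?w) z) =
     c * (- 2 * (real k + 1) * z * poly ((pderiv ^^ Suc (k + l)) ?w) z +
     (real l + real k + 1) * (real l - real k) * poly ((pderiv ^^ (k + l)) ?w) z)" by simp
  then show ?thesis unfolding legendre_deriv by (simp only: add_Suc) (simp add: algebra_simps)
qed

lemma legendre_deriv_Suc_degree: "legendre_deriv l (Suc l) z = 0"
proof -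
  have "degree ([:-1, 0, 1:] ^ l :: real poly) = 2 * l"
    by (simp add: degree_power_eq)
  then have "degree ((pderiv ^^ l) (legendre_poly l)) = 0"
    by (simp add: degree_higher_pderiv legendre_poly_def)
  then have "(pderiv ^^ Suc l) (legendre_poly l) = 0"
    by (simp add: pderiv_eq_0_iff)
  then show ?thesis by (simp only: legendre_deriv_def) simp
qed

text \<open>The free cofactor \<open>q\<close> carries the induction: one derivative of (z -
  1)^(n+1) q leaves (z - 1)^n times a cofactor whose value at 1 is (n + 1) q(1).\<close>

lemma pderiv_funpow_root_power:
  "poly ((pderiv ^^ n) ([:-1, 1:] ^ n * q)) 1 = fact n * poly q (1::real)"
proof (induction n arbitrary: q)
  case (Suc n)
  have "pderiv ([:-1, 1:] ^ Suc n * q) =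
      [:-1, 1:] ^ n * (smult (real (Suc n)) q + [:-1, 1:] * pderiv q)"
    by (simp only: poly_eq_poly_eq_iff[symmetric] fun_eq_iff pderiv_mult pderiv_power_Suc)
       (simp add: pderiv_pCons algebra_simps)
  then show ?case using Suc by (simp add: funpow_Suc_right del: funpow.simps power_Suc)
qed simp

lemma legendre_deriv_0_1: "legendre_deriv l 0 1 = 1"
proof -
  have "[:-1, 0, 1:] ^ l = ([:-1, 1:] ^ l * [:1, 1:] ^ l :: real poly)"
    by (simp add: power_mult_distrib[symmetric])
  then show ?thesis
    by (simp add: legendre_deriv_def legendre_poly_def pderiv_funpow_root_power)
qed

text \<open>The factor \<open>c\<close> of \<open>sph_harm\<close>, without the
  \<open>sqrt 2\<close> of the orders m \<noteq> 0.\<close>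

definition sph_norm :: "nat \<Rightarrow> nat \<Rightarrow> real" where
  "sph_norm l k = sqrt ((2 * real l + 1) / (4 * pi) * fact (l - k) / fact (l + k))"

text \<open>Matrix entry of the angular momentum ladder operators between orders \<open>k\<close> and \<open>k + 1\<close>.\<close>

definition ladder :: "nat \<Rightarrow> nat \<Rightarrow> real" where
  "ladder l k = sqrt ((real l + real k + 1) * (real l - real k))"

lemma sph_norm_ladder:
  assumes "k < l" shows "sph_norm l k = ladder l k * sph_norm l (Suc k)"
proof -
  have 1: "fact (l - k) = (real l - real k) * (fact (l - Suc k) :: real)"
    using assms by (simp add: Suc_diff_Suc[symmetric] of_nat_diff)
  have 2: "fact (l + Suc k) = (real l + real k + 1) * (fact (l + k) :: real)"
    by simp
  have "(real l + real k + 1) * (real l - real k) * ((2 * real l + 1) / (4 * pi) * fact (l - Suc k) / fact (l + Suc k))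
    = (2 * real l + 1) / (4 * pi) * fact (l - k) / (fact (l + k)::real)"
    unfolding 1 2 using add_pos_nonneg[of "real l + 1" "real k"] by (simp add: divide_simps)
  then show ?thesis unfolding sph_norm_def ladder_def by (simp add: real_sqrt_mult[symmetric])
qed

lemma ladder_sq: "k \<le> l \<Longrightarrow> (ladder l k)\<^sup>2 = (real l + real k + 1) * (real l - real k)"
  unfolding ladder_def by simp

lemma ladder_bound: "k \<le> l \<Longrightarrow> 0 \<le> ladder l k \<and> ladder l k \<le> 2 * (real l + 1)"
proof -
  assume "k \<le> l"
  then have "(real l + real k + 1) * (real l - real k) \<le> (2 * (real l + 1)) * (2 * (real l + 1))"
    by (intro mult_mono) auto
  then show ?thesis using \<open>k \<le> l\<close> unfolding ladder_def
    by (auto intro!: real_le_lsqrt simp: power2_eq_square)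
qed

text \<open>At height z on the sphere, 1 - z^2 is the squared modulus of x1 + i x2, so this is the
  squared modulus of the complex harmonic of order k. For k > 0 the real orders k and -k together
  contribute twice this value.\<close>

definition sph_energy :: "nat \<Rightarrow> nat \<Rightarrow> real \<Rightarrow> real" where
  "sph_energy l k z = (sph_norm l k)\<^sup>2 * (legendre_deriv l k z)\<^sup>2 * (1 - z\<^sup>2) ^ k"

text \<open>The derivative telescopes in \<open>k\<close>; this is why the sum of squares is constant on the sphere.\<close>

lemma DERIV_sph_energy:
  fixes l z
  defines "v \<equiv> (\<lambda>k. (sph_norm l k)\<^sup>2 * (1 - z\<^sup>2) ^ k * legendre_deriv l k z * legendre_deriv l (Suc k) z)"
  assumes "k < l"
  shows "(sph_energy l (Suc k) has_real_derivative v (Suc k) - v k) (at z)"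
proof -
  have n: "(sph_norm l k)\<^sup>2 = (real l + real k + 1) * (real l - real k) * (sph_norm l (Suc k))\<^sup>2"
    using sph_norm_ladder[OF assms(2)] ladder_sq[of k l] assms(2) by (simp add: power_mult_distrib)
  have "(sph_energy l (Suc k) has_real_derivative
     (sph_norm l (Suc k))\<^sup>2 * (2 * legendre_deriv l (Suc k) z * legendre_deriv l (Suc (Suc k)) z * (1 - z\<^sup>2) ^ Suc k
        + (legendre_deriv l (Suc k) z)\<^sup>2 * (real (Suc k) * (1 - z\<^sup>2) ^ k * (- 2 * z)))) (at z)"
    unfolding sph_energy_def
    by (rule derivative_eq_intros DERIV_legendre_deriv refl | simp add: algebra_simps)+
  moreover have "(sph_norm l (Suc k))\<^sup>2 * (2 * legendre_deriv l (Suc k) z * legendre_deriv l (Suc (Suc k)) z * (1 - z\<^sup>2) ^ Suc k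
        + (legendre_deriv l (Suc k) z)\<^sup>2 * (real (Suc k) * (1 - z\<^sup>2) ^ k * (- 2 * z)))
     = v (Suc k) - v k"
  proof -
    define N where "N = (sph_norm l (Suc k))\<^sup>2"
    have ode: "(real l + real k + 1) * (real l - real k) * legendre_deriv l k z
       = (z\<^sup>2 - 1) * legendre_deriv l (Suc (Suc k)) z + 2 * (real k + 1) * z * legendre_deriv l (Suc k) z"
      using legendre_deriv_ode[of z l k] by (simp add: algebra_simps)
    \<comment> \<open>The relation between consecutive normalisations produces exactly the
      coefficient of the lowest order in the differential equation, which then eliminates
      \<open>legendre_deriv l k z\<close>.\<close>
    have "v k = N * (1 - z\<^sup>2) ^ k * legendre_deriv l (Suc k) z *
        ((real l + real k + 1) * (real l - real k) * legendre_deriv l k z)"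
      unfolding v_def n N_def by (simp add: algebra_simps)
    then have "v k = N * (1 - z\<^sup>2) ^ k * legendre_deriv l (Suc k) z *
        ((z\<^sup>2 - 1) * legendre_deriv l (Suc (Suc k)) z + 2 * (real k + 1) * z * legendre_deriv l (Suc k) z)"
      unfolding ode .
    then show ?thesis unfolding v_def N_def by (simp add: algebra_simps power2_eq_square)
  qed
  ultimately show ?thesis by simp
qed

text \<open>After telescoping the derivative is \<open>2 * v l\<close>, which contains derivative l
  + 1 of a polynomial of degree l and so vanishes. The left side is therefore constant on the whole
  line, and at z = 1 only order 0 survives.\<close>

lemma sph_energy_sum:
  "sph_energy l 0 z + 2 * (\<Sum>k<l. sph_energy l (Suc k) z) = (2 * real l + 1) / (4 * pi)"
proof -
  define f where "f z = sph_energy l 0 z + 2 * (\<Sum>k<l. sph_energy l (Suc k) z)" for z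
  have "(f has_real_derivative 0) (at z)" for z
  proof -
    define v where "v = (\<lambda>k. (sph_norm l k)\<^sup>2 * (1 - z\<^sup>2) ^ k * legendre_deriv l k z * legendre_deriv l (Suc k) z)"
    have "(sph_energy l 0 has_real_derivative 2 * v 0) (at z)"
      unfolding sph_energy_def v_def
      by (rule derivative_eq_intros DERIV_legendre_deriv refl | simp add: algebra_simps)+
    moreover have "((\<lambda>z. \<Sum>k<l. sph_energy l (Suc k) z) has_real_derivative (\<Sum>k<l. v (Suc k) - v k)) (at z)"
      by (intro DERIV_sum) (use DERIV_sph_energy in \<open>auto simp: v_def\<close>)
    ultimately have "(f has_real_derivative 2 * v 0 + 2 * (\<Sum>k<l. v (Suc k) - v k)) (at z)"
      unfolding f_def by (intro DERIV_add DERIV_cmult)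
    moreover have "v l = 0" by (simp add: v_def legendre_deriv_Suc_degree)
    ultimately show ?thesis by (simp add: sum_lessThan_telescope)
  qed
  then have "f z = f 1" using DERIV_isconst_all by blast
  also have "f 1 = (2 * real l + 1) / (4 * pi)"
    by (simp add: f_def sph_energy_def legendre_deriv_0_1 sph_norm_def)
  finally show ?thesis by (simp add: f_def)
qed

lemma sph_harm_eq:
  "sph_harm l m x = (if m = 0 then sph_norm l 0 * legendre_deriv l 0 (x$3)
     else if m > 0 then sqrt 2 * sph_norm l (nat m) * legendre_deriv l (nat m) (x$3) * Re (Complex (x$1) (x$2) ^ nat m)
     else sqrt 2 * sph_norm l (nat (-m)) * legendre_deriv l (nat (-m)) (x$3) * Im (Complex (x$1) (x$2) ^ nat (-m)))"
  by (auto simp: sph_harm_def Let_def sph_norm_def legendre_deriv_def abs_if)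

lemma sum_int_symmetric:
  fixes f :: "int \<Rightarrow> real"
  shows "(\<Sum>m\<in>{- int l..int l}. f m) = f 0 + (\<Sum>k<l. f (int (Suc k)) + f (- int (Suc k)))"
proof (induction l)
  case (Suc l)
  have "{- int (Suc l)..int (Suc l)} = insert (int (Suc l)) (insert (- int (Suc l)) {- int l..int l})"
    by auto
  then show ?case using Suc by (simp add: algebra_simps)
qed simp

text \<open>The addition theorem on the diagonal. The orders k and -k carry the real and imaginary
  part of the same complex power, so their squares add up to a function of x3 alone.\<close>

lemma sum_sph_harm_sq:
  assumes "x \<in> S2"
  shows "(\<Sum>m\<in>{- int l..int l}. (sph_harm l m x)\<^sup>2) = (2 * real l + 1) / (4 * pi)"
proof -
  let ?p = "Complex (x$1) (x$2)"
  have *: "(Re (?p ^ k))\<^sup>2 + (Im (?p ^ k))\<^sup>2 = (1 - (x$3)\<^sup>2) ^ k" for k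
  proof -
    have "(Re (?p ^ k))\<^sup>2 + (Im (?p ^ k))\<^sup>2 = ((cmod ?p)\<^sup>2) ^ k"
      by (simp add: cmod_power2[symmetric] norm_power power_mult[symmetric] mult.commute)
    moreover have "(cmod ?p)\<^sup>2 = 1 - (x$3)\<^sup>2"
      using assms by (simp add: cmod_power2 S2_def algebra_simps)
    ultimately show ?thesis by simp
  qed
  have "(sph_harm l (int (Suc k)) x)\<^sup>2 + (sph_harm l (- int (Suc k)) x)\<^sup>2 = 2 * sph_energy l (Suc k) (x$3)" for k
  proof -
    have "(sph_harm l (int (Suc k)) x)\<^sup>2 + (sph_harm l (- int (Suc k)) x)\<^sup>2
      = 2 * (sph_norm l (Suc k))\<^sup>2 * (legendre_deriv l (Suc k) (x$3))\<^sup>2 * ((Re (?p ^ Suc k))\<^sup>2 + (Im (?p ^ Suc k))\<^sup>2)"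
      unfolding sph_harm_eq nat_int minus_minus by (simp add: power_mult_distrib algebra_simps del: power_Suc)
    then show ?thesis unfolding * sph_energy_def by (simp add: algebra_simps)
  qed
  then show ?thesis
    unfolding sum_int_symmetric using sph_energy_sum[of l "x$3"]
    by (simp add: sum_distrib_left sph_harm_eq[of l 0] sph_energy_def power_mult_distrib)
qed

section \<open>Rotation fields and derivatives of all orders\<close>

text \<open>Complex harmonic of order k \<ge> 0 as a polynomial function on all of R^3. In complex
  form the rotations act by raising and lowering the order.\<close>

definition sph_W :: "nat \<Rightarrow> nat \<Rightarrow> real^3 \<Rightarrow> complex" where
  "sph_W l k x = of_real (sph_norm l k * legendre_deriv l k (x$3)) * Complex (x$1) (x$2) ^ k"

text \<open>The truncated exponent \<open>k - 1\<close> is harmless at k = 0 because of the factor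
  \<open>of_nat k\<close>.\<close>

definition sph_dW :: "nat \<Rightarrow> nat \<Rightarrow> real^3 \<Rightarrow> real^3 \<Rightarrow> complex" where
  "sph_dW l k x h = of_real (sph_norm l k * legendre_deriv l (Suc k) (x$3) * h$3) * Complex (x$1) (x$2) ^ k +
     of_real (sph_norm l k * legendre_deriv l k (x$3)) *
       (of_nat k * Complex (h$1) (h$2) * Complex (x$1) (x$2) ^ (k - 1))"

lemma sph_W_has_derivative: "(sph_W l k has_derivative sph_dW l k x) (at x)"
proof -
  have "linear (\<lambda>h::real^3. Complex (h$1) (h$2))"
    by (rule linearI) (simp_all add: complex_eq_iff)
  then have 1: "((\<lambda>y. Complex (y$1) (y$2)) has_derivative (\<lambda>h. Complex (h$1) (h$2))) (at x)"
    by (simp add: linear_conv_bounded_linear bounded_linear_imp_has_derivative)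
  have "((\<lambda>y. y$3) has_derivative (\<lambda>h. h$3)) (at x)"
    by (intro bounded_linear_imp_has_derivative bounded_linear_vec_nth)
  from has_derivative_compose[OF this, of "legendre_deriv l k" "\<lambda>t. legendre_deriv l (Suc k) (x$3) * t"]
  have 2: "((\<lambda>y. legendre_deriv l k (y$3)) has_derivative (\<lambda>h. legendre_deriv l (Suc k) (x$3) * h$3)) (at x)"
    using DERIV_legendre_deriv[of l k "x$3"] by (simp add: has_field_derivative_def)
  show ?thesis
    unfolding sph_W_def[abs_def] sph_dW_def[abs_def]
    by (rule has_derivative_eq_rhs,
        (rule has_derivative_mult has_derivative_power has_derivative_of_real has_derivative_const 1 2)+)
      (simp add: algebra_simps)
qed

lemma sph_harm_sph_W:
  "sph_harm l m x = (if m = 0 then Re (sph_W l 0 x) else if m > 0 then sqrt 2 * Re (sph_W l (nat m) x)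
     else sqrt 2 * Im (sph_W l (nat (- m)) x))"
  by (simp add: sph_harm_eq sph_W_def)

definition sph_dharm :: "nat \<Rightarrow> int \<Rightarrow> real^3 \<Rightarrow> real^3 \<Rightarrow> real" where
  "sph_dharm l m x h = (if m = 0 then Re (sph_dW l 0 x h) else if m > 0 then sqrt 2 * Re (sph_dW l (nat m) x h)
     else sqrt 2 * Im (sph_dW l (nat (- m)) x h))"

lemma sph_harm_has_derivative: "(sph_harm l m has_derivative sph_dharm l m x) (at x)"
proof -
  have R: "((\<lambda>x. Re (sph_W l k x)) has_derivative (\<lambda>h. Re (sph_dW l k x h))) (at x)"
    and I: "((\<lambda>x. Im (sph_W l k x)) has_derivative (\<lambda>h. Im (sph_dW l k x h))) (at x)" for k
    using has_derivative_Re has_derivative_Im sph_W_has_derivative by blast+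
  show ?thesis
    unfolding sph_harm_sph_W[abs_def] sph_dharm_def[abs_def]
    by (cases "m = 0"; cases "m > 0") (auto intro!: R I has_derivative_mult_right)
qed

text \<open>Velocity field of the rotation about axis b. It is tangent to the sphere, and
  differentiating along it does not change the degree of a harmonic.\<close>

definition rot_field :: "3 \<Rightarrow> real^3 \<Rightarrow> real^3" where
  "rot_field b x = cross3 (axis b 1) x"

lemma rot_field_nth:
  "rot_field 1 x $ 1 = 0" "rot_field 1 x $ 2 = - x$3" "rot_field 1 x $ 3 = x$2"
  "rot_field 2 x $ 1 = x$3" "rot_field 2 x $ 2 = 0" "rot_field 2 x $ 3 = - x$1"
  "rot_field 3 x $ 1 = - x$2" "rot_field 3 x $ 2 = x$1" "rot_field 3 x $ 3 = 0"
  by (simp_all add: rot_field_def cross3_def axis_def)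

text \<open>For k < l this is \<open>sph_norm_ladder\<close>; at k = l both sides vanish.\<close>

lemma ladder_sph_W_up:
  assumes "k \<le> l"
  shows "of_real (ladder l k) * sph_W l (Suc k) x
    = of_real (sph_norm l k * legendre_deriv l (Suc k) (x$3)) * Complex (x$1) (x$2) ^ Suc k"
proof (cases "k = l")
  case True then show ?thesis by (simp add: sph_W_def legendre_deriv_Suc_degree)
next
  case False then show ?thesis using assms by (simp add: sph_W_def sph_norm_ladder[of k l])
qed

text \<open>The differential equation replaces derivative k by derivatives k + 1 and k + 2, which
  are the ones that occur when \<open>sph_W l (Suc k)\<close> is differentiated.\<close>

lemma ladder_sph_W_down:
  assumes "k < l"
  shows "of_real (ladder l k) * sph_W l k x
    = of_real (sph_norm l (Suc k) * (((x$3)\<^sup>2 - 1) * legendre_deriv l (Suc (Suc k)) (x$3) +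
         2 * (real k + 1) * x$3 * legendre_deriv l (Suc k) (x$3))) * Complex (x$1) (x$2) ^ k"
proof -
  have "((x$3)\<^sup>2 - 1) * legendre_deriv l (Suc (Suc k)) (x$3) + 2 * (real k + 1) * x$3 * legendre_deriv l (Suc k) (x$3)
    = (ladder l k)\<^sup>2 * legendre_deriv l k (x$3)"
    using legendre_deriv_ode[of "x$3" l k] assms by (simp add: ladder_sq algebra_simps)
  then show ?thesis using assms by (simp add: sph_W_def sph_norm_ladder[of k l] power2_eq_square)
qed

lemma sph_dW_rot3: "sph_dW l k x (rot_field 3 x) = \<i> * of_nat k * sph_W l k x"
proof -
  have "Complex (- x$2) (x$1) = \<i> * Complex (x$1) (x$2)" by (simp add: complex_eq_iff)
  then show ?thesis by (cases k) (simp_all add: sph_dW_def sph_W_def rot_field_nth)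
qed

text \<open>Up to constants, the two horizontal rotations are the half sum and the half difference
  of raising and lowering. The sphere enters through x3^2 - 1 = - (x1^2 + x2^2).\<close>

lemma sph_dW_rot12:
  assumes x: "x \<in> S2" and k: "Suc k \<le> l"
  shows "sph_dW l (Suc k) x (rot_field 1 x) = - (\<i> / 2) *
      (of_real (ladder l (Suc k)) * sph_W l (Suc (Suc k)) x + of_real (ladder l k) * sph_W l k x)" (is ?A)
    and "sph_dW l (Suc k) x (rot_field 2 x) = - (1 / 2) *
      (of_real (ladder l (Suc k)) * sph_W l (Suc (Suc k)) x - of_real (ladder l k) * sph_W l k x)" (is ?B)
proof -
  have z: "(x$3)\<^sup>2 - 1 = - (x$1 * x$1 + x$2 * x$2)"
    using x by (simp add: S2_def power2_eq_square algebra_simps)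
  have kl: "k < l" using k by simp
  show ?A
    unfolding ladder_sph_W_up[OF k] ladder_sph_W_down[OF kl] z
    unfolding sph_dW_def rot_field_nth Complex_eq diff_Suc_1
    by (simp add: algebra_simps)
  show ?B
    unfolding ladder_sph_W_up[OF k] ladder_sph_W_down[OF kl] z
    unfolding sph_dW_def rot_field_nth Complex_eq diff_Suc_1
    by (simp add: algebra_simps)
qed

text \<open>Lowering from order 0 would lead to order -1, which up to sign is the conjugate of order
  1. So only the real or the imaginary part of \<open>sph_W l 1\<close> remains.\<close>

lemma sph_dW_0_rot12:
  shows "sph_dW l 0 x (rot_field 1 x) = of_real (ladder l 0 * Im (sph_W l 1 x))"
    and "sph_dW l 0 x (rot_field 2 x) = - of_real (ladder l 0 * Re (sph_W l 1 x))"
proof -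
  have "of_real (ladder l 0) * sph_W l 1 x = of_real (sph_norm l 0 * legendre_deriv l 1 (x$3)) * Complex (x$1) (x$2)"
    using ladder_sph_W_up[of 0 l x] by simp
  then have "Re (of_real (ladder l 0) * sph_W l 1 x) = Re (of_real (sph_norm l 0 * legendre_deriv l 1 (x$3)) * Complex (x$1) (x$2))"
   "Im (of_real (ladder l 0) * sph_W l 1 x) = Im (of_real (sph_norm l 0 * legendre_deriv l 1 (x$3)) * Complex (x$1) (x$2))"
    by metis+
  then show "sph_dW l 0 x (rot_field 1 x) = of_real (ladder l 0 * Im (sph_W l 1 x))"
    and "sph_dW l 0 x (rot_field 2 x) = - of_real (ladder l 0 * Re (sph_W l 1 x))"
    by (simp_all add: sph_dW_def rot_field_nth complex_eq_iff)
qed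

text \<open>
  Rotation about axis \<open>b\<close> maps the real harmonic of order \<open>m\<close> to a combination of at most two others,
  of orders \<open>rot_up_ix b m\<close> and \<open>rot_down_ix b m\<close>. Case distinctions at \<open>m = 0\<close> and \<open>|m| = 1\<close> come
  from the factor \<open>sqrt 2\<close> that is missing in the normalisation at \<open>m = 0\<close>.
\<close>

definition step_up :: "int \<Rightarrow> int" where "step_up m = (if m \<ge> 0 then m + 1 else m - 1)"
definition step_down :: "int \<Rightarrow> int" where "step_down m = m - sgn m"

definition rot_up :: "3 \<Rightarrow> nat \<Rightarrow> int \<Rightarrow> real" where
  "rot_up b l m = (if b = 3 then - of_int m
     else (if b = 1 \<and> m \<ge> 0 then 1 else -1) * ladder l (nat \<bar>m\<bar>) / (if m = 0 then sqrt 2 else 2))"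

definition rot_up_ix :: "3 \<Rightarrow> int \<Rightarrow> int" where
  "rot_up_ix b m = (if b = 3 then - m else if b = 1 then - step_up m else step_up m)"

definition rot_down :: "3 \<Rightarrow> nat \<Rightarrow> int \<Rightarrow> real" where
  "rot_down b l m = (if b = 3 \<or> m = 0 \<or> (b = 1 \<and> m = 1) \<or> (b = 2 \<and> m = -1) then 0
     else (if b = 1 \<and> m < 0 then -1 else 1) * ladder l (nat \<bar>m\<bar> - 1) / (if \<bar>m\<bar> = 1 then sqrt 2 else 2))"

definition rot_down_ix :: "3 \<Rightarrow> int \<Rightarrow> int" where
  "rot_down_ix b m = (if b = 1 then - step_down m else step_down m)"

text \<open>Real and imaginary parts of the ladder formulas. Rotations about axes 1 and 3 carry a
  factor i and exchange the cosine and sine families, hence the sign changes in the index maps.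
  Lowering from |m| = 1 ends at order 0, whose imaginary part is zero and whose normalisation lacks
  \<open>sqrt 2\<close>; this is the separate case \<open>k = 0\<close>.\<close>

lemma sph_dharm_rot:
  assumes x: "x \<in> S2" and m: "\<bar>m\<bar> \<le> int l"
  shows "sph_dharm l m x (rot_field b x) =
    rot_up b l m * sph_harm l (rot_up_ix b m) x + rot_down b l m * sph_harm l (rot_down_ix b m) x"
proof -
  have s2: "sqrt 2 * (sqrt 2 * a) = 2 * a" for a :: real by simp
  consider "m = 0" | k where "m = int (Suc k)" | k where "m = - int (Suc k)"
    by (metis int_cases3 gr0_conv_Suc)
  then show ?thesis
  proof cases
    case 1
    then show ?thesis using exhaust_3[of b] sph_dW_0_rot12[of l x] sph_dW_rot3[of l 0 x]
      by (auto simp: sph_dharm_def rot_up_def rot_up_ix_def rot_down_def rot_down_ix_def step_up_def step_down_def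
          sph_harm_sph_W)
  next
    case (2 k)
    have m': "m \<noteq> 0" "m > 0" "\<not> m < 0" "nat m = Suc k" "nat \<bar>m\<bar> = Suc k" "Suc k \<le> l" using 2 m by auto
    have d: "Re (sph_dW l (Suc k) x (rot_field 1 x)) = (ladder l (Suc k) * Im (sph_W l (Suc (Suc k)) x) + ladder l k * Im (sph_W l k x)) / 2"
      "Im (sph_dW l (Suc k) x (rot_field 1 x)) = - (ladder l (Suc k) * Re (sph_W l (Suc (Suc k)) x) + ladder l k * Re (sph_W l k x)) / 2"
      "Re (sph_dW l (Suc k) x (rot_field 2 x)) = - (ladder l (Suc k) * Re (sph_W l (Suc (Suc k)) x) - ladder l k * Re (sph_W l k x)) / 2"
      "Im (sph_dW l (Suc k) x (rot_field 2 x)) = - (ladder l (Suc k) * Im (sph_W l (Suc (Suc k)) x) - ladder l k * Im (sph_W l k x)) / 2"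
      using sph_dW_rot12[OF x m'(6)] by (simp_all add: add_divide_distrib diff_divide_distrib)
    consider "b = 3" | "b = 1 \<or> b = 2" "k = 0" | j where "b = 1 \<or> b = 2" "k = Suc j"
      using exhaust_3[of b] by (cases k) auto
    then show ?thesis
    proof cases
      case 1
      then show ?thesis using m' sph_dW_rot3[of l "Suc k" x]
        by (simp add: sph_dharm_def rot_up_def rot_up_ix_def rot_down_def sph_harm_sph_W, simp add: 2 algebra_simps)
    next
      case b: 2
      have "Im (sph_W l 0 x) = 0" by (simp add: sph_W_def)
      then show ?thesis using b m' d
        by (auto simp: sph_dharm_def rot_up_def rot_up_ix_def rot_down_def rot_down_ix_def step_up_def
          step_down_def sph_harm_sph_W 2 nat_add_distrib field_simps numeral_2_eq_2 s2)
    next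
      case b: (3 j)
      have "sph_W l (j + 3) x = sph_W l (Suc (Suc (Suc j))) x" by (simp add: numeral_3_eq_3)
      then show ?thesis using m' b
        by (auto simp: sph_dharm_def rot_up_def rot_up_ix_def rot_down_def rot_down_ix_def step_up_def
          step_down_def sph_harm_sph_W 2 nat_add_distrib d[unfolded b(2)])
          (simp_all add: field_simps)
    qed
  next
    case (3 k)
    have m': "m \<noteq> 0" "m < 0" "\<not> m > 0" "nat (-m) = Suc k" "nat \<bar>m\<bar> = Suc k" "Suc k \<le> l" using 3 m by auto
    have d: "Re (sph_dW l (Suc k) x (rot_field 1 x)) = (ladder l (Suc k) * Im (sph_W l (Suc (Suc k)) x) + ladder l k * Im (sph_W l k x)) / 2"
      "Im (sph_dW l (Suc k) x (rot_field 1 x)) = - (ladder l (Suc k) * Re (sph_W l (Suc (Suc k)) x) + ladder l k * Re (sph_W l k x)) / 2"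
      "Re (sph_dW l (Suc k) x (rot_field 2 x)) = - (ladder l (Suc k) * Re (sph_W l (Suc (Suc k)) x) - ladder l k * Re (sph_W l k x)) / 2"
      "Im (sph_dW l (Suc k) x (rot_field 2 x)) = - (ladder l (Suc k) * Im (sph_W l (Suc (Suc k)) x) - ladder l k * Im (sph_W l k x)) / 2"
      using sph_dW_rot12[OF x m'(6)] by (simp_all add: add_divide_distrib diff_divide_distrib)
    consider "b = 3" | "b = 1 \<or> b = 2" "k = 0" | j where "b = 1 \<or> b = 2" "k = Suc j"
      using exhaust_3[of b] by (cases k) auto
    then show ?thesis
    proof cases
      case 1
      then show ?thesis using m' sph_dW_rot3[of l "Suc k" x]
        by (simp add: sph_dharm_def rot_up_def rot_up_ix_def rot_down_def sph_harm_sph_W, simp add: 3 algebra_simps)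
    next
      case b: 2
      have "Im (sph_W l 0 x) = 0" by (simp add: sph_W_def)
      then show ?thesis using b m'
        by (auto simp: sph_dharm_def rot_up_def rot_up_ix_def rot_down_def rot_down_ix_def step_up_def
          step_down_def sph_harm_sph_W 3 nat_add_distrib numeral_2_eq_2 d[unfolded b(2)])
          (simp_all add: field_simps s2)
    next
      case b: (3 j)
      have "sph_W l (j + 3) x = sph_W l (Suc (Suc (Suc j))) x" by (simp add: numeral_3_eq_3)
      then show ?thesis using m' b
        by (auto simp: sph_dharm_def rot_up_def rot_up_ix_def rot_down_def rot_down_ix_def step_up_def
          step_down_def sph_harm_sph_W 3 nat_add_distrib d[unfolded b(2)])
          (simp_all add: field_simps)
    qed
  qed
qed

section \<open>A class of functions closed under partial derivatives\<close>

text \<open>What a weighted change of index needs in order to cost a factor O(l): weights of that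
  size that vanish when the index leaves -l..l, and an index map that hits no value too often.
  Injectivity is required on positive and on negative indices separately, since
  \<open>step_down\<close> sends both 1 and -1 to 0.\<close>

definition shift_ok :: "(nat \<Rightarrow> int \<Rightarrow> real) \<Rightarrow> (int \<Rightarrow> int) \<Rightarrow> bool" where
  "shift_ok u f \<longleftrightarrow> (\<forall>l m. \<bar>m\<bar> \<le> int l \<longrightarrow> \<bar>f m\<bar> > int l \<longrightarrow> u l m = 0) \<and>
     (\<exists>C. \<forall>l m. \<bar>m\<bar> \<le> int l \<longrightarrow> \<bar>u l m\<bar> \<le> C * (real l + 1)) \<and>
     inj_on f {0<..} \<and> inj_on f {..<0}"

lemma ladder_self [simp]: "ladder l l = 0" by (simp add: ladder_def)

text \<open>The index leaves the range only when it is raised from |m| = l, where the weight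
  contains \<open>ladder l l = 0\<close>.\<close>

lemma shift_ok_rot_up: "shift_ok (rot_up b) (rot_up_ix b)"
  unfolding shift_ok_def
proof (intro conjI exI[of _ 2] allI impI)
  fix l m assume m: "\<bar>m\<bar> \<le> int l"
  show "rot_up b l m = 0" if "\<bar>rot_up_ix b m\<bar> > int l"
  proof -
    have "b \<noteq> 3" "nat \<bar>m\<bar> = l" using that m
      by (auto simp: rot_up_ix_def step_up_def split: if_splits)
    then show ?thesis by (simp add: rot_up_def)
  qed
  have k: "nat \<bar>m\<bar> \<le> l" using m by simp
  have "\<bar>real_of_int m\<bar> \<le> real l" using m by linarith
  moreover have "1 \<le> sqrt 2" by simp
  moreover have "ladder l (nat \<bar>m\<bar>) / sqrt 2 \<le> ladder l (nat \<bar>m\<bar>) / 1"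
    using ladder_bound[OF k] by (intro divide_left_mono) auto
  ultimately show "\<bar>rot_up b l m\<bar> \<le> 2 * (real l + 1)"
    using ladder_bound[OF k] by (auto simp: rot_up_def abs_mult)
qed (auto simp: inj_on_def rot_up_ix_def step_up_def)

lemma shift_ok_rot_down: "shift_ok (rot_down b) (rot_down_ix b)"
  unfolding shift_ok_def
proof (intro conjI exI[of _ 2] allI impI)
  fix l m assume m: "\<bar>m\<bar> \<le> int l"
  show "rot_down b l m = 0" if "\<bar>rot_down_ix b m\<bar> > int l"
    using that m by (auto simp: rot_down_ix_def step_down_def sgn_if split: if_splits)
  have k: "nat \<bar>m\<bar> - 1 \<le> l" using m by simp
  have "1 \<le> sqrt 2" by simp
  moreover have "ladder l (nat \<bar>m\<bar> - 1) / sqrt 2 \<le> ladder l (nat \<bar>m\<bar> - 1) / 1"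
    using ladder_bound[OF k] by (intro divide_left_mono) auto
  ultimately show "\<bar>rot_down b l m\<bar> \<le> 2 * (real l + 1)"
    using ladder_bound[OF k] by (auto simp: rot_down_def abs_mult)
qed (auto simp: inj_on_def rot_down_ix_def step_down_def)

text \<open>Makes division by the norm a special shift, so that a term of lower growth can be placed
  in the next class.\<close>

lemma shift_ok_id: "shift_ok (\<lambda>l m. 1) (\<lambda>m. m)"
  unfolding shift_ok_def by (auto intro!: exI[of _ 1] inj_onI)

definition sph_ext :: "nat \<Rightarrow> int \<Rightarrow> real^3 \<Rightarrow> real" where
  "sph_ext l m y = sph_harm l m (y /\<^sub>R norm y)"

text \<open>
  Families of functions, homogeneous of degree \<open>-k\<close> and of size \<open>O(l^k)\<close> relative to the harmonics,
  that are generated from the extended harmonics and closed under partial derivatives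
  (which raise \<open>k\<close> by one).
\<close>

inductive sph_sym :: "nat \<Rightarrow> (nat \<Rightarrow> int \<Rightarrow> real^3 \<Rightarrow> real) \<Rightarrow> bool" where
  base: "sph_sym 0 sph_ext"
| shift: "sph_sym k c \<Longrightarrow> shift_ok u f \<Longrightarrow> sph_sym (Suc k) (\<lambda>l m y. u l m * c l (f m) y / norm y)"
| coord: "sph_sym k c \<Longrightarrow> sph_sym k (\<lambda>l m y. y$a / norm y * c l m y)"
| add: "sph_sym k c \<Longrightarrow> sph_sym k d \<Longrightarrow> sph_sym k (\<lambda>l m y. c l m y + d l m y)"
| scale: "sph_sym k c \<Longrightarrow> sph_sym k (\<lambda>l m y. r * c l m y)"

lemma sph_sym_inv: "sph_sym k c \<Longrightarrow> sph_sym (Suc k) (\<lambda>l m y. c l m y / norm y)"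
  using sph_sym.shift[OF _ shift_ok_id] by simp

lemma sph_sym_diff: "sph_sym k c \<Longrightarrow> sph_sym k d \<Longrightarrow> sph_sym k (\<lambda>l m y. c l m y - d l m y)"
  using sph_sym.add[OF _ sph_sym.scale[of k d "-1"]] by simp

lemma S2_iff_norm: "x \<in> S2 \<longleftrightarrow> norm x = 1"
  by (simp add: S2_def norm_vec_def L2_set_def sum_3)

lemma sph_sym_homogeneous:
  assumes "sph_sym k c" "y \<noteq> 0"
  shows "c l m y = c l m (y /\<^sub>R norm y) / norm y ^ k"
  using assms
proof (induction arbitrary: l m rule: sph_sym.induct)
  case (shift k c u f)
  then show ?case using shift.IH[of l "f m"] by simp
next
  case (coord k c a)
  then show ?case using coord.IH[of l m] by (simp add: divide_inverse)
qed (simp_all add: sph_ext_def add_divide_distrib)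

text \<open>The positive indices, the negative indices and 0 are treated separately. On each of
  these sets \<open>f\<close> is injective, so the shifted sum is at most \<open>K\<close> times the
  full sum; the factor 3 counts the sets.\<close>

lemma sum_shift_le:
  assumes f: "inj_on f {0<..}" "inj_on f {..<0::int}" and g: "\<And>m. g m \<ge> (0::real)"
    and z: "\<And>m. \<bar>m\<bar> \<le> int l \<Longrightarrow> \<bar>f m\<bar> > int l \<Longrightarrow> h m = 0"
    and h: "\<And>m. \<bar>m\<bar> \<le> int l \<Longrightarrow> h m \<le> K * g (f m)" and K: "0 \<le> K"
  shows "(\<Sum>m\<in>{- int l..int l}. h m) \<le> 3 * K * (\<Sum>m\<in>{- int l..int l}. g m)"
proof -
  let ?I = "{- int l..int l}"
  have part: "(\<Sum>m\<in>P. h m) \<le> K * (\<Sum>m\<in>?I. g m)" if P: "P \<subseteq> ?I" "inj_on f P" for P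
  proof -
    let ?P = "{m\<in>P. f m \<in> ?I}"
    have fin: "finite P" using P finite_subset by blast
    have "(\<Sum>m\<in>P. h m) = (\<Sum>m\<in>?P. h m)"
      by (rule sum.mono_neutral_right) (use fin P z in force)+
    also have "\<dots> \<le> (\<Sum>m\<in>?P. K * g (f m))"
    proof (rule sum_mono, rule h)
      fix m assume "m \<in> ?P"
      then have "m \<in> ?I" using P by blast
      then show "\<bar>m\<bar> \<le> int l" by auto
    qed
    also have "\<dots> = K * (\<Sum>m\<in>f ` ?P. g m)"
      using inj_on_subset[OF P(2), of ?P] by (simp add: sum.reindex sum_distrib_left)
    also have "\<dots> \<le> K * (\<Sum>m\<in>?I. g m)"
      by (intro mult_left_mono sum_mono2) (use K g in auto)
    finally show ?thesis .
  qed
  define P N where "P = ?I \<inter> {0<..}" and "N = ?I \<inter> {..<0}"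
  have PN: "finite P" "finite N" "P \<inter> (N \<union> {0}) = {}" "N \<inter> {0} = {}" "P \<subseteq> ?I" "N \<subseteq> ?I"
    "P \<subseteq> {0<..}" "N \<subseteq> {..<0}" by (auto simp: P_def N_def)
  have "?I = P \<union> (N \<union> {0})" by (auto simp: P_def N_def)
  then have "(\<Sum>m\<in>?I. h m) = sum h (P \<union> (N \<union> {0}))" by metis
  also have "\<dots> = sum h P + (sum h N + sum h {0})"
    using PN by (simp add: sum.union_disjoint del: Un_insert_right)
  also have "\<dots> \<le> K * (\<Sum>m\<in>?I. g m) + (K * (\<Sum>m\<in>?I. g m) + K * (\<Sum>m\<in>?I. g m))"
    using PN by (intro add_mono part) (auto intro: inj_on_subset[OF f(1)] inj_on_subset[OF f(2)])
  finally show ?thesis by simp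
qed

text \<open>Induction over the generation of the class. The exponent starts at 1, from the sum of
  squares of the harmonics, and grows by 2 with each shift, whose squared weights are O(l^2).
  Coordinates y$a / norm y are bounded by 1 and cost nothing.\<close>

lemma sph_sym_bound:
  assumes "sph_sym k c"
  shows "\<exists>C\<ge>0. \<forall>l. \<forall>x\<in>S2. (\<Sum>m\<in>{- int l..int l}. (c l m x)\<^sup>2) \<le> C * (real l + 1) ^ (1 + 2 * k)"
  using assms
proof (induction rule: sph_sym.induct)
  case base
  have "(2 * real l + 1) / (4 * pi) \<le> 1 * (real l + 1)" for l
  proof -
    have "(2 * real l + 1) * 1 \<le> (real l + 1) * (4 * pi)"
      using mult_left_mono[of 2 "4 * pi" "real l + 1"] pi_ge_two by (simp add: distrib_right)
    then show ?thesis by (simp add: divide_simps mult.commute)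
  qed
  then show ?case
    by (intro exI[of _ 1]) (simp add: sph_ext_def S2_iff_norm sum_sph_harm_sq)
next
  case (shift k c u f)
  then obtain C where C: "C \<ge> 0" "\<And>l x. x \<in> S2 \<Longrightarrow> (\<Sum>m\<in>{- int l..int l}. (c l m x)\<^sup>2) \<le> C * (real l + 1) ^ (1 + 2 * k)"
    by blast
  from shift obtain D where u: "\<And>l m. \<bar>m\<bar> \<le> int l \<Longrightarrow> \<bar>f m\<bar> > int l \<Longrightarrow> u l m = 0"
    "\<And>l m. \<bar>m\<bar> \<le> int l \<Longrightarrow> \<bar>u l m\<bar> \<le> D * (real l + 1)" and f: "inj_on f {0<..}" "inj_on f {..<0}"
    unfolding shift_ok_def by blast
  have "(\<Sum>m\<in>{- int l..int l}. (u l m * c l (f m) x / norm x)\<^sup>2) \<le> 3 * D\<^sup>2 * C * (real l + 1) ^ (1 + 2 * Suc k)"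
    if x: "x \<in> S2" for l x
  proof -
    have "(\<Sum>m\<in>{- int l..int l}. (u l m * c l (f m) x / norm x)\<^sup>2)
      \<le> 3 * (D * (real l + 1))\<^sup>2 * (\<Sum>m\<in>{- int l..int l}. (c l m x)\<^sup>2)"
    proof (rule sum_shift_le[OF f])
      fix m assume m: "\<bar>m\<bar> \<le> int l"
      have "(u l m)\<^sup>2 \<le> (D * (real l + 1))\<^sup>2"
        using u(2)[OF m] by (rule abs_le_square_iff[THEN iffD1, OF order_trans]) simp
      then show "(u l m * c l (f m) x / norm x)\<^sup>2 \<le> (D * (real l + 1))\<^sup>2 * (c l (f m) x)\<^sup>2"
        using x by (simp add: S2_iff_norm power_mult_distrib mult_right_mono)
    qed (use u in auto)
    also have "\<dots> \<le> 3 * (D * (real l + 1))\<^sup>2 * (C * (real l + 1) ^ (1 + 2 * k))"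
      by (intro mult_left_mono C(2) x) auto
    also have "\<dots> = 3 * D\<^sup>2 * C * (real l + 1) ^ (1 + 2 * Suc k)"
      by (simp add: power_mult_distrib power2_eq_square algebra_simps)
    finally show ?thesis .
  qed
  then show ?case using C(1) by (intro exI[of _ "3 * D\<^sup>2 * C"]) auto
next
  case (coord k c a)
  then obtain C where C: "C \<ge> 0" "\<And>l x. x \<in> S2 \<Longrightarrow> (\<Sum>m\<in>{- int l..int l}. (c l m x)\<^sup>2) \<le> C * (real l + 1) ^ (1 + 2 * k)"
    by blast
  have "(\<Sum>m\<in>{- int l..int l}. (x$a / norm x * c l m x)\<^sup>2) \<le> C * (real l + 1) ^ (1 + 2 * k)"
    if x: "x \<in> S2" for l x
  proof -
    have "\<bar>x$a\<bar> \<le> 1" using component_le_norm_cart[of x a] x by (simp add: S2_iff_norm)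
    then have "(x$a)\<^sup>2 \<le> 1" by (simp add: abs_square_le_1)
    then have "(\<Sum>m\<in>{- int l..int l}. (x$a / norm x * c l m x)\<^sup>2) \<le> (\<Sum>m\<in>{- int l..int l}. (c l m x)\<^sup>2)"
      using x by (intro sum_mono) (simp add: S2_iff_norm power_mult_distrib mult_left_le_one_le)
    then show ?thesis using C(2)[OF x, of l] by linarith
  qed
  then show ?case using C(1) by blast
next
  case (add k c d)
  then obtain C D where C: "C \<ge> 0" "\<And>l x. x \<in> S2 \<Longrightarrow> (\<Sum>m\<in>{- int l..int l}. (c l m x)\<^sup>2) \<le> C * (real l + 1) ^ (1 + 2 * k)"
   and D: "D \<ge> 0" "\<And>l x. x \<in> S2 \<Longrightarrow> (\<Sum>m\<in>{- int l..int l}. (d l m x)\<^sup>2) \<le> D * (real l + 1) ^ (1 + 2 * k)"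
    by blast
  have "(\<Sum>m\<in>{- int l..int l}. (c l m x + d l m x)\<^sup>2) \<le> (2 * C + 2 * D) * (real l + 1) ^ (1 + 2 * k)"
    if x: "x \<in> S2" for l x
  proof -
    have "(\<Sum>m\<in>{- int l..int l}. (c l m x + d l m x)\<^sup>2) \<le> (\<Sum>m\<in>{- int l..int l}. 2 * (c l m x)\<^sup>2 + 2 * (d l m x)\<^sup>2)"
    proof (intro sum_mono)
      fix m show "(c l m x + d l m x)\<^sup>2 \<le> 2 * (c l m x)\<^sup>2 + 2 * (d l m x)\<^sup>2"
        using sum_squares_ge_zero[of "c l m x - d l m x" 0] by (simp add: power2_eq_square algebra_simps)
    qed
    also have "\<dots> = 2 * (\<Sum>m\<in>{- int l..int l}. (c l m x)\<^sup>2) + 2 * (\<Sum>m\<in>{- int l..int l}. (d l m x)\<^sup>2)"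
      by (simp add: sum.distrib sum_distrib_left)
    also have "\<dots> \<le> (2 * C + 2 * D) * (real l + 1) ^ (1 + 2 * k)"
      using C(2)[OF x, of l] D(2)[OF x, of l] by (simp add: distrib_right)
    finally show ?thesis .
  qed
  then show ?case using C(1) D(1) by (intro exI[of _ "2 * C + 2 * D"]) auto
next
  case (scale k c r)
  then obtain C where C: "C \<ge> 0" "\<And>l x. x \<in> S2 \<Longrightarrow> (\<Sum>m\<in>{- int l..int l}. (c l m x)\<^sup>2) \<le> C * (real l + 1) ^ (1 + 2 * k)"
    by blast
  have "(\<Sum>m\<in>{- int l..int l}. (r * c l m x)\<^sup>2) \<le> (r\<^sup>2 * C) * (real l + 1) ^ (1 + 2 * k)"
    if x: "x \<in> S2" for l x
    using mult_left_mono[OF C(2)[OF x, of l], of "r\<^sup>2"] by (simp add: power_mult_distrib sum_distrib_left algebra_simps)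
  then show ?case using C(1) by (intro exI[of _ "r\<^sup>2 * C"]) auto
qed

lemma has_derivative_normalize:
  fixes y :: "'a::real_inner"
  assumes "y \<noteq> 0"
  shows "((\<lambda>y. y /\<^sub>R norm y) has_derivative
     (\<lambda>h. (h - ((y /\<^sub>R norm y) \<bullet> h) *\<^sub>R (y /\<^sub>R norm y)) /\<^sub>R norm y)) (at y)"
  using assms
  by (auto intro!: derivative_eq_intros has_derivative_norm simp: fun_eq_iff algebra_simps sgn_div_norm inner_commute power2_eq_square)

text \<open>The derivative of y / norm y is the projection onto the tangent plane divided by the
  norm. With x = y / norm y the tangential part of h is (x \<times> h) \<times> x, hence a
  combination of the rotation fields with the entries of x \<times> h as coefficients, and
  \<open>sph_dharm_rot\<close> applies to each.\<close>

lemma sph_ext_has_derivative: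
  defines "L \<equiv> (\<lambda>b l m y. rot_up b l m * sph_ext l (rot_up_ix b m) y / norm y + rot_down b l m * sph_ext l (rot_down_ix b m) y / norm y)"
  assumes y: "y \<noteq> 0" and m: "\<bar>m\<bar> \<le> int l"
  shows "(sph_ext l m has_derivative (\<lambda>h.
      h$1 * (y$3 / norm y * L 2 l m y - y$2 / norm y * L 3 l m y) +
      h$2 * (y$1 / norm y * L 3 l m y - y$3 / norm y * L 1 l m y) +
      h$3 * (y$2 / norm y * L 1 l m y - y$1 / norm y * L 2 l m y))) (at y)"
proof -
  define x where "x = y /\<^sub>R norm y"
  have x: "x \<in> S2" using y by (simp add: S2_iff_norm x_def)
  have xn: "x$a = y$a / norm y" for a by (simp add: x_def field_simps)
  have Lb: "sph_dharm l m x (rot_field b x) = norm y * L b l m y" for b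
    using sph_dharm_rot[OF x m, of b] y by (simp add: L_def sph_ext_def x_def field_simps)
  have lin: "linear (sph_dharm l m x)"
    using sph_harm_has_derivative has_derivative_linear by blast
  have "(sph_ext l m has_derivative (\<lambda>h. sph_dharm l m x ((h - (x \<bullet> h) *\<^sub>R x) /\<^sub>R norm y))) (at y)"
    using has_derivative_compose[OF has_derivative_normalize[OF y], of "sph_harm l m"] sph_harm_has_derivative
    unfolding sph_ext_def x_def by blast
  moreover have "sph_dharm l m x ((h - (x \<bullet> h) *\<^sub>R x) /\<^sub>R norm y) =
      h$1 * (x$3 * L 2 l m y - x$2 * L 3 l m y) + h$2 * (x$1 * L 3 l m y - x$3 * L 1 l m y) +
      h$3 * (x$2 * L 1 l m y - x$1 * L 2 l m y)" for h
  proof -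
    have x2: "x$1 * x$1 + x$2 * x$2 + x$3 * x$3 = 1" using x by (simp add: S2_def power2_eq_square)
    have "h - (x \<bullet> h) *\<^sub>R x = (x$2 * h$3 - x$3 * h$2) *\<^sub>R rot_field 1 x +
       (x$3 * h$1 - x$1 * h$3) *\<^sub>R rot_field 2 x + (x$1 * h$2 - x$2 * h$1) *\<^sub>R rot_field 3 x" (is "?l = ?r")
    proof -
      have "h$1 * (x$1 * x$1 + x$2 * x$2 + x$3 * x$3) = h$1" "h$2 * (x$1 * x$1 + x$2 * x$2 + x$3 * x$3) = h$2"
        "h$3 * (x$1 * x$1 + x$2 * x$2 + x$3 * x$3) = h$3" using x2 by simp_all
      then have "?l$1 = ?r$1" "?l$2 = ?r$2" "?l$3 = ?r$3"
        by (simp_all add: rot_field_nth inner_vec_def sum_3 algebra_simps)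
      then show ?thesis by (simp add: vec_eq_iff forall_3)
    qed
    then show ?thesis
      using y by (simp add: linear_cmul[OF lin] linear_add[OF lin] Lb) (simp add: field_simps)
  qed
  ultimately show ?thesis by (simp add: xn)
qed

lemma has_derivative_coord_div_norm:
  fixes y :: "real^3"
  assumes "y \<noteq> 0"
  shows "((\<lambda>y. y$a / norm y) has_derivative
     (\<lambda>h. \<Sum>i\<in>UNIV. h$i * ((if i = a then 1 else 0) / norm y - y$i / norm y * (y$a / norm y) / norm y))) (at y)"
proof -
  have "((\<lambda>y. (y /\<^sub>R norm y)$a) has_derivative
     (\<lambda>h. ((h - ((y /\<^sub>R norm y) \<bullet> h) *\<^sub>R (y /\<^sub>R norm y)) /\<^sub>R norm y)$a)) (at y)"
    by (rule bounded_linear.has_derivative[OF bounded_linear_vec_nth has_derivative_normalize[OF assms]])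
  moreover have "(\<lambda>y::real^3. (y /\<^sub>R norm y)$a) = (\<lambda>y. y$a / norm y)"
    by (simp add: fun_eq_iff divide_inverse mult.commute)
  moreover have "((h - ((y /\<^sub>R norm y) \<bullet> h) *\<^sub>R (y /\<^sub>R norm y)) /\<^sub>R norm y)$a =
     (\<Sum>i\<in>UNIV. h$i * ((if i = a then 1 else 0) / norm y - y$i / norm y * (y$a / norm y) / norm y))" for h
    using exhaust_3[of a] assms
    by (auto simp: sum_3 inner_vec_def field_simps)
  ultimately show ?thesis by simp
qed

lemma has_derivative_inverse_norm:
  fixes y :: "real^3"
  assumes "y \<noteq> 0"
  shows "((\<lambda>y. 1 / norm y) has_derivative
     (\<lambda>h. \<Sum>i\<in>UNIV. h$i * - (y$i / norm y / norm y / norm y))) (at y)"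
proof -
  have "((\<lambda>y. 1 / norm y) has_derivative (\<lambda>h. - (h \<bullet> sgn y) / (norm y * norm y))) (at y)"
    using assms by (auto intro!: derivative_eq_intros has_derivative_norm simp: fun_eq_iff field_simps)
  moreover have "- (h \<bullet> sgn y) / (norm y * norm y) = (\<Sum>i\<in>UNIV. h$i * - (y$i / norm y / norm y / norm y))" for h
    using assms by (simp add: sgn_div_norm inner_vec_def sum_3 field_simps)
  ultimately show ?thesis by simp
qed

lemma sph_sym_has_derivative:
  assumes "sph_sym k c"
  shows "\<exists>c'. (\<forall>i. sph_sym (Suc k) (c' i)) \<and> (\<forall>l m y. \<bar>m\<bar> \<le> int l \<longrightarrow> y \<noteq> 0 \<longrightarrow>
     (c l m has_derivative (\<lambda>h. \<Sum>i\<in>UNIV. h$i * c' i l m y)) (at y))"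
  using assms
proof (induction rule: sph_sym.induct)
  case base
  define L where "L = (\<lambda>b l m y. rot_up b l m * sph_ext l (rot_up_ix b m) y / norm y +
     rot_down b l m * sph_ext l (rot_down_ix b m) y / norm y)"
  have L: "sph_sym 1 (L b)" for b
    unfolding L_def One_nat_def
    by (intro sph_sym.add sph_sym.shift sph_sym.base shift_ok_rot_up shift_ok_rot_down)
  define c' where "c' = (\<lambda>i::3. if i = 1 then (\<lambda>l m y. y$3 / norm y * L 2 l m y - y$2 / norm y * L 3 l m y)
     else if i = 2 then (\<lambda>l m y. y$1 / norm y * L 3 l m y - y$3 / norm y * L 1 l m y)
     else (\<lambda>l m y. y$2 / norm y * L 1 l m y - y$1 / norm y * L 2 l m y))"
  have "sph_sym (Suc 0) (\<lambda>l m y. y$a / norm y * L b l m y - y$b / norm y * L a l m y)" for a b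
    using L by (intro sph_sym_diff sph_sym.coord) simp_all
  then have "sph_sym (Suc 0) (c' i)" for i
    using exhaust_3[of i] by (auto simp: c'_def)
  moreover have "(sph_ext l m has_derivative (\<lambda>h. \<Sum>i\<in>UNIV. h$i * c' i l m y)) (at y)"
    if "\<bar>m\<bar> \<le> int l" "y \<noteq> 0" for l m y
    using sph_ext_has_derivative[OF that(2,1)] by (simp add: c'_def L_def sum_3)
  ultimately show ?case by blast
next
  case (shift k c u f)
  then obtain c' where c': "\<And>i. sph_sym (Suc k) (c' i)"
    "\<And>l m y. \<bar>m\<bar> \<le> int l \<Longrightarrow> y \<noteq> 0 \<Longrightarrow> (c l m has_derivative (\<lambda>h. \<Sum>i\<in>UNIV. h$i * c' i l m y)) (at y)"
    by blast
  define d where "d = (\<lambda>i l m y. u l m * c' i l (f m) y / norm y - y$i / norm y * (u l m * c l (f m) y / norm y / norm y))"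
  have "sph_sym (Suc (Suc k)) (d i)" for i
    unfolding d_def using shift.hyps c'
    by (intro sph_sym_diff sph_sym.coord sph_sym.shift[OF _ shift.hyps(2)] sph_sym_inv) auto
  moreover have "((\<lambda>y. u l m * c l (f m) y / norm y) has_derivative (\<lambda>h. \<Sum>i\<in>UNIV. h$i * d i l m y)) (at y)"
    if m: "\<bar>m\<bar> \<le> int l" and y: "y \<noteq> 0" for l m y
  proof (cases "\<bar>f m\<bar> \<le> int l")
    case True
    have "(\<lambda>y. u l m * c l (f m) y / norm y) = (\<lambda>y. u l m * (c l (f m) y * (1 / norm y)))"
      by (simp add: fun_eq_iff)
    then show ?thesis
      by (rule ssubst, intro has_derivative_eq_rhs[OF has_derivative_mult_right[OF
          has_derivative_mult[OF c'(2)[OF True y] has_derivative_inverse_norm[OF y]], of "u l m"]])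
        (auto simp: fun_eq_iff d_def sum_3 algebra_simps)
  next
    case False
    then have "u l m = 0" using shift.hyps(2) m unfolding shift_ok_def by auto
    then show ?thesis by (simp add: d_def)
  qed
  ultimately show ?case by blast
next
  case (coord k c a)
  then obtain c' where c': "\<And>i. sph_sym (Suc k) (c' i)"
    "\<And>l m y. \<bar>m\<bar> \<le> int l \<Longrightarrow> y \<noteq> 0 \<Longrightarrow> (c l m has_derivative (\<lambda>h. \<Sum>i\<in>UNIV. h$i * c' i l m y)) (at y)"
    by blast
  define d where "d = (\<lambda>i l m y. y$a / norm y * c' i l m y +
     ((if i = a then 1 else 0) * (c l m y / norm y) - y$i / norm y * (y$a / norm y * (c l m y / norm y))))"
  have "sph_sym (Suc k) (d i)" for i
    unfolding d_def using coord.hyps c'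
    by (intro sph_sym.add sph_sym_diff sph_sym.coord sph_sym.scale sph_sym_inv) auto
  moreover have "((\<lambda>y. y$a / norm y * c l m y) has_derivative (\<lambda>h. \<Sum>i\<in>UNIV. h$i * d i l m y)) (at y)"
    if m: "\<bar>m\<bar> \<le> int l" and y: "y \<noteq> 0" for l m y
    by (rule has_derivative_eq_rhs[OF has_derivative_mult[OF has_derivative_coord_div_norm[OF y] c'(2)[OF m y]]])
      (simp add: fun_eq_iff d_def sum_3 algebra_simps)
  ultimately show ?case by blast
next
  case (add k c d)
  then obtain c' d' where c': "\<And>i. sph_sym (Suc k) (c' i)"
    "\<And>l m y. \<bar>m\<bar> \<le> int l \<Longrightarrow> y \<noteq> 0 \<Longrightarrow> (c l m has_derivative (\<lambda>h. \<Sum>i\<in>UNIV. h$i * c' i l m y)) (at y)"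
   and d': "\<And>i. sph_sym (Suc k) (d' i)"
    "\<And>l m y. \<bar>m\<bar> \<le> int l \<Longrightarrow> y \<noteq> 0 \<Longrightarrow> (d l m has_derivative (\<lambda>h. \<Sum>i\<in>UNIV. h$i * d' i l m y)) (at y)"
    by blast
  have "((\<lambda>y. c l m y + d l m y) has_derivative (\<lambda>h. \<Sum>i\<in>UNIV. h$i * (c' i l m y + d' i l m y))) (at y)"
    if m: "\<bar>m\<bar> \<le> int l" and y: "y \<noteq> 0" for l m y
    by (rule has_derivative_eq_rhs[OF has_derivative_add[OF c'(2)[OF m y] d'(2)[OF m y]]])
      (simp add: fun_eq_iff sum_3 algebra_simps)
  then show ?case using sph_sym.add[OF c'(1) d'(1)]
    by (intro exI[of _ "\<lambda>i l m y. c' i l m y + d' i l m y"]) blast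
next
  case (scale k c r)
  then obtain c' where c': "\<And>i. sph_sym (Suc k) (c' i)"
    "\<And>l m y. \<bar>m\<bar> \<le> int l \<Longrightarrow> y \<noteq> 0 \<Longrightarrow> (c l m has_derivative (\<lambda>h. \<Sum>i\<in>UNIV. h$i * c' i l m y)) (at y)"
    by blast
  have "((\<lambda>y. r * c l m y) has_derivative (\<lambda>h. \<Sum>i\<in>UNIV. h$i * (r * c' i l m y))) (at y)"
    if m: "\<bar>m\<bar> \<le> int l" and y: "y \<noteq> 0" for l m y
    by (rule has_derivative_eq_rhs[OF has_derivative_mult_right[OF c'(2)[OF m y]]])
      (simp add: fun_eq_iff sum_3 algebra_simps)
  then show ?case using sph_sym.scale[OF c'(1)]
    by (intro exI[of _ "\<lambda>i l m y. r * c' i l m y"]) blast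
qed

text \<open>A choice of partial derivatives inside the next class. The parameter \<open>k\<close> is
  the class of \<open>c\<close>, which the choice has to know.\<close>

definition sph_grad :: "nat \<Rightarrow> (nat \<Rightarrow> int \<Rightarrow> real^3 \<Rightarrow> real) \<Rightarrow> 3 \<Rightarrow> nat \<Rightarrow> int \<Rightarrow> real^3 \<Rightarrow> real" where
  "sph_grad k c = (SOME c'. (\<forall>i. sph_sym (Suc k) (c' i)) \<and> (\<forall>l m y. \<bar>m\<bar> \<le> int l \<longrightarrow> y \<noteq> 0 \<longrightarrow>
     (c l m has_derivative (\<lambda>h. \<Sum>i\<in>UNIV. h$i * c' i l m y)) (at y)))"

text \<open>The list names the coordinate directions, with the derivative taken last in front. Its
  length is the class in \<open>sph_sym\<close>.\<close>

primrec sph_ext_deriv :: "3 list \<Rightarrow> nat \<Rightarrow> int \<Rightarrow> real^3 \<Rightarrow> real" where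
  "sph_ext_deriv [] = sph_ext"
| "sph_ext_deriv (i # w) = sph_grad (length w) (sph_ext_deriv w) i"

lemma sph_sym_sph_ext_deriv: "sph_sym (length w) (sph_ext_deriv w)"
proof (induction w)
  case (Cons i w)
  from someI_ex[OF sph_sym_has_derivative[OF this]] show ?case
    unfolding sph_ext_deriv.simps sph_grad_def by simp
qed (simp add: sph_sym.base)

lemma sph_ext_deriv_has_derivative:
  "\<bar>m\<bar> \<le> int l \<Longrightarrow> y \<noteq> 0 \<Longrightarrow> (sph_ext_deriv w l m has_derivative (\<lambda>h. \<Sum>i\<in>UNIV. h$i * sph_ext_deriv (i # w) l m y)) (at y)"
  using someI_ex[OF sph_sym_has_derivative[OF sph_sym_sph_ext_deriv[of w]]]
  unfolding sph_ext_deriv.simps sph_grad_def by simp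

lemmas sph_ext_deriv_homogeneous = sph_sym_homogeneous[OF sph_sym_sph_ext_deriv]
lemmas sph_ext_deriv_bound = sph_sym_bound[OF sph_sym_sph_ext_deriv]

text \<open>The chord from \<open>x\<close> to \<open>y\<close> stays away from the origin only for nearby points; distant points are
  handled by the sup bound.\<close>

lemma sphere_lipschitz:
  fixes f :: "real^3 \<Rightarrow> real" and g :: "3 \<Rightarrow> real^3 \<Rightarrow> real"
  assumes der: "\<And>y. y \<noteq> 0 \<Longrightarrow> (f has_derivative (\<lambda>h. \<Sum>i\<in>UNIV. h$i * g i y)) (at y)"
    and hom: "\<And>i y. y \<noteq> 0 \<Longrightarrow> g i y = g i (y /\<^sub>R norm y) / norm y ^ p"
    and f: "\<And>x. x \<in> S2 \<Longrightarrow> \<bar>f x\<bar> \<le> B" and g: "\<And>i x. x \<in> S2 \<Longrightarrow> \<bar>g i x\<bar> \<le> B"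
    and xy: "x \<in> S2" "y \<in> S2"
  shows "\<bar>f x - f y\<bar> \<le> (4 + 3 * 2 ^ p) * B * norm (x - y)"
proof -
  have B: "0 \<le> B" using f[OF xy(1)] by linarith
  show ?thesis
  proof (cases "norm (x - y) \<le> 1 / 2")
    case True
    have "norm (f x - f y) \<le> (3 * 2 ^ p * B) * norm (x - y)"
    proof (rule differentiable_bound[of "cball x (1/2)"])
      fix z assume z: "z \<in> cball x (1/2)"
      have "norm x - norm (x - z) \<le> norm z" using norm_triangle_ineq2[of x "x - z"] by simp
      then have z2: "1 / 2 \<le> norm z" using z xy(1) by (simp add: dist_norm S2_iff_norm)
      then have z0: "z \<noteq> 0" by auto
      show "(f has_derivative (\<lambda>h. \<Sum>i\<in>UNIV. h$i * g i z)) (at z within cball x (1/2))"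
        by (rule has_derivative_at_withinI[OF der[OF z0]])
      \<comment> \<open>The norm is at least 1/2 on this ball, so homogeneity of degree -p costs at
        most 2^p. The factor 3 in the final constant counts the partial derivatives.\<close>
      have gi: "\<bar>g i z\<bar> \<le> B * 2 ^ p" for i
      proof -
        have "\<bar>g i z\<bar> = \<bar>g i (z /\<^sub>R norm z)\<bar> / norm z ^ p" using hom[OF z0, of i] by simp
        also have "\<dots> \<le> B / (1 / 2) ^ p"
          using z2 z0 B by (intro frac_le g power_mono) (auto simp: S2_iff_norm)
        finally show ?thesis by (simp add: power_one_over)
      qed
      show "onorm (\<lambda>h. \<Sum>i\<in>UNIV. h$i * g i z) \<le> 3 * 2 ^ p * B"
      proof (rule onorm_le)
        fix h :: "real^3"
        have "norm (\<Sum>i\<in>UNIV. h$i * g i z) \<le> (\<Sum>i\<in>(UNIV::3 set). norm h * (B * 2 ^ p))"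
          by (rule order_trans[OF norm_sum], rule sum_mono)
            (auto simp: abs_mult intro!: mult_mono gi component_le_norm_cart)
        then show "norm (\<Sum>i\<in>UNIV. h$i * g i z) \<le> 3 * 2 ^ p * B * norm h"
          by (simp add: algebra_simps)
      qed
    qed (use True in \<open>auto simp: dist_norm\<close>)
    also have "\<dots> \<le> (4 + 3 * 2 ^ p) * B * norm (x - y)"
      using B by (intro mult_right_mono) auto
    finally show ?thesis by simp
  next
    case False
    \<comment> \<open>For norm (x - y) > 1/2 the trivial bound 2 B is below 4 B norm (x - y); this
      is the 4 in the constant.\<close>
    have "\<bar>f x - f y\<bar> \<le> 2 * B" using f[OF xy(1)] f[OF xy(2)] by linarith
    also have "\<dots> \<le> 4 * B * norm (x - y)" using mult_left_mono[of "1/2" "norm (x - y)" "4 * B"] False B by simp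
    also have "\<dots> \<le> (4 + 3 * 2 ^ p) * B * norm (x - y)"
      using B by (intro mult_right_mono) auto
    finally show ?thesis .
  qed
qed

section \<open>Crude bounds for single harmonics and nets on the sphere\<close>

text \<open>One term of the sum of squares. The exponent length w + 1/2 is rounded up, as only
  polynomial growth matters here.\<close>

lemma sph_ext_deriv_bound_single:
  "\<exists>C\<ge>0. \<forall>l m. \<forall>x\<in>S2. \<bar>m\<bar> \<le> int l \<longrightarrow> \<bar>sph_ext_deriv w l m x\<bar> \<le> C * (real l + 1) ^ (length w + 1)"
proof -
  obtain C where C: "C \<ge> 0" "\<And>l x. x \<in> S2 \<Longrightarrow>
      (\<Sum>m\<in>{- int l..int l}. (sph_ext_deriv w l m x)\<^sup>2) \<le> C * (real l + 1) ^ (1 + 2 * length w)"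
    using sph_ext_deriv_bound[of w] by blast
  have "\<bar>sph_ext_deriv w l m x\<bar> \<le> sqrt C * (real l + 1) ^ (length w + 1)" if "x \<in> S2" "\<bar>m\<bar> \<le> int l" for l m x
  proof (rule power2_le_imp_le)
    have "(sph_ext_deriv w l m x)\<^sup>2 \<le> (\<Sum>m\<in>{- int l..int l}. (sph_ext_deriv w l m x)\<^sup>2)"
      using that(2) by (intro member_le_sum[of m _ "\<lambda>m. (sph_ext_deriv w l m x)\<^sup>2"]) auto
    also have "\<dots> \<le> C * (real l + 1) ^ (1 + 2 * length w)" by (rule C(2)[OF that(1)])
    also have "\<dots> \<le> C * (real l + 1) ^ ((length w + 1) * 2)"
      using C(1) by (intro mult_left_mono power_increasing) auto
    also have "\<dots> = (sqrt C * (real l + 1) ^ (length w + 1))\<^sup>2"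
      unfolding power_mult power_mult_distrib using C(1) by simp
    finally show "\<bar>sph_ext_deriv w l m x\<bar>\<^sup>2 \<le> (sqrt C * (real l + 1) ^ (length w + 1))\<^sup>2" by simp
  qed (use C(1) in auto)
  then show ?thesis using C(1) by (intro exI[of _ "sqrt C"]) auto
qed

text \<open>The gradient has one more index, hence the power length w + 2. Any fixed power would do,
  because the mesh of the net is chosen afterwards.\<close>

lemma sph_ext_deriv_lipschitz:
  "\<exists>C\<ge>0. \<forall>l m. \<forall>x\<in>S2. \<forall>y\<in>S2. \<bar>m\<bar> \<le> int l \<longrightarrow>
     \<bar>sph_ext_deriv w l m x - sph_ext_deriv w l m y\<bar> \<le> C * (real l + 1) ^ (length w + 2) * norm (x - y)"
proof -
  obtain C where C: "C \<ge> 0" "\<And>l m x. x \<in> S2 \<Longrightarrow> \<bar>m\<bar> \<le> int l \<Longrightarrow> \<bar>sph_ext_deriv w l m x\<bar> \<le> C * (real l + 1) ^ (length w + 1)"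
    using sph_ext_deriv_bound_single[of w] by blast
  have "\<forall>i. \<exists>D\<ge>0. \<forall>l m. \<forall>x\<in>S2. \<bar>m\<bar> \<le> int l \<longrightarrow> \<bar>sph_ext_deriv (i # w) l m x\<bar> \<le> D * (real l + 1) ^ (length w + 2)"
    using sph_ext_deriv_bound_single[of "_ # w"] by simp
  then obtain D where D: "\<And>i. D i \<ge> 0" "\<And>i l m x. x \<in> S2 \<Longrightarrow> \<bar>m\<bar> \<le> int l \<Longrightarrow>
     \<bar>sph_ext_deriv (i # w) l m x\<bar> \<le> D i * (real l + 1) ^ (length w + 2)"
    by metis
  define E where "E = C + sum D UNIV"
  have E: "0 \<le> E" "C \<le> E" "D i \<le> E" for i
    using C(1) D(1) member_le_sum[of i UNIV D] by (auto simp: E_def sum_nonneg intro: add_nonneg_nonneg add_increasing)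
  let ?K = "4 + 3 * 2 ^ Suc (length w) :: real"
  have "\<bar>sph_ext_deriv w l m x - sph_ext_deriv w l m y\<bar> \<le> ?K * (E * (real l + 1) ^ (length w + 2)) * norm (x - y)"
    if xy: "x \<in> S2" "y \<in> S2" and m: "\<bar>m\<bar> \<le> int l" for l m x y
  proof (rule sphere_lipschitz[OF sph_ext_deriv_has_derivative[OF m]])
    show "sph_ext_deriv (i # w) l m y = sph_ext_deriv (i # w) l m (y /\<^sub>R norm y) / norm y ^ Suc (length w)" if "y \<noteq> 0" for i y
      using sph_ext_deriv_homogeneous[OF that, of "i # w" l m] by simp
    show "\<bar>sph_ext_deriv w l m x\<bar> \<le> E * (real l + 1) ^ (length w + 2)" if "x \<in> S2" for x
      by (rule order_trans[OF C(2)[OF that m]]) (use E C(1) in \<open>intro mult_mono power_increasing, auto\<close>)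
    show "\<bar>sph_ext_deriv (i # w) l m x\<bar> \<le> E * (real l + 1) ^ (length w + 2)" if "x \<in> S2" for x i
      by (rule order_trans[OF D(2)[OF that m]]) (use E in \<open>intro mult_right_mono, auto\<close>)
  qed (use xy in auto)
  then show ?thesis using E(1)
    by (intro exI[of _ "?K * E"]) (auto simp: mult.assoc)
qed

text \<open>One point of the sphere is selected in every occupied cube of side 1/n. Points of the
  same cube differ by at most 1/n in each coordinate, and the norm is at most the sum of the three
  differences.\<close>

lemma sphere_net:
  fixes n :: nat
  assumes n: "0 < n"
  shows "\<exists>N. finite N \<and> N \<subseteq> S2 \<and> card N \<le> (2 * n + 1) ^ 3 \<and> (\<forall>x\<in>S2. \<exists>y\<in>N. norm (x - y) \<le> 3 / real n)"
proof -
  define grid where "grid x = (\<lfloor>real n * x$1\<rfloor>, \<lfloor>real n * x$2\<rfloor>, \<lfloor>real n * x$3\<rfloor>)" for x :: "real^3"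
  define N where "N = inv_into S2 grid ` grid ` S2"
  let ?B = "{- int n..int n} \<times> {- int n..int n} \<times> {- int n..int n}"
  have "grid x \<in> ?B" if "x \<in> S2" for x
  proof -
    have "\<lfloor>real n * x$i\<rfloor> \<in> {- int n..int n}" for i
    proof -
      have "\<bar>x$i\<bar> \<le> 1" using component_le_norm_cart[of x i] that by (simp add: S2_iff_norm)
      then have "real n * x$i \<le> real n * 1" "real n * (-1) \<le> real n * x$i"
        by (intro mult_left_mono; simp)+
      then show ?thesis by (simp add: floor_le_iff le_floor_iff)
    qed
    then show ?thesis by (simp add: grid_def)
  qed
  then have sub: "grid ` S2 \<subseteq> ?B" by blast
  then have fin: "finite (grid ` S2)" by (rule finite_subset) simp
  have "card N \<le> card (grid ` S2)" unfolding N_def by (rule card_image_le[OF fin])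
  also have "\<dots> \<le> card ?B" by (rule card_mono[OF _ sub]) simp
  also have "\<dots> = (2 * n + 1) ^ 3"
  proof -
    have "card {- int n..int n} = 2 * n + 1" by simp
    then show ?thesis by (simp only: card_cartesian_product power3_eq_cube mult.assoc)
  qed
  finally have card: "card N \<le> (2 * n + 1) ^ 3" .
  have near: "\<exists>y\<in>N. norm (x - y) \<le> 3 / real n" if x: "x \<in> S2" for x
  proof
    let ?y = "inv_into S2 grid (grid x)"
    show "?y \<in> N" using x by (auto simp: N_def)
    have "grid ?y = grid x" using x by (simp add: f_inv_into_f)
    then have fl: "\<lfloor>real n * ?y$i\<rfloor> = \<lfloor>real n * x$i\<rfloor>" for i
      using exhaust_3[of i] by (auto simp: grid_def)
    have "\<bar>(x - ?y)$i\<bar> \<le> 1 / real n" for i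
    proof -
      have "\<bar>real n * x$i - real n * ?y$i\<bar> \<le> 1" using fl[of i] by linarith
      moreover have "real n * x$i - real n * ?y$i = real n * (x - ?y)$i" by (simp add: right_diff_distrib)
      ultimately have "real n * \<bar>(x - ?y)$i\<bar> \<le> 1" by (simp only: abs_mult abs_of_nat)
      then show ?thesis using n by (simp only: pos_le_divide_eq mult.commute of_nat_0_less_iff)
    qed
    then have "(\<Sum>i\<in>UNIV. \<bar>(x - ?y)$i\<bar>) \<le> (\<Sum>i\<in>(UNIV::3 set). 1 / real n)" by (intro sum_mono) blast
    then show "norm (x - ?y) \<le> 3 / real n" using norm_le_l1_cart[of "x - ?y"] by simp
  qed
  have "N \<subseteq> S2" by (auto simp: N_def intro: inv_into_into)
  moreover have "finite N" using fin by (simp add: N_def)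
  ultimately show ?thesis using card near by (intro exI[of _ N]) simp
qed

section \<open>Kolmogorov chaining and Gaussian moments\<close>

text \<open>Each u is approached by its left neighbours \<open>pt u n\<close> on the dyadic grids.
  Their consecutive increments form a geometric series, and continuity identifies the limit. At the
  scale n of |t - s| the neighbours of s and t coincide or are adjacent, so two tails and one step
  remain: this is 2 / (1 - r) + 1.\<close>

lemma dyadic_chaining:
  fixes f :: "real \<Rightarrow> real" and T a K :: real
  defines "r \<equiv> 2 powr (- a)"
  assumes T: "0 < T" and a: "0 < a" and K: "0 \<le> K" and cont: "continuous_on {0..T} f"
    and inc: "\<And>n i. i < 2 ^ n \<Longrightarrow> \<bar>f (T * real (Suc i) / 2 ^ n) - f (T * real i / 2 ^ n)\<bar> \<le> K * r ^ n"
    and st: "s \<in> {0..T}" "t \<in> {0..T}"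
  shows "\<bar>f t - f s\<bar> \<le> (2 / (1 - r) + 1) * (2 / T) powr a * K * \<bar>t - s\<bar> powr a"
proof -
  have r: "0 < r" "r < 1" using a by (auto simp: r_def powr_less_one)
  define ix where "ix u n = nat \<lfloor>2 ^ n * u / T\<rfloor>" for u n
  define pt where "pt u n = T * real (ix u n) / 2 ^ n" for u n
  have ix: "real (ix u n) \<le> 2 ^ n * u / T" "2 ^ n * u / T < real (ix u n) + 1"
    if "u \<in> {0..T}" for u n
  proof -
    have "0 \<le> 2 ^ n * u / T" using that T by simp
    then have "real (ix u n) = of_int \<lfloor>2 ^ n * u / T\<rfloor>" unfolding ix_def by simp
    then show "real (ix u n) \<le> 2 ^ n * u / T" "2 ^ n * u / T < real (ix u n) + 1" by linarith+
  qed
  have ix_le: "ix u n \<le> 2 ^ n" if u: "u \<in> {0..T}" for u n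
  proof -
    have "2 ^ n * u / T \<le> 2 ^ n" using u T by (simp add: field_simps)
    then have "real (ix u n) \<le> 2 ^ n" using ix(1)[OF u, of n] by linarith
    then show ?thesis by (metis of_nat_le_iff of_nat_numeral of_nat_power)
  qed
  have pt_in: "pt u n \<in> {0..T}" if u: "u \<in> {0..T}" for u n
  proof -
    have "real (ix u n) \<le> 2 ^ n" using ix_le[OF u, of n] by (metis of_nat_le_iff of_nat_numeral of_nat_power)
    then show ?thesis using T by (simp add: pt_def field_simps)
  qed
  \<comment> \<open>Refining the grid either keeps the left neighbour or moves it by one step of the
    finer grid.\<close>
  have step: "\<bar>f (pt u (Suc n)) - f (pt u n)\<bar> \<le> K * r ^ Suc n" if u: "u \<in> {0..T}" for u n
  proof -
    have "real (ix u (Suc n)) < 2 * real (ix u n) + 2" "2 * real (ix u n) < real (ix u (Suc n)) + 1"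
      using ix[OF u, of n] ix[OF u, of "Suc n"] by auto
    then consider "ix u (Suc n) = 2 * ix u n" | "ix u (Suc n) = Suc (2 * ix u n)" by linarith
    then show ?thesis
    proof cases
      case 1
      then show ?thesis using K r by (simp add: pt_def)
    next
      case 2
      then have "2 * ix u n < 2 ^ Suc n" using ix_le[OF u, of "Suc n"] by simp
      from inc[OF this] show ?thesis using 2 by (simp add: pt_def algebra_simps)
    qed
  qed
  have chain: "\<bar>f (pt u (n + d)) - f (pt u n)\<bar> \<le> K * (r ^ n - r ^ (n + d)) / (1 - r)"
    if u: "u \<in> {0..T}" for u n d
  proof (induction d)
    case (Suc d)
    have "\<bar>f (pt u (n + Suc d)) - f (pt u n)\<bar> \<le> K * (r ^ n - r ^ (n + d)) / (1 - r) + K * r ^ Suc (n + d)"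
      using Suc step[OF u, of "n + d"] by simp
    also have "\<dots> \<le> K * (r ^ n - r ^ (n + d)) / (1 - r) + K * r ^ (n + d)"
      using K r by (intro add_left_mono mult_left_mono power_decreasing) auto
    also have "\<dots> = K * (r ^ n - r ^ (n + Suc d)) / (1 - r)"
      using r by (simp add: field_simps)
    finally show ?case .
  qed simp
  have lim: "(\<lambda>n. f (pt u n)) \<longlonglongrightarrow> f u" if u: "u \<in> {0..T}" for u
  proof -
    have "\<bar>pt u n - u\<bar> \<le> T * (1 / 2) ^ n" for n
    proof -
      have "T * real (ix u n) \<le> 2 ^ n * u" "2 ^ n * u \<le> T * real (ix u n) + T"
        using ix[OF u, of n] T by (auto simp: field_simps)
      then have "T * real (ix u n) / 2 ^ n \<le> u" "u \<le> (T * real (ix u n) + T) / 2 ^ n"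
        by (auto simp: field_simps)
      moreover have "(T * real (ix u n) + T) / 2 ^ n = pt u n + T / 2 ^ n"
        by (simp add: pt_def add_divide_distrib)
      moreover have "T * (1 / 2) ^ n = T / 2 ^ n" by (simp add: power_one_over)
      ultimately show ?thesis unfolding pt_def by linarith
    qed
    moreover have "(\<lambda>n. T * (1 / 2) ^ n) \<longlonglongrightarrow> T * 0"
      by (intro tendsto_mult_left LIMSEQ_realpow_zero) auto
    ultimately have "(\<lambda>n. pt u n - u) \<longlonglongrightarrow> 0"
      by (intro Lim_null_comparison[of "\<lambda>n. pt u n - u" "\<lambda>n. T * (1 / 2) ^ n"] always_eventually allI) simp_all
    then have "(\<lambda>n. pt u n) \<longlonglongrightarrow> u" by (simp add: LIM_zero_iff)
    then show ?thesis
      using continuous_on_tendsto_compose[OF cont, of "\<lambda>n. pt u n" u] u pt_in[OF u] by auto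
  qed
  have tail: "\<bar>f u - f (pt u n)\<bar> \<le> K * r ^ n / (1 - r)" if u: "u \<in> {0..T}" for u n
  proof (rule LIMSEQ_le_const2)
    show "(\<lambda>d. \<bar>f (pt u (d + n)) - f (pt u n)\<bar>) \<longlonglongrightarrow> \<bar>f u - f (pt u n)\<bar>"
      using LIMSEQ_ignore_initial_segment[OF lim[OF u], of n] by (intro tendsto_intros)
    have "\<bar>f (pt u (d + n)) - f (pt u n)\<bar> \<le> K * r ^ n / (1 - r)" for d
    proof -
      have "K * (r ^ n - r ^ (n + d)) / (1 - r) \<le> K * r ^ n / (1 - r)"
        using K r by (intro divide_right_mono mult_left_mono) auto
      then show ?thesis using chain[OF u, of n d] by (simp add: add.commute)
    qed
    then show "\<exists>N. \<forall>d\<ge>N. \<bar>f (pt u (d + n)) - f (pt u n)\<bar> \<le> K * r ^ n / (1 - r)" by blast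
  qed
  have main: "\<bar>f t - f s\<bar> \<le> (2 / (1 - r) + 1) * (2 / T) powr a * K * \<bar>t - s\<bar> powr a"
    if st: "s \<in> {0..T}" "t \<in> {0..T}" and lt: "s < t" for s t
  proof -
    define u where "u = (t - s) / T"
    have u: "0 < u" "u \<le> 1" using st lt T by (auto simp: u_def)
    obtain m where m: "(1 / 2) ^ m < u" using real_arch_pow_inv[OF u(1), of "1 / 2"] by auto
    \<comment> \<open>The scale of u: 2^(-n-1) < u \<le> 2^(-n). The upper bound comes from
      minimality, and for n = 0 from u \<le> 1.\<close>
    define n where "n = (LEAST n. (1 / 2) ^ Suc n < u)"
    have n1: "(1 / 2) ^ Suc n < u" unfolding n_def
    proof (rule LeastI[of _ m])
      have "(1 / 2) ^ Suc m \<le> (1 / 2 :: real) ^ m" by simp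
      then show "(1 / 2) ^ Suc m < u" using m by linarith
    qed
    have n2: "u \<le> (1 / 2) ^ n"
    proof (cases n)
      case (Suc k)
      then have "\<not> (1 / 2) ^ Suc k < u" using not_less_Least[of k "\<lambda>n. (1 / 2) ^ Suc n < u"] n_def by auto
      then show ?thesis using Suc by simp
    qed (use u in simp)
    have "2 ^ n * t / T \<le> 2 ^ n * s / T + 1" "2 ^ n * s / T < 2 ^ n * t / T"
      using n2 T lt unfolding u_def by (auto simp: field_simps power_one_over)
    then have "real (ix t n) < real (ix s n) + 2" "real (ix s n) < real (ix t n) + 1"
      using ix[OF st(1), of n] ix[OF st(2), of n] by linarith+
    then consider "ix t n = ix s n" | "ix t n = Suc (ix s n)" by linarith
    then have mid: "\<bar>f (pt t n) - f (pt s n)\<bar> \<le> K * r ^ n"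
    proof cases
      case 1
      then show ?thesis using K r by (simp add: pt_def)
    next
      case 2
      then have "ix s n < 2 ^ n" using ix_le[OF st(2), of n] by simp
      from inc[OF this] show ?thesis using 2 by (simp add: pt_def)
    qed
    \<comment> \<open>By the choice of n, 2^(-n) < 2 |t - s| / T; raising this to the power a gives
      the factor (2 / T)^a.\<close>
    have rn: "r ^ n \<le> (2 / T) powr a * \<bar>t - s\<bar> powr a"
    proof -
      have "r ^ n = 2 powr (- (a * real n))"
        by (simp add: r_def powr_realpow[symmetric] powr_powr)
      moreover have "(1 / 2) ^ n = (2::real) powr (- real n)"
        by (simp add: powr_minus_divide powr_realpow power_one_over)
      ultimately have "r ^ n = ((1 / 2) ^ n) powr a"
        by (simp add: powr_powr mult.commute)
      also have "\<dots> \<le> (2 * u) powr a" using n1 a by (intro powr_mono2) auto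
      also have "\<dots> = (2 / T) powr a * \<bar>t - s\<bar> powr a"
      proof -
        have "2 * u = 2 / T * \<bar>t - s\<bar>" using lt by (simp add: u_def)
        then show ?thesis using T by (simp only: powr_mult)
      qed
      finally show ?thesis .
    qed
    have "\<bar>f t - f s\<bar> \<le> K * r ^ n / (1 - r) + K * r ^ n / (1 - r) + K * r ^ n"
      using tail[OF st(1), of n] tail[OF st(2), of n] mid by linarith
    also have "\<dots> = (2 / (1 - r) + 1) * K * r ^ n" by (simp add: algebra_simps)
    also have "\<dots> \<le> (2 / (1 - r) + 1) * K * ((2 / T) powr a * \<bar>t - s\<bar> powr a)"
      using K r by (intro mult_left_mono rn) auto
    finally show ?thesis by (simp add: algebra_simps)
  qed
  consider "s < t" | "s = t" | "t < s" by linarith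
  then show ?thesis
  proof cases
    case 1 then show ?thesis by (rule main[OF st])
  next
    case 3 then show ?thesis using main[OF st(2,1)] by (simp add: abs_minus_commute)
  qed simp
qed

lemma ennreal_le_suminf: "(f :: nat \<Rightarrow> ennreal) n \<le> suminf f"
  using sum_le_suminf[of f "{n}"] by (simp add: summableI)

text \<open>All scaled dyadic increments of all processes are collected in one random variable
  \<open>G\<close>. Its expectation is finite, by a geometric series over the levels n and by
  \<open>sv\<close> over j. Hence \<open>G\<close> is almost surely finite, and a single constant
  serves every j and every b.\<close>

lemma (in prob_space) kolmogorov_family:
  fixes X :: "nat \<Rightarrow> 'b \<Rightarrow> real \<Rightarrow> 'a \<Rightarrow> real" and T a H :: real and v :: "nat \<Rightarrow> real"
  assumes T: "0 < T" and a: "0 < a" and q: "1 < 2 * real q * (H - a)"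
    and fin: "\<And>j. finite (N j)"
    and meas: "\<And>j b t. b \<in> N j \<Longrightarrow> t \<in> {0..T} \<Longrightarrow> X j b t \<in> borel_measurable M"
    and cont: "\<And>j b \<omega>. b \<in> N j \<Longrightarrow> \<omega> \<in> space M \<Longrightarrow> continuous_on {0..T} (\<lambda>t. X j b t \<omega>)"
    and mom: "\<And>j b s t. b \<in> N j \<Longrightarrow> s \<in> {0..T} \<Longrightarrow> t \<in> {0..T} \<Longrightarrow>
      (\<integral>\<^sup>+\<omega>. ennreal ((X j b t \<omega> - X j b s \<omega>) ^ (2 * q)) \<partial>M) \<le> ennreal (v j * \<bar>t - s\<bar> powr (2 * real q * H))"
    and v: "\<And>j. 0 \<le> v j" and sv: "summable (\<lambda>j. real (card (N j)) * v j)"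
  shows "AE \<omega> in M. \<exists>C\<ge>0. \<forall>j. \<forall>b\<in>N j. \<forall>s\<in>{0..T}. \<forall>t\<in>{0..T}.
     \<bar>X j b t \<omega> - X j b s \<omega>\<bar> \<le> C * \<bar>t - s\<bar> powr a"
proof -
  have q1: "2 * q \<noteq> 0" using q by (cases q) auto
  define p where "p i n = T * real i / 2 ^ n" for i n :: nat
  have p: "p i n \<in> {0..T}" if "i \<le> 2 ^ n" for i n
  proof -
    have "real i \<le> real (2 ^ n)" using that of_nat_le_iff by blast
    then show ?thesis using T by (simp add: p_def field_simps)
  qed
  define r where "r = 2 powr (- a)"
  have r: "0 < r" by (simp add: r_def)
  define D where "D j b n i \<omega> = (X j b (p (Suc i) n) \<omega> - X j b (p i n) \<omega>) / r ^ n" for j b n i \<omega>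
  \<comment> \<open>The growth per level of the expected sum: 2 for the number of increments,
    2^(2qa) from the division by r^n, 2^(-2qH) from the moment bound. The hypothesis on q says
    precisely that this is below 1.\<close>
  define \<rho> where "\<rho> = 2 powr (1 + 2 * real q * a - 2 * real q * H)"
  have \<rho>: "0 \<le> \<rho>" "\<rho> < 1" using q by (auto simp: \<rho>_def algebra_simps intro!: powr_less_one)
  define G where "G \<omega> = (\<Sum>j. \<Sum>n. \<Sum>b\<in>N j. \<Sum>i<2^n. ennreal (D j b n i \<omega> ^ (2 * q)))" for \<omega>
  have D_meas: "D j b n i \<in> borel_measurable M" if "b \<in> N j" "i < 2 ^ n" for j b n i
    unfolding D_def using that by (intro borel_measurable_divide borel_measurable_diff meas p) auto
  have D_mom: "(\<integral>\<^sup>+\<omega>. ennreal (D j b n i \<omega> ^ (2 * q)) \<partial>M) \<le> ennreal (v j * T powr (2 * real q * H) * (\<rho> / 2) ^ n)"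
    if "b \<in> N j" "i < 2 ^ n" for j b n i
  proof -
    let ?Z = "\<lambda>\<omega>. X j b (p (Suc i) n) \<omega> - X j b (p i n) \<omega>"
    have pp: "p (Suc i) n \<in> {0..T}" "p i n \<in> {0..T}" using that p[of "Suc i" n] p[of i n] by auto
    have d: "\<bar>p (Suc i) n - p i n\<bar> = T / 2 ^ n" using T by (simp add: p_def field_simps)
    have "(\<integral>\<^sup>+\<omega>. ennreal (D j b n i \<omega> ^ (2 * q)) \<partial>M)
      = (\<integral>\<^sup>+\<omega>. ennreal (1 / (r ^ n) ^ (2 * q)) * ennreal (?Z \<omega> ^ (2 * q)) \<partial>M)"
      using r by (intro nn_integral_cong) (simp add: D_def power_divide ennreal_mult[symmetric])
    also have "\<dots> = ennreal (1 / (r ^ n) ^ (2 * q)) * (\<integral>\<^sup>+\<omega>. ennreal (?Z \<omega> ^ (2 * q)) \<partial>M)"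
      using meas[OF that(1) pp(1)] meas[OF that(1) pp(2)] by (intro nn_integral_cmult) measurable
    also have "\<dots> \<le> ennreal (1 / (r ^ n) ^ (2 * q)) * ennreal (v j * \<bar>p (Suc i) n - p i n\<bar> powr (2 * real q * H))"
      by (intro mult_left_mono mom that pp) auto
    also have "\<dots> = ennreal (1 / (r ^ n) ^ (2 * q) * (v j * (T / 2 ^ n) powr (2 * real q * H)))"
      using r v[of j] unfolding d by (intro ennreal_mult[symmetric]) auto
    also have "1 / (r ^ n) ^ (2 * q) * (v j * (T / 2 ^ n) powr (2 * real q * H)) =
       v j * T powr (2 * real q * H) * (\<rho> / 2) ^ n"
    proof -
      have "1 / (r ^ n) ^ (2 * q) = 2 powr (a * (real n * (2 * real q)))"
      proof -
        have "(r ^ n) ^ (2 * q) = r powr real (n * (2 * q))"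
          using r by (simp only: powr_realpow power_mult)
        also have "\<dots> = 2 powr (- (a * (real n * (2 * real q))))" by (simp add: r_def powr_powr)
        finally show ?thesis by (simp add: powr_minus_divide)
      qed
      moreover have "(T / 2 ^ n) powr (2 * real q * H) = T powr (2 * real q * H) * 2 powr (- (real n * (2 * real q * H)))"
        using T by (simp add: powr_divide powr_realpow[symmetric] powr_powr powr_minus_divide)
      moreover have "(\<rho> / 2) ^ n = 2 powr (a * (real n * (2 * real q))) * 2 powr (- (real n * (2 * real q * H)))"
      proof -
        have "\<rho> / 2 = 2 powr (2 * real q * a - 2 * real q * H)"
          by (simp add: \<rho>_def powr_add powr_diff)
        then have "(\<rho> / 2) ^ n = 2 powr ((2 * real q * a - 2 * real q * H) * real n)"
          by (simp add: powr_realpow[symmetric] powr_powr)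
        then show ?thesis by (simp add: powr_add[symmetric] algebra_simps)
      qed
      ultimately show ?thesis by simp
    qed
    finally show ?thesis .
  qed
  define g where "g j n \<omega> = (\<Sum>b\<in>N j. \<Sum>i<2^n. ennreal (D j b n i \<omega> ^ (2 * q)))" for j n \<omega>
  have D_meas': "(\<lambda>\<omega>. ennreal (D j b n i \<omega> ^ (2 * q))) \<in> borel_measurable M" if "b \<in> N j" "i < 2 ^ n" for j b n i
    using D_meas[OF that] by measurable
  have g_meas: "g j n \<in> borel_measurable M" for j n
    unfolding g_def by (intro borel_measurable_sum D_meas') auto
  have G_g: "G = (\<lambda>\<omega>. \<Sum>j. \<Sum>n. g j n \<omega>)" unfolding G_def g_def ..
  have G_meas: "G \<in> borel_measurable M"
    unfolding G_g by (intro borel_measurable_suminf_order g_meas)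
  have "(\<integral>\<^sup>+\<omega>. G \<omega> \<partial>M) = (\<Sum>j. \<integral>\<^sup>+\<omega>. (\<Sum>n. g j n \<omega>) \<partial>M)"
    unfolding G_g by (intro nn_integral_suminf borel_measurable_suminf_order g_meas)
  also have "\<dots> = (\<Sum>j. \<Sum>n. \<integral>\<^sup>+\<omega>. g j n \<omega> \<partial>M)"
    by (intro suminf_cong nn_integral_suminf g_meas)
  also have "\<dots> = (\<Sum>j. \<Sum>n. \<Sum>b\<in>N j. \<Sum>i<2^n. \<integral>\<^sup>+\<omega>. ennreal (D j b n i \<omega> ^ (2 * q)) \<partial>M)"
  proof (intro suminf_cong)
    fix j n
    have "(\<integral>\<^sup>+\<omega>. g j n \<omega> \<partial>M) = (\<Sum>b\<in>N j. \<integral>\<^sup>+\<omega>. (\<Sum>i<2^n. ennreal (D j b n i \<omega> ^ (2 * q))) \<partial>M)"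
      unfolding g_def by (intro nn_integral_sum borel_measurable_sum D_meas') auto
    also have "\<dots> = (\<Sum>b\<in>N j. \<Sum>i<2^n. \<integral>\<^sup>+\<omega>. ennreal (D j b n i \<omega> ^ (2 * q)) \<partial>M)"
      by (intro sum.cong refl nn_integral_sum D_meas') auto
    finally show "(\<integral>\<^sup>+\<omega>. g j n \<omega> \<partial>M) = \<dots>" .
  qed
  also have "\<dots> \<le> (\<Sum>j. \<Sum>n. \<Sum>b\<in>N j. \<Sum>i<(2::nat)^n. ennreal (v j * T powr (2 * real q * H) * (\<rho> / 2) ^ n))"
    by (intro suminf_le sum_mono summableI D_mom) auto
  also have "\<dots> = (\<Sum>j. \<Sum>n. ennreal (real (card (N j)) * v j * T powr (2 * real q * H) * \<rho> ^ n))"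
    using v \<rho> by (intro suminf_cong) (simp add: ennreal_of_nat_eq_real_of_nat ennreal_mult[symmetric] power_divide)
  also have "\<dots> = (\<Sum>j. ennreal (real (card (N j)) * v j * T powr (2 * real q * H) * (1 / (1 - \<rho>))))"
  proof (intro suminf_cong)
    fix j
    have "(\<lambda>n. real (card (N j)) * v j * T powr (2 * real q * H) * \<rho> ^ n) sums
      (real (card (N j)) * v j * T powr (2 * real q * H) * (1 / (1 - \<rho>)))"
      using \<rho> by (intro sums_mult geometric_sums) auto
    then show "(\<Sum>n. ennreal (real (card (N j)) * v j * T powr (2 * real q * H) * \<rho> ^ n))
      = ennreal (real (card (N j)) * v j * T powr (2 * real q * H) * (1 / (1 - \<rho>)))"
      using v \<rho> by (intro suminf_ennreal_eq) auto
  qed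
  also have "\<dots> < \<infinity>"
  proof -
    have "summable (\<lambda>j. real (card (N j)) * v j * T powr (2 * real q * H) * (1 / (1 - \<rho>)))"
      by (intro summable_mult2 sv)
    then show ?thesis using v \<rho> by (subst suminf_ennreal2) (auto simp: less_top)
  qed
  finally have "AE \<omega> in M. G \<omega> \<noteq> \<infinity>"
    using G_meas by (intro nn_integral_PInf_AE) auto
  then show ?thesis
  proof (rule AE_mp[OF _ AE_I2], intro impI)
    fix \<omega> assume \<omega>: "\<omega> \<in> space M" and Gf: "G \<omega> \<noteq> \<infinity>"
    \<comment> \<open>Adding 1 avoids a root of order 2q: either |D| \<le> 1, or |D| is at most its
      own power, which is bounded by \<open>G\<close>.\<close>
    define K where "K = 1 + enn2real (G \<omega>)"
    have K: "0 \<le> K" and K1: "1 \<le> K" by (simp_all add: K_def)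
    have D_le: "\<bar>D j b n i \<omega>\<bar> \<le> K" if "b \<in> N j" "i < 2 ^ n" for j b n i
    proof -
      have "ennreal (D j b n i \<omega> ^ (2 * q)) \<le> (\<Sum>i<2^n. ennreal (D j b n i \<omega> ^ (2 * q)))"
        using that by (intro member_le_sum[of i _ "\<lambda>i. ennreal (D j b n i \<omega> ^ (2 * q))"]) auto
      also have "\<dots> \<le> (\<Sum>b\<in>N j. \<Sum>i<2^n. ennreal (D j b n i \<omega> ^ (2 * q)))"
        using that fin by (intro member_le_sum[of b _ "\<lambda>b. \<Sum>i<2^n. ennreal (D j b n i \<omega> ^ (2 * q))"]) auto
      also have "\<dots> \<le> (\<Sum>n. \<Sum>b\<in>N j. \<Sum>i<2^n. ennreal (D j b n i \<omega> ^ (2 * q)))"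
        by (rule ennreal_le_suminf)
      also have "\<dots> \<le> G \<omega>" unfolding G_def by (rule ennreal_le_suminf)
      also have "G \<omega> = ennreal (K - 1)" using Gf by (simp add: K_def less_top)
      finally have le: "D j b n i \<omega> ^ (2 * q) \<le> K - 1" by (simp add: K_def)
      show ?thesis
      proof (cases "\<bar>D j b n i \<omega>\<bar> \<le> 1")
        case False
        then have "\<bar>D j b n i \<omega>\<bar> \<le> \<bar>D j b n i \<omega>\<bar> ^ (2 * q)" using q1 by (intro self_le_power) auto
        also have "\<dots> = D j b n i \<omega> ^ (2 * q)" by (simp add: power_even_abs)
        finally show ?thesis using le by simp
      qed (use K1 in linarith)
    qed
    have "\<bar>X j b t \<omega> - X j b s \<omega>\<bar> \<le> (2 / (1 - r) + 1) * (2 / T) powr a * K * \<bar>t - s\<bar> powr a"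
      if b: "b \<in> N j" and st: "s \<in> {0..T}" "t \<in> {0..T}" for j b s t
      unfolding r_def
    proof (rule dyadic_chaining[OF T a K cont[OF b \<omega>] _ st])
      fix n i :: nat assume i: "i < 2 ^ n"
      have "\<bar>X j b (p (Suc i) n) \<omega> - X j b (p i n) \<omega>\<bar> = \<bar>D j b n i \<omega>\<bar> * r ^ n"
        using r by (simp add: D_def abs_mult)
      also have "\<dots> \<le> K * r ^ n" using D_le[OF b i] r by (intro mult_right_mono) auto
      finally show "\<bar>X j b (T * real (Suc i) / 2 ^ n) \<omega> - X j b (T * real i / 2 ^ n) \<omega>\<bar> \<le> K * (2 powr - a) ^ n"
        by (simp add: p_def r_def)
    qed
    moreover have "0 \<le> (2 / (1 - r) + 1) * (2 / T) powr a * K"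
    proof -
      have "r < 1" using a by (simp add: r_def powr_less_one)
      then show ?thesis using K by simp
    qed
    ultimately show "\<exists>C\<ge>0. \<forall>j. \<forall>b\<in>N j. \<forall>s\<in>{0..T}. \<forall>t\<in>{0..T}.
       \<bar>X j b t \<omega> - X j b s \<omega>\<bar> \<le> C * \<bar>t - s\<bar> powr a" by blast
  qed
qed

section \<open>Even moments of Gaussian sums\<close>

text \<open>The double factorial (2q - 1)!!, which is the moment of order 2q of a standard normal
  variable.\<close>

definition gauss_mom :: "nat \<Rightarrow> real" where "gauss_mom q = fact (2 * q) / (2 ^ q * fact q)"

lemma (in prob_space) normal_even_moment:
  assumes "distributed M lborel X (normal_density 0 \<sigma>)" "0 < \<sigma>"
  shows "(\<integral>\<^sup>+\<omega>. ennreal (X \<omega> ^ (2 * q)) \<partial>M) = ennreal (gauss_mom q * (\<sigma>\<^sup>2) ^ q)"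
proof -
  have "(\<integral>\<^sup>+\<omega>. ennreal (X \<omega> ^ (2 * q)) \<partial>M) = (\<integral>\<^sup>+x. ennreal (normal_density 0 \<sigma> x) * ennreal (x ^ (2 * q)) \<partial>lborel)"
    by (rule distributed_nn_integral[OF assms(1), symmetric]) measurable
  also have "\<dots> = (\<integral>\<^sup>+x. ennreal (normal_density 0 \<sigma> x * (x - 0) ^ (2 * q)) \<partial>lborel)"
    by (simp add: ennreal_mult)
  also have "\<dots> = ennreal (fact (2 * q) / ((2 / \<sigma>\<^sup>2) ^ q * fact q))"
    using normal_moment_even[OF assms(2), of 0 q]
    by (subst nn_integral_eq_integral) (auto simp: has_bochner_integral_iff)
  also have "fact (2 * q) / ((2 / \<sigma>\<^sup>2) ^ q * fact q) = gauss_mom q * (\<sigma>\<^sup>2) ^ q"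
    using assms(2) by (simp add: gauss_mom_def power_divide field_simps)
  finally show ?thesis .
qed

text \<open>An independent normal sum is normal with the summed variance. Zero coefficients are
  discarded beforehand, since a normal density needs a positive deviation; if none remain, both
  sides are zero because q > 0.\<close>

lemma (in prob_space) indep_normal_sum_even_moment:
  assumes fin: "finite I" and ind: "indep_vars (\<lambda>_. borel) Z I" and \<sigma>: "0 < \<sigma>"
    and Z: "\<And>i. i \<in> I \<Longrightarrow> distributed M lborel (Z i) (normal_density 0 \<sigma>)" and q: "0 < q"
  shows "(\<integral>\<^sup>+\<omega>. ennreal ((\<Sum>i\<in>I. c i * Z i \<omega>) ^ (2 * q)) \<partial>M) = ennreal (gauss_mom q * (\<sigma>\<^sup>2 * (\<Sum>i\<in>I. (c i)\<^sup>2)) ^ q)"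
proof -
  define J where "J = {i\<in>I. c i \<noteq> 0}"
  have J: "finite J" "J \<subseteq> I" using fin by (auto simp: J_def)
  have 1: "(\<Sum>i\<in>I. c i * Z i \<omega>) = (\<Sum>i\<in>J. c i * Z i \<omega>)" for \<omega>
    by (rule sum.mono_neutral_right) (use fin in \<open>auto simp: J_def\<close>)
  have 2: "(\<Sum>i\<in>I. (c i)\<^sup>2) = (\<Sum>i\<in>J. (c i)\<^sup>2)"
    by (rule sum.mono_neutral_right) (use fin in \<open>auto simp: J_def\<close>)
  show ?thesis
  proof (cases "J = {}")
    case True
    then show ?thesis unfolding 1 2 using q by (simp add: power_0_left)
  next
    case False
    have n: "distributed M lborel (\<lambda>\<omega>. c i * Z i \<omega>) (normal_density 0 (\<bar>c i\<bar> * \<sigma>))" if "i \<in> J" for i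
      using normal_density_affine[OF Z \<sigma>, of i "c i" 0] that by (auto simp: J_def)
    have "indep_vars (\<lambda>_. borel) (\<lambda>i \<omega>. c i * Z i \<omega>) J"
      using indep_vars_compose2[OF indep_vars_subset[OF ind J(2)], of "\<lambda>i z. c i * z" "\<lambda>_. borel"] by simp
    from sum_indep_normal[OF J(1) False this, of "\<lambda>i. \<bar>c i\<bar> * \<sigma>" "\<lambda>_. 0"] n \<sigma>
    have "distributed M lborel (\<lambda>\<omega>. \<Sum>i\<in>J. c i * Z i \<omega>) (normal_density 0 (sqrt (\<Sum>i\<in>J. (\<bar>c i\<bar> * \<sigma>)\<^sup>2)))"
      by (auto simp: J_def)
    moreover have pos: "0 < (\<Sum>i\<in>J. (\<bar>c i\<bar> * \<sigma>)\<^sup>2)"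
      using J False \<sigma> by (intro sum_pos) (auto simp: J_def)
    ultimately have "(\<integral>\<^sup>+\<omega>. ennreal ((\<Sum>i\<in>J. c i * Z i \<omega>) ^ (2 * q)) \<partial>M)
        = ennreal (gauss_mom q * ((sqrt (\<Sum>i\<in>J. (\<bar>c i\<bar> * \<sigma>)\<^sup>2))\<^sup>2) ^ q)"
      by (intro normal_even_moment) auto
    also have "(sqrt (\<Sum>i\<in>J. (\<bar>c i\<bar> * \<sigma>)\<^sup>2))\<^sup>2 = \<sigma>\<^sup>2 * (\<Sum>i\<in>J. (c i)\<^sup>2)"
      using pos by (simp add: power_mult_distrib sum_distrib_left mult.commute)
    finally show ?thesis unfolding 1 2 .
  qed
qed

section \<open>Almost sure bounds for the dyadic blocks\<close>

lemma (in prob_space) centered_gaussian_square_integrable: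
  assumes "centered_gaussian M X"
  shows "X \<in> borel_measurable M" and "integrable M (\<lambda>\<omega>. (X \<omega>)\<^sup>2)"
proof -
  have "X \<in> borel_measurable M \<and> integrable M (\<lambda>\<omega>. (X \<omega>)\<^sup>2)"
    using assms unfolding centered_gaussian_def
  proof (elim disjE conjE exE)
    assume X: "X \<in> borel_measurable M" and 0: "AE \<omega> in M. X \<omega> = 0"
    have "integrable M (\<lambda>\<omega>. (X \<omega>)\<^sup>2) \<longleftrightarrow> integrable M (\<lambda>_. 0 :: real)"
      by (rule integrable_cong_AE) (use X 0 in \<open>auto intro: AE_mp\<close>)
    then show ?thesis using X by simp
  next
    fix \<sigma> :: real assume \<sigma>: "0 < \<sigma>" and d: "distributed M lborel X (normal_density 0 \<sigma>)"
    have "integrable lborel (\<lambda>x. normal_density 0 \<sigma> x * x\<^sup>2)"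
      using integrable_normal_moment[OF \<sigma>, of 0 2] by simp
    then have "integrable M (\<lambda>\<omega>. (X \<omega>)\<^sup>2)"
      by (subst distributed_integrable[OF d, of "\<lambda>x. x\<^sup>2", symmetric]) auto
    then show ?thesis using distributed_measurable[OF d] by simp
  qed
  then show "X \<in> borel_measurable M" "integrable M (\<lambda>\<omega>. (X \<omega>)\<^sup>2)" by auto
qed

lemma is_fbm_gaussian:
  assumes "is_fbm M T H \<beta>" "finite F" "F \<subseteq> {0..T}"
  shows "centered_gaussian M (\<lambda>\<omega>. \<Sum>t\<in>F. c t * \<beta> t \<omega>)"
  using assms(1)[unfolded is_fbm_def, THEN conjunct1, rule_format, of F c] assms(2,3) by simp

lemma (in prob_space) is_fbm_square_integrable:
  assumes "is_fbm M T H \<beta>" "t \<in> {0..T}"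
  shows "\<beta> t \<in> borel_measurable M" and "integrable M (\<lambda>\<omega>. (\<beta> t \<omega>)\<^sup>2)"
proof -
  have "centered_gaussian M (\<lambda>\<omega>. \<Sum>t\<in>{t}. 1 * \<beta> t \<omega>)"
    by (rule is_fbm_gaussian[OF assms(1)]) (use assms in auto)
  then have "centered_gaussian M (\<beta> t)" by simp
  from centered_gaussian_square_integrable[OF this]
  show "\<beta> t \<in> borel_measurable M" "integrable M (\<lambda>\<omega>. (\<beta> t \<omega>)\<^sup>2)" .
qed

text \<open>\<open>is_fbm\<close> makes the increment Gaussian with an unspecified deviation. The
  covariance function determines the second moment |t - s|^(2H); this excludes the degenerate
  alternative for s \<noteq> t and identifies the deviation.\<close>

lemma (in prob_space) fbm_increment_distributed:
  assumes fbm: "is_fbm M T H \<beta>" and st: "s \<in> {0..T}" "t \<in> {0..T}" "s \<noteq> t"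
  shows "distributed M lborel (\<lambda>\<omega>. \<beta> t \<omega> - \<beta> s \<omega>) (normal_density 0 (\<bar>t - s\<bar> powr H))"
proof -
  note m = is_fbm_square_integrable[OF fbm st(1)] is_fbm_square_integrable[OF fbm st(2)]
  have prod: "integrable M (\<lambda>\<omega>. \<beta> s \<omega> * \<beta> t \<omega>)"
  proof (rule Bochner_Integration.integrable_bound)
    show "integrable M (\<lambda>\<omega>. (\<beta> s \<omega>)\<^sup>2 + (\<beta> t \<omega>)\<^sup>2)" using m by auto
    have "\<bar>a * b\<bar> \<le> a\<^sup>2 + b\<^sup>2" for a b :: real
    proof -
      have "0 \<le> (\<bar>a\<bar> - \<bar>b\<bar>)\<^sup>2" by simp
      then have "2 * (\<bar>a\<bar> * \<bar>b\<bar>) \<le> a\<^sup>2 + b\<^sup>2" by (simp add: power2_diff)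
      moreover have "0 \<le> \<bar>a\<bar> * \<bar>b\<bar>" by simp
      ultimately show ?thesis unfolding abs_mult by linarith
    qed
    then show "AE \<omega> in M. norm (\<beta> s \<omega> * \<beta> t \<omega>) \<le> norm ((\<beta> s \<omega>)\<^sup>2 + (\<beta> t \<omega>)\<^sup>2)" by simp
  qed (use m in measurable)
  have cov: "(\<integral>\<omega>. \<beta> u \<omega> * \<beta> v \<omega> \<partial>M) = fbm_cov H u v" if "u \<in> {0..T}" "v \<in> {0..T}" for u v
    using fbm that unfolding is_fbm_def by blast
  have sq: "(\<integral>\<omega>. (\<beta> u \<omega>)\<^sup>2 \<partial>M) = u powr (2 * H)" if "u \<in> {0..T}" for u
    using cov[OF that that] by (simp add: fbm_cov_def power2_eq_square)
  have "(\<integral>\<omega>. (\<beta> t \<omega> - \<beta> s \<omega>)\<^sup>2 \<partial>M) = (\<integral>\<omega>. ((\<beta> t \<omega>)\<^sup>2 + (\<beta> s \<omega>)\<^sup>2) - 2 * (\<beta> s \<omega> * \<beta> t \<omega>) \<partial>M)"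
    by (simp add: power2_diff algebra_simps)
  also have "\<dots> = (\<integral>\<omega>. (\<beta> t \<omega>)\<^sup>2 \<partial>M) + (\<integral>\<omega>. (\<beta> s \<omega>)\<^sup>2 \<partial>M) - 2 * (\<integral>\<omega>. \<beta> s \<omega> * \<beta> t \<omega> \<partial>M)"
    using m prod by simp
  also have "\<dots> = \<bar>t - s\<bar> powr (2 * H)"
  proof -
    have "a + b - 2 * ((a + b - c) / 2) = c" for a b c :: real by (simp add: field_simps)
    then show ?thesis unfolding sq[OF st(1)] sq[OF st(2)] cov[OF st(1,2)] fbm_cov_def .
  qed
  finally have var: "(\<integral>\<omega>. (\<beta> t \<omega> - \<beta> s \<omega>)\<^sup>2 \<partial>M) = \<bar>t - s\<bar> powr (2 * H)" .
  have "centered_gaussian M (\<lambda>\<omega>. \<Sum>u\<in>{s, t}. (if u = t then 1 else -1) * \<beta> u \<omega>)"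
    by (rule is_fbm_gaussian[OF fbm]) (use st in auto)
  moreover have "(\<lambda>\<omega>. \<Sum>u\<in>{s, t}. (if u = t then 1 else -1) * \<beta> u \<omega>) = (\<lambda>\<omega>. \<beta> t \<omega> - \<beta> s \<omega>)"
    using st(3) by (auto simp: fun_eq_iff)
  ultimately have "centered_gaussian M (\<lambda>\<omega>. \<beta> t \<omega> - \<beta> s \<omega>)" by simp
  then show ?thesis unfolding centered_gaussian_def
  proof (elim disjE conjE exE)
    assume "AE \<omega> in M. \<beta> t \<omega> - \<beta> s \<omega> = 0"
    then have "(\<integral>\<omega>. (\<beta> t \<omega> - \<beta> s \<omega>)\<^sup>2 \<partial>M) = (\<integral>\<omega>. 0 \<partial>M)"
      using m by (intro integral_cong_AE) auto
    then show ?thesis using var st(3) by simp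
  next
    fix \<sigma> :: real assume \<sigma>: "0 < \<sigma>"
      and d: "distributed M lborel (\<lambda>\<omega>. \<beta> t \<omega> - \<beta> s \<omega>) (normal_density 0 \<sigma>)"
    have "(\<integral>\<omega>. (\<beta> t \<omega> - \<beta> s \<omega>)\<^sup>2 \<partial>M) = (\<integral>x. normal_density 0 \<sigma> x * x\<^sup>2 \<partial>lborel)"
      using distributed_integral[OF d, of "\<lambda>x. x\<^sup>2"] by simp
    also have "\<dots> = \<sigma>\<^sup>2"
      using integral_normal_moment_even[OF \<sigma>, of 0 1] by simp
    finally have "\<sigma>\<^sup>2 = (\<bar>t - s\<bar> powr H)\<^sup>2" using var by (simp add: power2_eq_square powr_add[symmetric])
    then have "\<sigma> = \<bar>t - s\<bar> powr H" using \<sigma> by (simp add: power2_eq_iff_nonneg)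
    then show ?thesis using d by simp
  qed
qed

text \<open>The variance at time 0 is zero. Starting at 0 later turns bounds on time increments into
  bounds on the blocks themselves.\<close>

lemma (in prob_space) is_fbm_zero:
  assumes fbm: "is_fbm M T H \<beta>" and T: "0 \<le> T"
  shows "AE \<omega> in M. \<beta> 0 \<omega> = 0"
proof -
  have 0: "0 \<in> {0..T}" using T by simp
  note m = is_fbm_square_integrable[OF fbm 0]
  have "(\<integral>\<omega>. (\<beta> 0 \<omega>)\<^sup>2 \<partial>M) = 0"
  proof -
    have "(\<integral>\<omega>. \<beta> 0 \<omega> * \<beta> 0 \<omega> \<partial>M) = fbm_cov H 0 0" using fbm 0 unfolding is_fbm_def by blast
    then show ?thesis by (simp add: fbm_cov_def power2_eq_square)
  qed
  then have "AE \<omega> in M. (\<beta> 0 \<omega>)\<^sup>2 = 0"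
    using integral_nonneg_eq_0_iff_AE[OF m(2)] by simp
  then show ?thesis by simp
qed

text \<open>The shift by one puts \<open>l = 0\<close> into the block \<open>j = 0\<close>.\<close>

definition dyadic_block :: "nat \<Rightarrow> nat set" where "dyadic_block j = {2 ^ j - 1..<2 ^ Suc j - 1}"

text \<open>The coefficients are arbitrary numbers, so that the same expression serves for a fixed
  time, for a time increment and for one fixed path.\<close>

definition block_sum :: "(nat \<Rightarrow> real) \<Rightarrow> (nat \<Rightarrow> int \<Rightarrow> real) \<Rightarrow> 3 list \<Rightarrow> nat \<Rightarrow> real^3 \<Rightarrow> real" where
  "block_sum A b w j y = (\<Sum>l\<in>dyadic_block j. \<Sum>m\<in>{- int l..int l}. sqrt (A l) * b l m * sph_ext_deriv w l m y)"

lemma dyadic_block_bounds: "l \<in> dyadic_block j \<Longrightarrow> 2 ^ j \<le> real l + 1 \<and> real l + 1 \<le> 2 * 2 ^ j"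
proof -
  assume "l \<in> dyadic_block j"
  then have "2 ^ j \<le> Suc l" "Suc l \<le> 2 * 2 ^ j" by (auto simp: dyadic_block_def)
  then have "real (2 ^ j) \<le> real (Suc l)" "real (Suc l) \<le> real (2 * 2 ^ j)" using of_nat_le_iff by blast+
  then show ?thesis by simp
qed

lemma finite_dyadic_block [simp]: "finite (dyadic_block j)" by (simp add: dyadic_block_def)

lemma card_dyadic_block: "card (dyadic_block j) = 2 ^ j" by (simp add: dyadic_block_def)

lemma block_sum_diff: "block_sum A (\<lambda>l m. b l m - c l m) w j y = block_sum A b w j y - block_sum A c w j y"
  by (simp add: block_sum_def algebra_simps sum_subtractf)

locale qfbm = prob_space M for M :: "'w measure" +
  fixes T H \<eta> :: real and A :: "nat \<Rightarrow> real" and \<beta> :: "nat \<Rightarrow> int \<Rightarrow> real \<Rightarrow> 'w \<Rightarrow> real"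
  assumes T: "0 < T" and H: "0 < H" and \<eta>: "0 < \<eta>" and A: "\<And>l. 0 \<le> A l"
    and summ: "summable (\<lambda>l. A l * real l powr (1 + \<eta>))"
    and fbm: "\<And>l m. \<bar>m\<bar> \<le> int l \<Longrightarrow> is_fbm M T H (\<beta> l m)"
    and indep: "indep_vars (\<lambda>_. Pi\<^sub>M {0..T} (\<lambda>_. borel))
           (\<lambda>(l, m) \<omega>. restrict (\<lambda>t. \<beta> l m t \<omega>) {0..T}) {(l, m). \<bar>m\<bar> \<le> int l}"
begin

abbreviation X :: "3 list \<Rightarrow> nat \<Rightarrow> real \<Rightarrow> real^3 \<Rightarrow> 'w \<Rightarrow> real" where
  "X w j t x \<omega> \<equiv> block_sum A (\<lambda>l m. \<beta> l m t \<omega>) w j x"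

lemma increment_sum_moment:
  assumes F: "finite F" "F \<subseteq> {(l, m). \<bar>m\<bar> \<le> int l}" and st: "s \<in> {0..T}" "t \<in> {0..T}" and q: "0 < q"
  shows "(\<integral>\<^sup>+\<omega>. ennreal ((\<Sum>(l, m)\<in>F. c (l, m) * (\<beta> l m t \<omega> - \<beta> l m s \<omega>)) ^ (2 * q)) \<partial>M)
    \<le> ennreal (gauss_mom q * (\<Sum>i\<in>F. (c i)\<^sup>2) ^ q * \<bar>t - s\<bar> powr (2 * real q * H))"
proof (cases "s = t")
  case True
  then show ?thesis using q by (simp add: case_prod_beta power_0_left)
next
  case False
  define Z where "Z i \<omega> = \<beta> (fst i) (snd i) t \<omega> - \<beta> (fst i) (snd i) s \<omega>" for i \<omega>
  have "indep_vars (\<lambda>_. borel) (\<lambda>i \<omega>. (\<lambda>f. f t - f s) ((\<lambda>(l, m) \<omega>. restrict (\<lambda>t. \<beta> l m t \<omega>) {0..T}) i \<omega>)) F"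
    by (rule indep_vars_compose2[OF indep_vars_subset[OF indep F(2)]])
      (use st in \<open>intro borel_measurable_diff measurable_component_singleton\<close>)
  moreover have "(\<lambda>i \<omega>. (\<lambda>f. f t - f s) ((\<lambda>(l, m) \<omega>. restrict (\<lambda>t. \<beta> l m t \<omega>) {0..T}) i \<omega>)) = Z"
    using st by (auto simp: fun_eq_iff Z_def)
  ultimately have ind: "indep_vars (\<lambda>_. borel) Z F" by simp
  have "(\<integral>\<^sup>+\<omega>. ennreal ((\<Sum>i\<in>F. c i * Z i \<omega>) ^ (2 * q)) \<partial>M)
    = ennreal (gauss_mom q * ((\<bar>t - s\<bar> powr H)\<^sup>2 * (\<Sum>i\<in>F. (c i)\<^sup>2)) ^ q)"
  proof (rule indep_normal_sum_even_moment[OF F(1) ind _ _ q])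
    fix i assume "i \<in> F"
    then have "\<bar>snd i\<bar> \<le> int (fst i)" using F(2) by auto
    from fbm_increment_distributed[OF fbm[OF this] st False]
    show "distributed M lborel (Z i) (normal_density 0 (\<bar>t - s\<bar> powr H))" unfolding Z_def .
  qed (use False in auto)
  also have "((\<bar>t - s\<bar> powr H)\<^sup>2 * (\<Sum>i\<in>F. (c i)\<^sup>2)) ^ q = (\<Sum>i\<in>F. (c i)\<^sup>2) ^ q * \<bar>t - s\<bar> powr (2 * real q * H)"
    using False by (simp add: power_mult_distrib power_mult[symmetric] powr_realpow[symmetric] powr_powr mult_ac)
  finally show ?thesis by (simp add: Z_def case_prod_beta mult.assoc)
qed

lemma summable_A_shift: "summable (\<lambda>l. A l * (real l + 1) powr (1 + \<eta>))"
proof (rule summable_comparison_test'[where N = 1])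
  show "summable (\<lambda>l. 2 powr (1 + \<eta>) * (A l * real l powr (1 + \<eta>)))"
    by (intro summable_mult summ)
  fix l :: nat assume l: "1 \<le> l"
  have "(real l + 1) powr (1 + \<eta>) \<le> (2 * real l) powr (1 + \<eta>)"
    using l \<eta> by (intro powr_mono2) auto
  also have "\<dots> = 2 powr (1 + \<eta>) * real l powr (1 + \<eta>)" by (simp add: powr_mult)
  finally have "A l * (real l + 1) powr (1 + \<eta>) \<le> A l * (2 powr (1 + \<eta>) * real l powr (1 + \<eta>))"
    by (intro mult_left_mono A)
  then show "norm (A l * (real l + 1) powr (1 + \<eta>)) \<le> 2 powr (1 + \<eta>) * (A l * real l powr (1 + \<eta>))"
    using A[of l] by (simp add: mult_ac)
qed

definition "A_sum = (\<Sum>l. A l * (real l + 1) powr (1 + \<eta>))"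

lemma A_sum_nonneg: "0 \<le> A_sum" unfolding A_sum_def using A by (intro suminf_nonneg summable_A_shift) simp

lemma dyadic_block_A_sum_le: "(\<Sum>l\<in>dyadic_block j. A l * (real l + 1) powr (1 + \<eta>)) \<le> A_sum"
  unfolding A_sum_def using A by (intro sum_le_suminf summable_A_shift) auto

lemma sqrt_A_le: "sqrt (A l) \<le> 1 + A_sum"
proof -
  have "A l * 1 \<le> A l * (real l + 1) powr (1 + \<eta>)"
    using \<eta> by (intro mult_left_mono A ge_one_powr_ge_zero) auto
  also have "\<dots> \<le> A_sum"
    unfolding A_sum_def using A sum_le_suminf[OF summable_A_shift, of "{l}"] by auto
  finally have "A l \<le> A_sum" by simp
  also have "\<dots> \<le> (1 + A_sum)\<^sup>2" using A_sum_nonneg by (simp add: power2_eq_square algebra_simps)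
  finally show ?thesis using A_sum_nonneg by (intro real_le_lsqrt) auto
qed

lemma dyadic_block_variance:
  "\<exists>C\<ge>0. \<forall>j. \<forall>x\<in>S2. (\<Sum>l\<in>dyadic_block j. \<Sum>m\<in>{- int l..int l}. (sqrt (A l) * sph_ext_deriv w l m x)\<^sup>2)
     \<le> C * 2 powr (real j * (2 * real (length w) - \<eta>))"
proof -
  define e where "e = 2 * real (length w) - \<eta>"
  obtain C where C: "C \<ge> 0" "\<And>l x. x \<in> S2 \<Longrightarrow>
      (\<Sum>m\<in>{- int l..int l}. (sph_ext_deriv w l m x)\<^sup>2) \<le> C * (real l + 1) ^ (1 + 2 * length w)"
    using sph_ext_deriv_bound[of w] by blast
  have powr: "(real l + 1) powr e \<le> 2 powr \<bar>e\<bar> * 2 powr (real j * e)" if "l \<in> dyadic_block j" for l j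
  proof (cases "0 \<le> e")
    case True
    have "(real l + 1) powr e \<le> (2 * 2 ^ j) powr e"
      using dyadic_block_bounds[OF that] True by (intro powr_mono2) auto
    also have "\<dots> = 2 powr \<bar>e\<bar> * 2 powr (real j * e)"
      using True by (simp add: powr_mult powr_realpow[symmetric] powr_powr)
    finally show ?thesis .
  next
    case False
    have "(real l + 1) powr e \<le> (2 ^ j) powr e"
      using dyadic_block_bounds[OF that] False by (intro powr_mono2') auto
    also have "\<dots> = 1 * 2 powr (real j * e)"
      by (simp add: powr_realpow[symmetric] powr_powr)
    also have "\<dots> \<le> 2 powr \<bar>e\<bar> * 2 powr (real j * e)"
      by (intro mult_right_mono ge_one_powr_ge_zero) auto
    finally show ?thesis .
  qed
  have "(\<Sum>l\<in>dyadic_block j. \<Sum>m\<in>{- int l..int l}. (sqrt (A l) * sph_ext_deriv w l m x)\<^sup>2)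
     \<le> C * 2 powr \<bar>e\<bar> * A_sum * 2 powr (real j * e)" if x: "x \<in> S2" for j x
  proof -
    have "(\<Sum>l\<in>dyadic_block j. \<Sum>m\<in>{- int l..int l}. (sqrt (A l) * sph_ext_deriv w l m x)\<^sup>2)
      \<le> (\<Sum>l\<in>dyadic_block j. C * 2 powr \<bar>e\<bar> * 2 powr (real j * e) * (A l * (real l + 1) powr (1 + \<eta>)))"
    proof (rule sum_mono)
      fix l assume l: "l \<in> dyadic_block j"
      have "(\<Sum>m\<in>{- int l..int l}. (sqrt (A l) * sph_ext_deriv w l m x)\<^sup>2) = A l * (\<Sum>m\<in>{- int l..int l}. (sph_ext_deriv w l m x)\<^sup>2)"
        using A[of l] by (simp add: power_mult_distrib sum_distrib_left)
      also have "\<dots> \<le> A l * (C * (real l + 1) ^ (1 + 2 * length w))"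
        by (intro mult_left_mono A C x)
      also have "(real l + 1) ^ (1 + 2 * length w) = (real l + 1) powr (1 + \<eta>) * (real l + 1) powr e"
        by (simp add: powr_add[symmetric] powr_realpow[symmetric] e_def del: power_Suc)
      also have "A l * (C * ((real l + 1) powr (1 + \<eta>) * (real l + 1) powr e)) \<le>
         A l * (C * ((real l + 1) powr (1 + \<eta>) * (2 powr \<bar>e\<bar> * 2 powr (real j * e))))"
        using A C(1) by (intro mult_left_mono powr l) auto
      finally show "(\<Sum>m\<in>{- int l..int l}. (sqrt (A l) * sph_ext_deriv w l m x)\<^sup>2)
         \<le> C * 2 powr \<bar>e\<bar> * 2 powr (real j * e) * (A l * (real l + 1) powr (1 + \<eta>))" by (simp add: mult_ac)
    qed
    also have "\<dots> = C * 2 powr \<bar>e\<bar> * 2 powr (real j * e) * (\<Sum>l\<in>dyadic_block j. A l * (real l + 1) powr (1 + \<eta>))"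
      by (simp add: sum_distrib_left)
    also have "\<dots> \<le> C * 2 powr \<bar>e\<bar> * 2 powr (real j * e) * A_sum"
      using C(1) by (intro mult_left_mono dyadic_block_A_sum_le) auto
    finally show ?thesis by (simp add: mult_ac)
  qed
  then show ?thesis unfolding e_def[symmetric] using C(1) A_sum_nonneg
    by (intro exI[of _ "C * 2 powr \<bar>e\<bar> * A_sum"]) auto
qed

lemma beta_holder:
  assumes a: "0 < a" "a < H"
  shows "AE \<omega> in M. \<exists>C\<ge>0. \<forall>l. \<forall>m\<in>{- int l..int l}. \<forall>s\<in>{0..T}. \<forall>t\<in>{0..T}.
     \<bar>\<beta> l m t \<omega> - \<beta> l m s \<omega>\<bar> \<le> C * (real l + 1)\<^sup>2 * \<bar>t - s\<bar> powr a"
proof -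
  obtain q0 :: nat where "1 / (2 * (H - a)) < real q0" using reals_Archimedean2 by blast
  then have q0: "1 < 2 * real q0 * (H - a)" using a by (simp add: field_simps)
  then have q: "0 < q0" by (cases q0) auto
  have "AE \<omega> in M. \<exists>C\<ge>0. \<forall>l. \<forall>m\<in>{- int l..int l}. \<forall>s\<in>{0..T}. \<forall>t\<in>{0..T}.
     \<bar>\<beta> l m t \<omega> / (real l + 1)\<^sup>2 - \<beta> l m s \<omega> / (real l + 1)\<^sup>2\<bar> \<le> C * \<bar>t - s\<bar> powr a"
  proof (rule kolmogorov_family[OF T a(1) q0])
    fix l m t assume "m \<in> {- int l..int l}" "t \<in> {0..T}"
    then show "(\<lambda>\<omega>. \<beta> l m t \<omega> / (real l + 1)\<^sup>2) \<in> borel_measurable M"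
      using is_fbm_square_integrable(1)[OF fbm] by (intro borel_measurable_divide) auto
  next
    fix l m \<omega> assume "m \<in> {- int l..int l}" "\<omega> \<in> space M"
    then show "continuous_on {0..T} (\<lambda>t. \<beta> l m t \<omega> / (real l + 1)\<^sup>2)"
      using fbm[of m l] unfolding is_fbm_def by (intro continuous_intros) auto
  next
    fix l m s t assume m: "m \<in> {- int l..int l}" and st: "s \<in> {0..T}" "t \<in> {0..T}"
    have "(\<integral>\<^sup>+\<omega>. ennreal ((\<Sum>(l', m')\<in>{(l, m)}. (1 / (real l + 1)\<^sup>2) * (\<beta> l' m' t \<omega> - \<beta> l' m' s \<omega>)) ^ (2 * q0)) \<partial>M)
     \<le> ennreal (gauss_mom q0 * (\<Sum>i\<in>{(l, m)}. (1 / (real l + 1)\<^sup>2)\<^sup>2) ^ q0 * \<bar>t - s\<bar> powr (2 * real q0 * H))"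
      using m by (intro increment_sum_moment[where c = "\<lambda>_. 1 / (real l + 1)\<^sup>2"] st q) auto
    then show "(\<integral>\<^sup>+\<omega>. ennreal ((\<beta> l m t \<omega> / (real l + 1)\<^sup>2 - \<beta> l m s \<omega> / (real l + 1)\<^sup>2) ^ (2 * q0)) \<partial>M)
     \<le> ennreal (gauss_mom q0 * ((1 / (real l + 1)\<^sup>2)\<^sup>2) ^ q0 * \<bar>t - s\<bar> powr (2 * real q0 * H))"
      by (simp add: diff_divide_distrib)
  next
    show "0 \<le> gauss_mom q0 * ((1 / (real l + 1)\<^sup>2)\<^sup>2) ^ q0" for l by (simp add: gauss_mom_def)
    show "summable (\<lambda>l. real (card {- int l..int l}) * (gauss_mom q0 * ((1 / (real l + 1)\<^sup>2)\<^sup>2) ^ q0))"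
    proof (rule summable_comparison_test'[where N = 0])
      show "summable (\<lambda>l. 2 * gauss_mom q0 * (1 / real (Suc l) ^ 2))"
        using inverse_power_summable[of 2, where 'a = real] 
        by (intro summable_mult) (simp add: summable_Suc_iff[of "\<lambda>n. 1 / real n ^ 2"] inverse_eq_divide del: of_nat_Suc)
      fix l :: nat
      define z where "z = 1 / (real l + 1)"
      have z: "0 < z" "z \<le> 1" "real l + 1 = 1 / z" by (auto simp: z_def)
      have "((1 / (real l + 1)\<^sup>2)\<^sup>2) ^ q0 = z ^ (4 * q0)"
        by (simp add: z_def power_divide power_mult[symmetric])
      also have "\<dots> \<le> z ^ 3" using z q by (intro power_decreasing) auto
      finally have "(2 * real l + 1) * (gauss_mom q0 * ((1 / (real l + 1)\<^sup>2)\<^sup>2) ^ q0) \<le> 2 * (real l + 1) * (gauss_mom q0 * z ^ 3)"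
        using z by (intro mult_mono mult_left_mono) (auto simp: gauss_mom_def)
      also have "\<dots> = 2 * gauss_mom q0 * z\<^sup>2" unfolding z(3) using z by (simp add: power3_eq_cube power2_eq_square)
      finally show "norm (real (card {- int l..int l}) * (gauss_mom q0 * ((1 / (real l + 1)\<^sup>2)\<^sup>2) ^ q0))
        \<le> 2 * gauss_mom q0 * (1 / real (Suc l) ^ 2)"
        by (simp add: z_def gauss_mom_def power_divide add.commute)
    qed
  qed auto
  then show ?thesis
  proof (rule AE_mp[OF _ AE_I2], intro impI)
    fix \<omega> assume "\<exists>C\<ge>0. \<forall>l. \<forall>m\<in>{- int l..int l}. \<forall>s\<in>{0..T}. \<forall>t\<in>{0..T}.
     \<bar>\<beta> l m t \<omega> / (real l + 1)\<^sup>2 - \<beta> l m s \<omega> / (real l + 1)\<^sup>2\<bar> \<le> C * \<bar>t - s\<bar> powr a"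
    then obtain C where C: "C \<ge> 0" "\<And>l m s t. m \<in> {- int l..int l} \<Longrightarrow> s \<in> {0..T} \<Longrightarrow> t \<in> {0..T} \<Longrightarrow>
      \<bar>\<beta> l m t \<omega> / (real l + 1)\<^sup>2 - \<beta> l m s \<omega> / (real l + 1)\<^sup>2\<bar> \<le> C * \<bar>t - s\<bar> powr a" by blast
    have "\<bar>\<beta> l m t \<omega> - \<beta> l m s \<omega>\<bar> \<le> C * (real l + 1)\<^sup>2 * \<bar>t - s\<bar> powr a"
      if "m \<in> {- int l..int l}" "s \<in> {0..T}" "t \<in> {0..T}" for l m s t
    proof -
      have "\<bar>\<beta> l m t \<omega> - \<beta> l m s \<omega>\<bar> / (real l + 1)\<^sup>2 \<le> C * \<bar>t - s\<bar> powr a"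
        using C(2)[OF that] by (simp add: diff_divide_distrib[symmetric])
      then show ?thesis by (simp add: pos_divide_le_eq mult_ac)
    qed
    then show "\<exists>C\<ge>0. \<forall>l. \<forall>m\<in>{- int l..int l}. \<forall>s\<in>{0..T}. \<forall>t\<in>{0..T}.
     \<bar>\<beta> l m t \<omega> - \<beta> l m s \<omega>\<bar> \<le> C * (real l + 1)\<^sup>2 * \<bar>t - s\<bar> powr a" using C(1) by blast
  qed
qed

lemma X_diff_Sigma:
  "X w j t x \<omega> - X w j s x \<omega> = (\<Sum>(l, m)\<in>Sigma (dyadic_block j) (\<lambda>l. {- int l..int l}).
     (sqrt (A l) * sph_ext_deriv w l m x) * (\<beta> l m t \<omega> - \<beta> l m s \<omega>))"
  unfolding block_sum_diff[symmetric] unfolding block_sum_def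
  by (subst sum.Sigma) (auto simp: mult_ac)

lemma X_net_holder:
  fixes N :: "nat \<Rightarrow> (real^3) set" and R :: nat
  assumes a: "0 < a" "a < H" and \<epsilon>: "0 < \<epsilon>"
    and N: "\<And>j. finite (N j)" "\<And>j. N j \<subseteq> S2" "\<And>j. card (N j) \<le> (2 * 2 ^ (j * R) + 1) ^ 3"
  shows "AE \<omega> in M. \<exists>C\<ge>0. \<forall>j. \<forall>x\<in>N j. \<forall>s\<in>{0..T}. \<forall>t\<in>{0..T}.
     \<bar>X w j t x \<omega> - X w j s x \<omega>\<bar> \<le> C * 2 powr (real j * (real (length w) - \<eta> / 2 + \<epsilon>)) * \<bar>t - s\<bar> powr a"
proof -
  obtain q :: nat where "max (1 / (2 * (H - a))) (3 * real R / (2 * \<epsilon>)) < real q"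
    using reals_Archimedean2 by blast
  then have q: "1 < 2 * real q * (H - a)" "3 * real R < 2 * real q * \<epsilon>" using a \<epsilon> by (auto simp: field_simps)
  then have q0: "0 < q" by (cases q) auto
  obtain V where V: "V \<ge> 0" "\<And>j x. x \<in> S2 \<Longrightarrow>
      (\<Sum>l\<in>dyadic_block j. \<Sum>m\<in>{- int l..int l}. (sqrt (A l) * sph_ext_deriv w l m x)\<^sup>2) \<le> V * 2 powr (real j * (2 * real (length w) - \<eta>))"
    using dyadic_block_variance[of w] by blast
  define W where "W j = 2 powr (real j * (real (length w) - \<eta> / 2 + \<epsilon>))" for j :: nat
  have W: "0 < W j" for j by (simp add: W_def)
  define \<rho> where "\<rho> = 2 powr (- (2 * \<epsilon>))"
  define v where "v j = gauss_mom q * (V * \<rho> ^ j) ^ q" for j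
  have g0: "0 \<le> gauss_mom q" by (simp add: gauss_mom_def)
  have v0: "0 \<le> v j" for j using V(1) by (simp add: v_def g0 \<rho>_def)
  have "AE \<omega> in M. \<exists>C\<ge>0. \<forall>j. \<forall>x\<in>N j. \<forall>s\<in>{0..T}. \<forall>t\<in>{0..T}.
     \<bar>X w j t x \<omega> / W j - X w j s x \<omega> / W j\<bar> \<le> C * \<bar>t - s\<bar> powr a"
  proof (rule kolmogorov_family[OF T a(1) q(1) N(1)])
    fix j x t assume "x \<in> N j" "t \<in> {0..T}"
    then show "(\<lambda>\<omega>. X w j t x \<omega> / W j) \<in> borel_measurable M"
      unfolding block_sum_def
      using is_fbm_square_integrable(1)[OF fbm]
      by (intro borel_measurable_divide borel_measurable_sum borel_measurable_times borel_measurable_const) auto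
  next
    fix j x \<omega> assume \<omega>: "\<omega> \<in> space M"
    have "continuous_on {0..T} (\<lambda>t. \<beta> l m t \<omega>)" if "m \<in> {- int l..int l}" for l m
      using fbm[of m l] \<omega> that unfolding is_fbm_def by auto
    then show "continuous_on {0..T} (\<lambda>t. X w j t x \<omega> / W j)"
      unfolding block_sum_def using W[of j] by (intro continuous_intros) auto
  next
    fix j x s t assume x: "x \<in> N j" and st: "s \<in> {0..T}" "t \<in> {0..T}"
    let ?F = "Sigma (dyadic_block j) (\<lambda>l. {- int l..int l})"
    let ?c = "\<lambda>(l, m). sqrt (A l) * sph_ext_deriv w l m x / W j"
    have "(\<Sum>i\<in>?F. (?c i)\<^sup>2) = (\<Sum>l\<in>dyadic_block j. \<Sum>m\<in>{- int l..int l}. (sqrt (A l) * sph_ext_deriv w l m x)\<^sup>2) / (W j)\<^sup>2"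
      by (subst sum.Sigma) (auto simp: sum_divide_distrib power_divide intro!: sum.cong)
    also have "\<dots> \<le> V * 2 powr (real j * (2 * real (length w) - \<eta>)) / (W j)\<^sup>2"
      using x N(2) by (intro divide_right_mono V(2)) auto
    also have "\<dots> = V * \<rho> ^ j"
      by (simp add: W_def \<rho>_def power2_eq_square powr_add[symmetric] powr_diff[symmetric] powr_realpow[symmetric]
          powr_powr times_divide_eq_right[symmetric] del: times_divide_eq_right)
         (simp add: algebra_simps)
    finally have cF: "(\<Sum>i\<in>?F. (?c i)\<^sup>2) \<le> V * \<rho> ^ j" .
    have "X w j t x \<omega> / W j - X w j s x \<omega> / W j = (\<Sum>(l, m)\<in>?F. ?c (l, m) * (\<beta> l m t \<omega> - \<beta> l m s \<omega>))" for \<omega>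
      unfolding diff_divide_distrib[symmetric] X_diff_Sigma by (simp add: sum_divide_distrib case_prod_beta)
    then have "(\<integral>\<^sup>+\<omega>. ennreal ((X w j t x \<omega> / W j - X w j s x \<omega> / W j) ^ (2 * q)) \<partial>M) =
      (\<integral>\<^sup>+\<omega>. ennreal ((\<Sum>(l, m)\<in>?F. ?c (l, m) * (\<beta> l m t \<omega> - \<beta> l m s \<omega>)) ^ (2 * q)) \<partial>M)" by presburger
    also have "\<dots> \<le> ennreal (gauss_mom q * (\<Sum>i\<in>?F. (?c i)\<^sup>2) ^ q * \<bar>t - s\<bar> powr (2 * real q * H))"
      by (rule increment_sum_moment[OF _ _ st q0]) auto
    also have "\<dots> \<le> ennreal (v j * \<bar>t - s\<bar> powr (2 * real q * H))"
      unfolding v_def using cF g0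
      by (intro ennreal_leI mult_right_mono mult_left_mono power_mono) (auto intro!: sum_nonneg)
    finally show "(\<integral>\<^sup>+\<omega>. ennreal ((X w j t x \<omega> / W j - X w j s x \<omega> / W j) ^ (2 * q)) \<partial>M) \<le>
      ennreal (v j * \<bar>t - s\<bar> powr (2 * real q * H))" .
  next
    show "summable (\<lambda>j. real (card (N j)) * v j)"
    proof (rule summable_comparison_test'[where N = 0])
      show "summable (\<lambda>j. 27 * gauss_mom q * V ^ q * (2 powr (3 * real R - 2 * real q * \<epsilon>)) ^ j)"
        using q by (intro summable_mult summable_geometric) (auto intro!: powr_less_one)
      fix j :: nat
      have "real (card (N j)) \<le> real ((2 * 2 ^ (j * R) + 1) ^ 3)" using N(3)[of j] of_nat_le_iff by blast
      also have "\<dots> = (2 * 2 ^ (j * R) + 1) ^ 3" by (simp add: add.commute)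
      also have "\<dots> \<le> (3 * 2 ^ (j * R)) ^ 3" by (intro power_mono) auto
      also have "\<dots> = 27 * 2 ^ (3 * (j * R))" by (simp add: power_mult_distrib power_mult[symmetric] mult.commute)
      finally have "real (card (N j)) * v j \<le> 27 * 2 ^ (3 * (j * R)) * v j"
        by (intro mult_right_mono v0)
      also have "\<dots> = 27 * gauss_mom q * V ^ q * (2 ^ (3 * (j * R)) * (\<rho> ^ j) ^ q)"
        by (simp add: v_def power_mult_distrib)
      also have "2 ^ (3 * (j * R)) * (\<rho> ^ j) ^ q = (2 powr (3 * real R - 2 * real q * \<epsilon>)) ^ j"
      proof -
        have "(2::real) ^ (3 * (j * R)) = 2 powr (real (3 * (j * R)))" by (rule powr_realpow[symmetric]) simp
        moreover have "(\<rho> ^ j) ^ q = 2 powr (- (2 * \<epsilon> * real (j * q)))"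
          by (simp add: \<rho>_def power_mult[symmetric] powr_realpow[symmetric] powr_powr mult.assoc)
        moreover have "(2 powr (3 * real R - 2 * real q * \<epsilon>)) ^ j = 2 powr ((3 * real R - 2 * real q * \<epsilon>) * real j)"
          by (simp add: powr_realpow[symmetric] powr_powr)
        ultimately show ?thesis by (simp add: powr_add[symmetric] algebra_simps)
      qed
      finally show "norm (real (card (N j)) * v j) \<le> 27 * gauss_mom q * V ^ q * (2 powr (3 * real R - 2 * real q * \<epsilon>)) ^ j"
        using v0[of j] by simp
    qed
  qed (use v0 in auto)
  then show ?thesis
  proof (rule AE_mp[OF _ AE_I2], intro impI)
    fix \<omega> assume "\<exists>C\<ge>0. \<forall>j. \<forall>x\<in>N j. \<forall>s\<in>{0..T}. \<forall>t\<in>{0..T}.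
     \<bar>X w j t x \<omega> / W j - X w j s x \<omega> / W j\<bar> \<le> C * \<bar>t - s\<bar> powr a"
    then obtain C where C: "C \<ge> 0" "\<And>j x s t. x \<in> N j \<Longrightarrow> s \<in> {0..T} \<Longrightarrow> t \<in> {0..T} \<Longrightarrow>
      \<bar>X w j t x \<omega> / W j - X w j s x \<omega> / W j\<bar> \<le> C * \<bar>t - s\<bar> powr a" by blast
    have "\<bar>X w j t x \<omega> - X w j s x \<omega>\<bar> \<le> C * W j * \<bar>t - s\<bar> powr a"
      if "x \<in> N j" "s \<in> {0..T}" "t \<in> {0..T}" for j x s t
    proof -
      have "\<bar>X w j t x \<omega> - X w j s x \<omega>\<bar> / W j \<le> C * \<bar>t - s\<bar> powr a"
        using C(2)[OF that] W[of j] by (simp add: diff_divide_distrib[symmetric])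
      then show ?thesis using W[of j] by (simp add: pos_divide_le_eq mult_ac)
    qed
    then show "\<exists>C\<ge>0. \<forall>j. \<forall>x\<in>N j. \<forall>s\<in>{0..T}. \<forall>t\<in>{0..T}.
     \<bar>X w j t x \<omega> - X w j s x \<omega>\<bar> \<le> C * 2 powr (real j * (real (length w) - \<eta> / 2 + \<epsilon>)) * \<bar>t - s\<bar> powr a"
      unfolding W_def[symmetric] using C(1) by blast
  qed
qed

text \<open>From the net to all of the sphere: off the net the crude Lipschitz bound loses a fixed power of
  \<open>2\<^sup>j\<close>, which the mesh \<open>2^(-jR)\<close> compensates.\<close>

lemma X_holder:
  assumes a: "0 < a" "a < H" and \<epsilon>: "0 < \<epsilon>"
  shows "AE \<omega> in M. \<exists>C\<ge>0. \<forall>j. \<forall>x\<in>S2. \<forall>s\<in>{0..T}. \<forall>t\<in>{0..T}.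
     \<bar>X w j t x \<omega> - X w j s x \<omega>\<bar> \<le> C * 2 powr (real j * (real (length w) - \<eta> / 2 + \<epsilon>)) * \<bar>t - s\<bar> powr a"
proof -
  let ?k = "length w"
  obtain R :: nat where R: "7 + \<eta> / 2 < real R" using reals_Archimedean2 by blast
  have "\<forall>j. \<exists>N. finite N \<and> N \<subseteq> S2 \<and> card N \<le> (2 * 2 ^ (j * R) + 1) ^ 3 \<and>
      (\<forall>x\<in>S2. \<exists>y\<in>N. norm (x - y) \<le> 3 / real (2 ^ (j * R)))"
    by (intro allI sphere_net) simp
  then obtain N where N: "\<And>j. finite (N j)" "\<And>j. N j \<subseteq> S2" "\<And>j. card (N j) \<le> (2 * 2 ^ (j * R) + 1) ^ 3"
    "\<And>j x. x \<in> S2 \<Longrightarrow> \<exists>y\<in>N j. norm (x - y) \<le> 3 / real (2 ^ (j * R))"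
    by metis
  obtain L where L: "L \<ge> 0" "\<And>l m x y. x \<in> S2 \<Longrightarrow> y \<in> S2 \<Longrightarrow> \<bar>m\<bar> \<le> int l \<Longrightarrow>
     \<bar>sph_ext_deriv w l m x - sph_ext_deriv w l m y\<bar> \<le> L * (real l + 1) ^ (?k + 2) * norm (x - y)"
    using sph_ext_deriv_lipschitz[of w] by blast
  show ?thesis
    using X_net_holder[OF a \<epsilon> N(1-3), of w] beta_holder[OF a]
  proof eventually_elim
    fix \<omega>
    assume "\<exists>C\<ge>0. \<forall>j. \<forall>x\<in>N j. \<forall>s\<in>{0..T}. \<forall>t\<in>{0..T}.
     \<bar>X w j t x \<omega> - X w j s x \<omega>\<bar> \<le> C * 2 powr (real j * (real ?k - \<eta> / 2 + \<epsilon>)) * \<bar>t - s\<bar> powr a"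
    then obtain C1 where C1: "C1 \<ge> 0" "\<And>j x s t. x \<in> N j \<Longrightarrow> s \<in> {0..T} \<Longrightarrow> t \<in> {0..T} \<Longrightarrow>
      \<bar>X w j t x \<omega> - X w j s x \<omega>\<bar> \<le> C1 * 2 powr (real j * (real ?k - \<eta> / 2 + \<epsilon>)) * \<bar>t - s\<bar> powr a" by blast
    assume "\<exists>C\<ge>0. \<forall>l. \<forall>m\<in>{- int l..int l}. \<forall>s\<in>{0..T}. \<forall>t\<in>{0..T}.
     \<bar>\<beta> l m t \<omega> - \<beta> l m s \<omega>\<bar> \<le> C * (real l + 1)\<^sup>2 * \<bar>t - s\<bar> powr a"
    then obtain C2 where C2: "C2 \<ge> 0" "\<And>l m s t. m \<in> {- int l..int l} \<Longrightarrow> s \<in> {0..T} \<Longrightarrow> t \<in> {0..T} \<Longrightarrow>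
     \<bar>\<beta> l m t \<omega> - \<beta> l m s \<omega>\<bar> \<le> C2 * (real l + 1)\<^sup>2 * \<bar>t - s\<bar> powr a" by blast
    define D where "D = (1 + A_sum) * C2 * L * 3 * 2 ^ (?k + 7)"
    have D: "0 \<le> D" using A_sum_nonneg C2(1) L(1) by (simp add: D_def)
    have "\<bar>X w j t x \<omega> - X w j s x \<omega>\<bar> \<le> (C1 + D) * 2 powr (real j * (real ?k - \<eta> / 2 + \<epsilon>)) * \<bar>t - s\<bar> powr a"
      if x: "x \<in> S2" and st: "s \<in> {0..T}" "t \<in> {0..T}" for j x s t
    proof -
      obtain y where y: "y \<in> N j" "norm (x - y) \<le> 3 / real (2 ^ (j * R))" using N(4)[OF x] by blast
      have yS: "y \<in> S2" using y N(2) by blast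
      define Q :: real where "Q = 2 * 2 ^ j"
      define \<delta> where "\<delta> = \<bar>t - s\<bar> powr a"
      have \<delta>: "0 \<le> \<delta>" by (simp add: \<delta>_def)
      define E where "E = (1 + A_sum) * (C2 * Q\<^sup>2 * \<delta>) * (L * Q ^ (?k + 2) * (3 / 2 ^ (j * R)))"
      have E: "0 \<le> E" using A_sum_nonneg C2(1) L(1) \<delta> by (simp add: E_def Q_def)
      have "\<bar>(X w j t x \<omega> - X w j s x \<omega>) - (X w j t y \<omega> - X w j s y \<omega>)\<bar> \<le>
         (\<Sum>l\<in>dyadic_block j. \<Sum>m\<in>{- int l..int l}. E)"
      proof -
        have "(X w j t x \<omega> - X w j s x \<omega>) - (X w j t y \<omega> - X w j s y \<omega>) =
          (\<Sum>l\<in>dyadic_block j. \<Sum>m\<in>{- int l..int l}. sqrt (A l) * (\<beta> l m t \<omega> - \<beta> l m s \<omega>) * (sph_ext_deriv w l m x - sph_ext_deriv w l m y))"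
          unfolding block_sum_diff[symmetric] unfolding block_sum_def
          by (simp add: sum_subtractf[symmetric] right_diff_distrib)
        also have "\<bar>\<dots>\<bar> \<le> (\<Sum>l\<in>dyadic_block j. \<Sum>m\<in>{- int l..int l}. \<bar>sqrt (A l) * (\<beta> l m t \<omega> - \<beta> l m s \<omega>) * (sph_ext_deriv w l m x - sph_ext_deriv w l m y)\<bar>)"
          by (rule order_trans[OF sum_abs sum_mono[OF sum_abs]])
        also have "\<dots> \<le> (\<Sum>l\<in>dyadic_block j. \<Sum>m\<in>{- int l..int l}. E)"
        proof (intro sum_mono)
          fix l m assume l: "l \<in> dyadic_block j" and m: "m \<in> {- int l..int l}"
          have lQ: "real l + 1 \<le> Q" using dyadic_block_bounds[OF l] by (simp add: Q_def)
          have "\<bar>\<beta> l m t \<omega> - \<beta> l m s \<omega>\<bar> \<le> C2 * (real l + 1)\<^sup>2 * \<delta>"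
            using C2(2)[OF m st] by (simp add: \<delta>_def)
          also have "\<dots> \<le> C2 * Q\<^sup>2 * \<delta>"
            using C2(1) \<delta> lQ by (intro mult_right_mono mult_left_mono power_mono) auto
          finally have 1: "\<bar>\<beta> l m t \<omega> - \<beta> l m s \<omega>\<bar> \<le> C2 * Q\<^sup>2 * \<delta>" .
          have "\<bar>sph_ext_deriv w l m x - sph_ext_deriv w l m y\<bar> \<le> L * (real l + 1) ^ (?k + 2) * norm (x - y)"
            using m by (intro L(2) x yS) auto
          also have "\<dots> \<le> L * Q ^ (?k + 2) * (3 / 2 ^ (j * R))"
            using L(1) lQ y(2) by (intro mult_mono power_mono) auto
          finally have 2: "\<bar>sph_ext_deriv w l m x - sph_ext_deriv w l m y\<bar> \<le> L * Q ^ (?k + 2) * (3 / 2 ^ (j * R))" .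
          show "\<bar>sqrt (A l) * (\<beta> l m t \<omega> - \<beta> l m s \<omega>) * (sph_ext_deriv w l m x - sph_ext_deriv w l m y)\<bar> \<le> E"
            unfolding E_def abs_mult
            using A[of l] A_sum_nonneg C2(1) \<delta> sqrt_A_le[of l] 1 2
            by (intro mult_mono) auto
        qed
        finally show ?thesis .
      qed
      also have "\<dots> \<le> (\<Sum>l\<in>dyadic_block j. Q\<^sup>2 * E)"
      proof (rule sum_mono)
        fix l assume l: "l \<in> dyadic_block j"
        have "1 \<le> (2::real) ^ j" by simp
        then have "2 * real l + 1 \<le> Q * 2" "2 \<le> Q" using dyadic_block_bounds[OF l] by (auto simp: Q_def)
        moreover from this have "Q * 2 \<le> Q * Q" by (intro mult_left_mono) auto
        ultimately have "2 * real l + 1 \<le> Q\<^sup>2" unfolding power2_eq_square by linarith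
        then show "(\<Sum>m\<in>{- int l..int l}. E) \<le> Q\<^sup>2 * E" using E by (simp add: mult_right_mono add.commute)
      qed
      also have "\<dots> \<le> Q * (Q\<^sup>2 * E)" using E by (simp add: card_dyadic_block Q_def mult_right_mono)
      also have "\<dots> = (1 + A_sum) * C2 * L * 3 * (Q ^ (?k + 7) / 2 ^ (j * R)) * \<delta>"
        by (simp add: E_def power_add eval_nat_numeral)
      also have "Q ^ (?k + 7) / 2 ^ (j * R) \<le> 2 ^ (?k + 7) * 2 powr (real j * (real ?k - \<eta> / 2 + \<epsilon>))"
      proof -
        have "Q ^ (?k + 7) / 2 ^ (j * R) = 2 ^ (?k + 7) * (2 ^ (j * (?k + 7)) / 2 ^ (j * R))"
          unfolding Q_def power_mult_distrib by (simp only: power_mult times_divide_eq_right)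
        also have "(2::real) ^ (j * (?k + 7)) / 2 ^ (j * R) = 2 powr (real (j * (?k + 7)) - real (j * R))"
          by (simp only: powr_diff powr_realpow zero_less_numeral)
        also have "\<dots> \<le> 2 powr (real j * (real ?k - \<eta> / 2 + \<epsilon>))"
        proof (rule powr_mono)
          have "real j * (real ?k + 7 - real R) \<le> real j * (real ?k - \<eta> / 2 + \<epsilon>)"
            using R \<epsilon> by (intro mult_left_mono) auto
          then show "real (j * (?k + 7)) - real (j * R) \<le> real j * (real ?k - \<eta> / 2 + \<epsilon>)"
            by (simp add: algebra_simps)
        qed simp
        finally show ?thesis by (simp add: mult_left_mono)
      qed
      then have "(1 + A_sum) * C2 * L * 3 * (Q ^ (?k + 7) / 2 ^ (j * R)) * \<delta> \<le>
         (1 + A_sum) * C2 * L * 3 * (2 ^ (?k + 7) * 2 powr (real j * (real ?k - \<eta> / 2 + \<epsilon>))) * \<delta>"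
        using A_sum_nonneg C2(1) L(1) \<delta> by (intro mult_right_mono mult_left_mono) auto
      also have "\<dots> = D * 2 powr (real j * (real ?k - \<eta> / 2 + \<epsilon>)) * \<delta>" by (simp add: D_def)
      finally have "\<bar>(X w j t x \<omega> - X w j s x \<omega>) - (X w j t y \<omega> - X w j s y \<omega>)\<bar> \<le>
          D * 2 powr (real j * (real ?k - \<eta> / 2 + \<epsilon>)) * \<delta>" .
      moreover have "\<bar>X w j t y \<omega> - X w j s y \<omega>\<bar> \<le> C1 * 2 powr (real j * (real ?k - \<eta> / 2 + \<epsilon>)) * \<delta>"
        using C1(2)[OF y(1) st] by (simp add: \<delta>_def)
      ultimately show ?thesis unfolding \<delta>_def[symmetric] distrib_right by linarith
    qed
    then show "\<exists>C\<ge>0. \<forall>j. \<forall>x\<in>S2. \<forall>s\<in>{0..T}. \<forall>t\<in>{0..T}.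
       \<bar>X w j t x \<omega> - X w j s x \<omega>\<bar> \<le> C * 2 powr (real j * (real ?k - \<eta> / 2 + \<epsilon>)) * \<bar>t - s\<bar> powr a"
      using C1(1) D by (intro exI[of _ "C1 + D"]) auto
  qed
qed

end

section \<open>Regularity of a single path\<close>

lemma block_sum_homogeneous:
  "y \<noteq> 0 \<Longrightarrow> block_sum A b w j y = block_sum A b w j (y /\<^sub>R norm y) / norm y ^ length w"
  unfolding block_sum_def sum_divide_distrib
  by (intro sum.cong refl) (subst sph_ext_deriv_homogeneous, auto)

lemma block_sum_has_derivative:
  assumes "y \<noteq> 0"
  shows "(block_sum A b w j has_derivative (\<lambda>h. \<Sum>i\<in>UNIV. h$i * block_sum A b (i # w) j y)) (at y)"
proof -
  have "(block_sum A b w j has_derivative (\<lambda>h. \<Sum>l\<in>dyadic_block j. \<Sum>m\<in>{- int l..int l}. sqrt (A l) * b l m *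
     (\<Sum>i\<in>UNIV. h$i * sph_ext_deriv (i # w) l m y))) (at y)"
    unfolding block_sum_def[abs_def] using assms
    by (intro has_derivative_sum has_derivative_mult_right sph_ext_deriv_has_derivative) auto
  then show ?thesis
    by (rule has_derivative_eq_rhs)
      (simp add: fun_eq_iff block_sum_def sum_3 sum_distrib_left sum.distrib[symmetric] algebra_simps)
qed

lemma norm_le_sph_dist:
  assumes "x \<in> S2" "y \<in> S2"
  shows "norm (x - y) \<le> sph_dist x y"
proof -
  let ?\<theta> = "arccos (x \<bullet> y)"
  have "\<bar>x \<bullet> y\<bar> \<le> 1" using Cauchy_Schwarz_ineq2[of x y] assms by (simp add: S2_iff_norm)
  then have c: "cos ?\<theta> = x \<bullet> y" "0 \<le> ?\<theta>" by (auto intro!: cos_arccos arccos_lbound)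
  have "(norm (x - y))\<^sup>2 = 2 - 2 * (x \<bullet> y)"
    using assms by (simp add: S2_iff_norm power2_norm_eq_inner inner_diff inner_commute norm_eq_1)
  also have "\<dots> = 4 * (sin (?\<theta> / 2))\<^sup>2"
    using cos_double_sin[of "?\<theta> / 2"] c by simp
  also have "\<dots> \<le> 4 * (?\<theta> / 2)\<^sup>2"
    using abs_sin_x_le_abs_x[of "?\<theta> / 2"] by (simp add: abs_le_square_iff[symmetric])
  also have "\<dots> = ?\<theta>\<^sup>2" by (simp add: power_divide)
  finally show ?thesis unfolding sph_dist_def using c(2) by (rule power2_le_imp_le)
qed

lemma summable_powr_geometric: "e < 0 \<Longrightarrow> summable (\<lambda>j. 2 powr (real j * e))"
proof -
  assume "e < 0"
  then have "summable (\<lambda>j. (2 powr e) ^ j)" by (intro summable_geometric) (auto intro!: powr_less_one)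
  moreover have "(2 powr e) ^ j = 2 powr (real j * e)" for j
    by (simp add: powr_realpow[symmetric] powr_powr mult.commute)
  ultimately show ?thesis by simp
qed

locale qfbm_path =
  fixes T H \<eta> :: real and A :: "nat \<Rightarrow> real" and b :: "nat \<Rightarrow> int \<Rightarrow> real \<Rightarrow> real"
  assumes T: "0 < T" and H: "0 < H" "H < 1" and \<eta>: "0 < \<eta>"
    and zero: "\<And>l m. \<bar>m\<bar> \<le> int l \<Longrightarrow> b l m 0 = 0"
    and holder: "\<And>w a \<epsilon>. 0 < a \<Longrightarrow> a < H \<Longrightarrow> 0 < \<epsilon> \<Longrightarrow>
      \<exists>C\<ge>0. \<forall>j. \<forall>x\<in>S2. \<forall>s\<in>{0..T}. \<forall>t\<in>{0..T}.
        \<bar>block_sum A (\<lambda>l m. b l m t) w j x - block_sum A (\<lambda>l m. b l m s) w j x\<bar>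
        \<le> C * 2 powr (real j * (real (length w) - \<eta> / 2 + \<epsilon>)) * \<bar>t - s\<bar> powr a"
begin

abbreviation X :: "3 list \<Rightarrow> nat \<Rightarrow> real \<Rightarrow> real^3 \<Rightarrow> real" where
  "X w j t x \<equiv> block_sum A (\<lambda>l m. b l m t) w j x"

definition Y :: "3 list \<Rightarrow> real \<Rightarrow> real^3 \<Rightarrow> real" where
  "Y w t x = (\<Sum>j. X w j t x)"

lemma X_bound:
  assumes "0 < \<epsilon>"
  shows "\<exists>C\<ge>0. \<forall>j. \<forall>x\<in>S2. \<forall>t\<in>{0..T}. \<bar>X w j t x\<bar> \<le> C * 2 powr (real j * (real (length w) - \<eta> / 2 + \<epsilon>))"
proof -
  obtain C where C: "C \<ge> 0" "\<And>j x s t. x \<in> S2 \<Longrightarrow> s \<in> {0..T} \<Longrightarrow> t \<in> {0..T} \<Longrightarrow>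
      \<bar>X w j t x - X w j s x\<bar> \<le> C * 2 powr (real j * (real (length w) - \<eta> / 2 + \<epsilon>)) * \<bar>t - s\<bar> powr (H / 2)"
    using holder[of "H / 2" \<epsilon> w] H assms by auto
  have "\<bar>X w j t x\<bar> \<le> C * T powr (H / 2) * 2 powr (real j * (real (length w) - \<eta> / 2 + \<epsilon>))"
    if "x \<in> S2" "t \<in> {0..T}" for j x t
  proof -
    have "X w j 0 x = 0" unfolding block_sum_def by (intro sum.neutral ballI) (auto simp: zero)
    then have "\<bar>X w j t x\<bar> \<le> C * 2 powr (real j * (real (length w) - \<eta> / 2 + \<epsilon>)) * \<bar>t\<bar> powr (H / 2)"
      using C(2)[OF that(1), of 0 t j] that T by simp
    also have "\<dots> \<le> C * 2 powr (real j * (real (length w) - \<eta> / 2 + \<epsilon>)) * T powr (H / 2)"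
      using that H C(1) by (intro mult_left_mono powr_mono2) auto
    finally show ?thesis by (simp add: mult_ac)
  qed
  then show ?thesis using C(1) by (intro exI[of _ "C * T powr (H / 2)"]) auto
qed

lemma X_summable_bound:
  assumes "real (length w) < \<eta> / 2"
  shows "\<exists>c. summable c \<and> (\<forall>j. 0 \<le> c j) \<and> (\<forall>j. \<forall>x\<in>S2. \<forall>t\<in>{0..T}. \<bar>X w j t x\<bar> \<le> c j)"
proof -
  define \<epsilon> where "\<epsilon> = (\<eta> / 2 - real (length w)) / 2"
  have "2 * \<epsilon> = \<eta> / 2 - real (length w)" by (simp add: \<epsilon>_def)
  then have \<epsilon>: "0 < \<epsilon>" "real (length w) - \<eta> / 2 + \<epsilon> < 0" using assms by linarith+
  obtain C where C: "C \<ge> 0" "\<And>j x t. x \<in> S2 \<Longrightarrow> t \<in> {0..T} \<Longrightarrow>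
      \<bar>X w j t x\<bar> \<le> C * 2 powr (real j * (real (length w) - \<eta> / 2 + \<epsilon>))"
    using X_bound[OF \<epsilon>(1), of w] by blast
  show ?thesis
    using C by (intro exI[of _ "\<lambda>j. C * 2 powr (real j * (real (length w) - \<eta> / 2 + \<epsilon>))"]
        conjI summable_mult summable_powr_geometric \<epsilon>) auto
qed

lemma X_summable:
  assumes "real (length w) < \<eta> / 2" "x \<in> S2" "t \<in> {0..T}"
  shows "summable (\<lambda>j. X w j t x)"
proof -
  obtain c where c: "summable c" "\<forall>j. \<forall>x\<in>S2. \<forall>t\<in>{0..T}. \<bar>X w j t x\<bar> \<le> c j"
    using X_summable_bound[OF assms(1)] by metis
  show ?thesis using c(2)[rule_format, OF assms(2,3)] by (intro summable_comparison_test'[OF c(1), of 0]) simp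
qed

lemma Y_diff_le:
  assumes w: "real (length w) < \<eta> / 2" and x: "x \<in> S2" "x' \<in> S2" and t: "t \<in> {0..T}" "t' \<in> {0..T}"
    and c: "summable c" "\<And>j. \<bar>X w j t x - X w j t' x'\<bar> \<le> c j * d"
  shows "\<bar>Y w t x - Y w t' x'\<bar> \<le> suminf c * d"
proof -
  note s = X_summable[OF w x(1) t(1)] X_summable[OF w x(2) t(2)]
  have cd: "summable (\<lambda>j. c j * d)" using c(1) by (rule summable_mult2)
  have abs: "summable (\<lambda>j. \<bar>X w j t x - X w j t' x'\<bar>)"
    using c(2) by (intro summable_comparison_test'[OF cd, of 0]) auto
  have "Y w t x - Y w t' x' = (\<Sum>j. X w j t x - X w j t' x')"
    unfolding Y_def by (rule suminf_diff[OF s])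
  also have "\<bar>\<dots>\<bar> \<le> (\<Sum>j. \<bar>X w j t x - X w j t' x'\<bar>)" by (rule summable_rabs[OF abs])
  also have "\<dots> \<le> (\<Sum>j. c j * d)" by (rule suminf_le[OF c(2) abs cd])
  also have "\<dots> = suminf c * d" by (rule suminf_mult2[OF c(1), symmetric])
  finally show ?thesis .
qed

lemma Y_holder_time:
  assumes a: "0 < a" "a < H"
  shows "\<exists>C\<ge>0. \<forall>x\<in>S2. \<forall>s\<in>{0..T}. \<forall>t\<in>{0..T}. \<bar>Y [] t x - Y [] s x\<bar> \<le> C * \<bar>t - s\<bar> powr a"
proof -
  obtain C where C: "C \<ge> 0" "\<And>j x s t. x \<in> S2 \<Longrightarrow> s \<in> {0..T} \<Longrightarrow> t \<in> {0..T} \<Longrightarrow>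
      \<bar>X [] j t x - X [] j s x\<bar> \<le> C * 2 powr (real j * (real (length ([] :: 3 list)) - \<eta> / 2 + \<eta> / 4)) * \<bar>t - s\<bar> powr a"
    using holder[OF a, of "\<eta> / 4" "[]"] \<eta> by auto
  define c where "c j = C * 2 powr (real j * (real (length ([] :: 3 list)) - \<eta> / 2 + \<eta> / 4))" for j :: nat
  have c: "summable c" unfolding c_def using \<eta> by (intro summable_mult summable_powr_geometric) simp
  have c0: "\<And>j. 0 \<le> c j" using C(1) by (simp add: c_def)
  have "\<bar>Y [] t x - Y [] s x\<bar> \<le> suminf c * \<bar>t - s\<bar> powr a" if "x \<in> S2" "s \<in> {0..T}" "t \<in> {0..T}" for x s t
    using that C(2) \<eta> by (intro Y_diff_le c) (auto simp: c_def)
  then show ?thesis using suminf_nonneg[OF c c0] by blast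
qed

lemma X_space_holder:
  assumes \<epsilon>: "0 < \<epsilon>" and \<gamma>: "0 < \<gamma>" "\<gamma> \<le> 1"
  shows "\<exists>C\<ge>0. \<forall>j. \<forall>t\<in>{0..T}. \<forall>x\<in>S2. \<forall>y\<in>S2.
    \<bar>X w j t x - X w j t y\<bar> \<le> C * 2 powr (real j * (real (length w) + \<gamma> - \<eta> / 2 + \<epsilon>)) * norm (x - y) powr \<gamma>"
proof -
  define e where "e = real (length w) - \<eta> / 2 + \<epsilon>"
  obtain C where C: "C \<ge> 0" "\<And>j x t. x \<in> S2 \<Longrightarrow> t \<in> {0..T} \<Longrightarrow> \<bar>X w j t x\<bar> \<le> C * 2 powr (real j * e)"
    using X_bound[OF \<epsilon>, of w] unfolding e_def by blast
  have eq: "real (length (i # w)) - \<eta> / 2 + \<epsilon> = e + 1" for i :: 3 by (simp add: e_def)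
  have "\<exists>D\<ge>0. \<forall>j. \<forall>x\<in>S2. \<forall>t\<in>{0..T}. \<bar>X (i # w) j t x\<bar> \<le> D * 2 powr (real j * (e + 1))" for i
    using X_bound[OF \<epsilon>, of "i # w"] unfolding eq .
  then obtain D where D: "\<And>i. D i \<ge> 0" "\<And>i j x t. x \<in> S2 \<Longrightarrow> t \<in> {0..T} \<Longrightarrow>
      \<bar>X (i # w) j t x\<bar> \<le> D i * 2 powr (real j * (e + 1))" by metis
  define E where "E = C + sum D UNIV"
  have E: "0 \<le> E" "C \<le> E" "D i \<le> E" for i
    using C(1) D(1) member_le_sum[of i UNIV D] by (auto simp: E_def sum_nonneg intro: add_nonneg_nonneg add_increasing)
  define K where "K = (4 + 3 * 2 ^ Suc (length w) :: real)"
  have K: "2 \<le> K" by (simp add: K_def)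
  have "\<bar>X w j t x - X w j t y\<bar> \<le> K * E * 2 powr (real j * (e + \<gamma>)) * norm (x - y) powr \<gamma>"
    if t: "t \<in> {0..T}" and xy: "x \<in> S2" "y \<in> S2" for j t x y
  proof -
    define P where "P = 2 powr (real j * e)"
    define u where "u = 2 powr real j * norm (x - y)"
    have P: "0 \<le> P" and u: "0 \<le> u" by (auto simp: P_def u_def)
    have B: "\<bar>X w j t x\<bar> \<le> E * P" if "x \<in> S2" for x
      by (rule order_trans[OF C(2)[OF that t]]) (use E P in \<open>auto simp: P_def intro!: mult_right_mono\<close>)
    have e1: "2 powr (real j * (e + 1)) = P * 2 powr real j"
      by (simp add: P_def powr_add[symmetric] algebra_simps)
    have lip: "\<bar>X w j t x - X w j t y\<bar> \<le> K * (E * (P * 2 powr real j)) * norm (x - y)"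
      unfolding K_def
    proof (rule sphere_lipschitz[OF block_sum_has_derivative])
      show "X (i # w) j t y = X (i # w) j t (y /\<^sub>R norm y) / norm y ^ Suc (length w)" if "y \<noteq> 0" for i y
        using block_sum_homogeneous[OF that, of A _ "i # w"] by simp
      show "\<bar>X w j t x\<bar> \<le> E * (P * 2 powr real j)" if "x \<in> S2" for x
      proof -
        have "E * P * 1 \<le> E * P * 2 powr real j"
          using E P by (intro mult_left_mono ge_one_powr_ge_zero) auto
        then show ?thesis using B[OF that] by simp
      qed
      show "\<bar>X (i # w) j t x\<bar> \<le> E * (P * 2 powr real j)" if "x \<in> S2" for x i
        by (rule order_trans[OF D(2)[OF that t, of i j, unfolded e1]]) (use E P in \<open>auto intro!: mult_right_mono\<close>)
    qed (use xy in auto)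
    have "\<bar>X w j t x - X w j t y\<bar> \<le> K * (E * P) * u powr \<gamma>"
    proof (cases "u \<le> 1")
      case True
      have "u \<le> u powr \<gamma>"
      proof (cases "u = 0")
        case False
        then have "u powr 1 \<le> u powr \<gamma>" using True u \<gamma> by (intro powr_mono') auto
        then show ?thesis using u by simp
      qed simp
      then have "K * (E * P) * u \<le> K * (E * P) * u powr \<gamma>"
        using K E P by (intro mult_left_mono) auto
      then show ?thesis using lip by (simp add: u_def mult_ac)
    next
      case False
      have "\<bar>X w j t x - X w j t y\<bar> \<le> 2 * (E * P)" using B[OF xy(1)] B[OF xy(2)] by linarith
      also have "\<dots> \<le> K * (E * P) * 1" using K E P by (simp add: mult_right_mono)
      also have "\<dots> \<le> K * (E * P) * u powr \<gamma>"
        using K E P False \<gamma> by (intro mult_left_mono ge_one_powr_ge_zero) auto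
      finally show ?thesis .
    qed
    also have "\<dots> = K * E * 2 powr (real j * (e + \<gamma>)) * norm (x - y) powr \<gamma>"
      by (simp add: u_def P_def powr_mult powr_powr powr_add[symmetric] algebra_simps)
    finally show ?thesis .
  qed
  moreover have "e + \<gamma> = real (length w) + \<gamma> - \<eta> / 2 + \<epsilon>" by (simp add: e_def)
  ultimately show ?thesis using K E(1) by (intro exI[of _ "K * E"]) auto
qed

lemma Y_holder_space:
  assumes \<gamma>: "0 < \<gamma>" "\<gamma> \<le> 1" and w: "real (length w) + \<gamma> < \<eta> / 2"
  shows "\<exists>C\<ge>0. \<forall>t\<in>{0..T}. \<forall>x\<in>S2. \<forall>y\<in>S2. \<bar>Y w t x - Y w t y\<bar> \<le> C * norm (x - y) powr \<gamma>"
proof -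
  define \<epsilon> where "\<epsilon> = (\<eta> / 2 - real (length w) - \<gamma>) / 2"
  have "2 * \<epsilon> = \<eta> / 2 - real (length w) - \<gamma>" by (simp add: \<epsilon>_def)
  then have \<epsilon>: "0 < \<epsilon>" "real (length w) + \<gamma> - \<eta> / 2 + \<epsilon> < 0" using w by linarith+
  obtain C where C: "C \<ge> 0" "\<And>j t x y. t \<in> {0..T} \<Longrightarrow> x \<in> S2 \<Longrightarrow> y \<in> S2 \<Longrightarrow>
    \<bar>X w j t x - X w j t y\<bar> \<le> C * 2 powr (real j * (real (length w) + \<gamma> - \<eta> / 2 + \<epsilon>)) * norm (x - y) powr \<gamma>"
    using X_space_holder[OF \<epsilon>(1) \<gamma>, of w] by blast
  define c where "c j = C * 2 powr (real j * (real (length w) + \<gamma> - \<eta> / 2 + \<epsilon>))" for j :: nat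
  have c: "summable c" unfolding c_def by (intro summable_mult summable_powr_geometric \<epsilon>)
  have c0: "\<And>j. 0 \<le> c j" using C(1) by (simp add: c_def)
  have "\<bar>Y w t x - Y w t y\<bar> \<le> suminf c * norm (x - y) powr \<gamma>" if "t \<in> {0..T}" "x \<in> S2" "y \<in> S2" for t x y
    using that C(2) w \<gamma> by (intro Y_diff_le c) (auto simp: c_def)
  then show ?thesis using suminf_nonneg[OF c c0] by blast
qed

lemma Y_has_derivative:
  assumes w: "real (length w) + 1 < \<eta> / 2" and t: "t \<in> {0..T}" and y: "y \<noteq> 0"
  shows "(Y w t has_derivative (\<lambda>h. \<Sum>i\<in>UNIV. h$i * Y (i # w) t y)) (at y)"
proof -
  define S where "S = ball y (norm y / 2)"
  have S: "norm y / 2 \<le> norm z" "z \<noteq> 0" if "z \<in> S" for z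
  proof -
    show "norm y / 2 \<le> norm z"
      using that norm_triangle_ineq2[of y "y - z"] by (simp add: S_def dist_norm)
    then show "z \<noteq> 0" using y by auto
  qed
  have yS: "y \<in> S" using y by (simp add: S_def)
  have unif: "uniform_limit S (\<lambda>n z. \<Sum>j<n. X v j t z) (\<lambda>z. Y v t z) sequentially"
    if v: "real (length v) < \<eta> / 2" for v
  proof -
    obtain c where c: "summable c" "\<forall>j. 0 \<le> c j" "\<forall>j. \<forall>x\<in>S2. \<forall>t\<in>{0..T}. \<bar>X v j t x\<bar> \<le> c j"
      using X_summable_bound[OF v] by metis
    have "norm (X v j t z) \<le> c j / (norm y / 2) ^ length v" if "z \<in> S" for j z
    proof -
      have "norm (X v j t z) = \<bar>X v j t (z /\<^sub>R norm z)\<bar> / norm z ^ length v"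
        using block_sum_homogeneous[OF S(2)[OF that]] by simp
      also have "\<dots> \<le> c j / (norm y / 2) ^ length v"
        using S[OF that] y c(2) by (intro frac_le c(3)[rule_format, OF _ t] power_mono) (auto simp: S2_iff_norm)
      finally show ?thesis .
    qed
    then show ?thesis unfolding Y_def
      by (intro Weierstrass_m_test[where M = "\<lambda>j. c j / (norm y / 2) ^ length v"] summable_divide c)
  qed
  have "\<exists>g. \<forall>z\<in>S. (\<lambda>j. X w j t z) sums g z \<and>
      (g has_derivative (\<lambda>h. \<Sum>i\<in>UNIV. h$i * Y (i # w) t z)) (at z within S)"
  proof (rule has_derivative_series)
    show "convex S" by (simp add: S_def)
    show "((\<lambda>x. X w j t x) has_derivative (\<lambda>h. \<Sum>i\<in>UNIV. h$i * X (i # w) j t z)) (at z within S)" if "z \<in> S" for j z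
      by (rule has_derivative_at_withinI[OF block_sum_has_derivative[OF S(2)[OF that]]])
    show "y \<in> S" by fact
    have "(\<lambda>n. \<Sum>j<n. X w j t y) \<longlonglongrightarrow> Y w t y"
      using tendsto_uniform_limitI[OF unif yS] w by simp
    then show "(\<lambda>j. X w j t y) sums Y w t y" by (simp add: sums_def)
    fix e :: real assume e: "0 < e"
    have "\<forall>\<^sub>F n in sequentially. \<forall>z\<in>S. dist (\<Sum>j<n. X (i # w) j t z) (Y (i # w) t z) < e / 3" for i
      using uniform_limitD[OF unif[of "i # w"], of "e / 3"] w e by simp
    then have "\<forall>\<^sub>F n in sequentially. \<forall>i. \<forall>z\<in>S. dist (\<Sum>j<n. X (i # w) j t z) (Y (i # w) t z) < e / 3"
      by (rule eventually_all_finite)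
    then show "\<forall>\<^sub>F n in sequentially. \<forall>z\<in>S. \<forall>h. norm ((\<Sum>j<n. \<Sum>i\<in>UNIV. h$i * X (i # w) j t z) -
        (\<Sum>i\<in>UNIV. h$i * Y (i # w) t z)) \<le> e * norm h"
    proof (rule eventually_mono, intro ballI allI)
      fix n z and h :: "real^3"
      assume *: "\<forall>i. \<forall>z\<in>S. dist (\<Sum>j<n. X (i # w) j t z) (Y (i # w) t z) < e / 3" and z: "z \<in> S"
      have "(\<Sum>j<n. \<Sum>i\<in>UNIV. h$i * X (i # w) j t z) - (\<Sum>i\<in>UNIV. h$i * Y (i # w) t z) =
        (\<Sum>i\<in>UNIV. h$i * ((\<Sum>j<n. X (i # w) j t z) - Y (i # w) t z))"
        by (subst sum.swap) (simp add: sum_distrib_left right_diff_distrib sum_subtractf)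
      also have "norm \<dots> \<le> (\<Sum>i\<in>(UNIV::3 set). norm h * (e / 3))"
      proof (intro order_trans[OF norm_sum] sum_mono)
        fix i
        have "\<bar>(\<Sum>j<n. X (i # w) j t z) - Y (i # w) t z\<bar> \<le> e / 3"
          using *[rule_format, OF z, of i] by (simp only: dist_real_def)
        then show "norm (h$i * ((\<Sum>j<n. X (i # w) j t z) - Y (i # w) t z)) \<le> norm h * (e / 3)"
          unfolding real_norm_def abs_mult by (intro mult_mono component_le_norm_cart) auto
      qed
      also have "\<dots> = e * norm h" by simp
      finally show "norm ((\<Sum>j<n. \<Sum>i\<in>UNIV. h$i * X (i # w) j t z) - (\<Sum>i\<in>UNIV. h$i * Y (i # w) t z)) \<le> e * norm h" .
    qed
  qed
  then obtain g where g: "\<And>z. z \<in> S \<Longrightarrow> (\<lambda>j. X w j t z) sums g z"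
    "\<And>z. z \<in> S \<Longrightarrow> (g has_derivative (\<lambda>h. \<Sum>i\<in>UNIV. h$i * Y (i # w) t z)) (at z within S)" by blast
  have "open S" by (simp add: S_def)
  have "(g has_derivative (\<lambda>h. \<Sum>i\<in>UNIV. h$i * Y (i # w) t y)) (at y)"
    using g(2)[OF yS] at_within_open[OF yS \<open>open S\<close>] by simp
  then show ?thesis
    by (rule has_derivative_transform_within_open[OF _ \<open>open S\<close> yS]) (use g(1) in \<open>simp add: Y_def sums_iff\<close>)
qed

lemma Y_Ck_holder:
  assumes "0 < \<gamma>" "\<gamma> \<le> 1" "t \<in> {0..T}" "real (length w) + real k + \<gamma> < \<eta> / 2"
  shows "Ck_holder k \<gamma> (Y w t)"
  using assms(4)
proof (induction k arbitrary: w)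
  case 0
  obtain C where C: "C \<ge> 0" "\<And>x y. x \<in> S2 \<Longrightarrow> y \<in> S2 \<Longrightarrow> \<bar>Y w t x - Y w t y\<bar> \<le> C * norm (x - y) powr \<gamma>"
    using Y_holder_space[OF assms(1,2), of w] 0 assms(3) by auto
  have "\<bar>Y w t x - Y w t y\<bar> \<le> C * sph_dist x y powr \<gamma>" if "x \<in> S2" "y \<in> S2" for x y
    by (rule order_trans[OF C(2)[OF that]])
      (use C(1) assms norm_le_sph_dist[OF that] in \<open>intro mult_left_mono powr_mono2, auto\<close>)
  then show ?case unfolding Ck_holder.simps holder_on_def by blast
next
  case (Suc k)
  have w: "real (length w) + 1 < \<eta> / 2" using Suc.prems assms(1) by simp
  have ax: "(\<Sum>i'\<in>UNIV. axis i 1 $ i' * Y (i' # w) t y) = Y (i # w) t y" for i y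
    using exhaust_3[of i] by (auto simp: sum_3 axis_def)
  show ?case unfolding Ck_holder.simps
    using Y_has_derivative[OF w assms(3)] Suc
    by (intro exI[of _ "\<lambda>y h. \<Sum>i\<in>UNIV. h$i * Y (i # w) t y"]) (auto simp: ax)
qed

lemma Y_normalize: "Y [] t (y /\<^sub>R norm y) = Y [] t y"
  by (cases "y = 0") (simp_all add: Y_def block_sum_def sph_ext_def)

lemma Y_holder_joint:
  assumes g: "0 < g" "g < min H (\<eta> / 2)"
  shows "\<exists>C\<ge>0. \<forall>s\<in>{0..T}. \<forall>t\<in>{0..T}. \<forall>x\<in>S2. \<forall>y\<in>S2.
     \<bar>Y [] s x - Y [] t y\<bar> \<le> C * (\<bar>s - t\<bar> + norm (x - y)) powr g"
proof -
  obtain C where C: "C \<ge> 0" "\<And>x s t. x \<in> S2 \<Longrightarrow> s \<in> {0..T} \<Longrightarrow> t \<in> {0..T} \<Longrightarrow>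
     \<bar>Y [] t x - Y [] s x\<bar> \<le> C * \<bar>t - s\<bar> powr g"
    using Y_holder_time[of g] g by auto
  obtain D where D: "D \<ge> 0" "\<And>t x y. t \<in> {0..T} \<Longrightarrow> x \<in> S2 \<Longrightarrow> y \<in> S2 \<Longrightarrow>
     \<bar>Y [] t x - Y [] t y\<bar> \<le> D * norm (x - y) powr g"
    using Y_holder_space[of g "[]"] g H by auto
  have "\<bar>Y [] s x - Y [] t y\<bar> \<le> (C + D) * (\<bar>s - t\<bar> + norm (x - y)) powr g"
    if "s \<in> {0..T}" "t \<in> {0..T}" "x \<in> S2" "y \<in> S2" for s t x y
  proof -
    have "\<bar>Y [] s x - Y [] t y\<bar> \<le> C * \<bar>s - t\<bar> powr g + D * norm (x - y) powr g"
      using C(2)[OF that(3,2,1)] D(2)[OF that(2,3,4)] by linarith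
    also have "\<dots> \<le> C * (\<bar>s - t\<bar> + norm (x - y)) powr g + D * (\<bar>s - t\<bar> + norm (x - y)) powr g"
      using C(1) D(1) g by (intro add_mono mult_left_mono powr_mono2) auto
    finally show ?thesis by (simp add: distrib_right)
  qed
  then show ?thesis using C(1) D(1) by (intro exI[of _ "C + D"]) auto
qed

lemma Y_continuous: "continuous_on ({0..T} \<times> S2) (\<lambda>(t, x). Y [] t x)"
proof -
  define g where "g = min H (\<eta> / 2) / 2"
  have g: "0 < g" "g < min H (\<eta> / 2)" using H \<eta> by (auto simp: g_def)
  obtain C where C: "C \<ge> 0" "\<And>s t x y. s \<in> {0..T} \<Longrightarrow> t \<in> {0..T} \<Longrightarrow> x \<in> S2 \<Longrightarrow> y \<in> S2 \<Longrightarrow>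
     \<bar>Y [] s x - Y [] t y\<bar> \<le> C * (\<bar>s - t\<bar> + norm (x - y)) powr g"
    using Y_holder_joint[OF g] by blast
  show ?thesis unfolding continuous_on_def
  proof
    fix p assume p: "p \<in> {0..T} \<times> S2"
    let ?F = "at p within {0..T} \<times> S2"
    have "((\<lambda>q. \<bar>fst q - fst p\<bar> + norm (snd q - snd p)) \<longlongrightarrow> \<bar>fst p - fst p\<bar> + norm (snd p - snd p)) ?F"
      by (intro tendsto_intros)
    then have lim: "((\<lambda>q. C * (\<bar>fst q - fst p\<bar> + norm (snd q - snd p)) powr g) \<longlongrightarrow> C * 0) ?F"
      using g by (intro tendsto_mult_left tendsto_zero_powrI[of _ _ "\<lambda>_. g" g]) auto
    have ev: "\<forall>\<^sub>F q in ?F. norm ((\<lambda>(t, x). Y [] t x) q - (\<lambda>(t, x). Y [] t x) p) \<le>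
        C * (\<bar>fst q - fst p\<bar> + norm (snd q - snd p)) powr g"
      unfolding eventually_at_filter
    proof (intro always_eventually allI impI)
      fix q assume "q \<in> {0..T} \<times> S2"
      then show "norm ((\<lambda>(t, x). Y [] t x) q - (\<lambda>(t, x). Y [] t x) p) \<le>
        C * (\<bar>fst q - fst p\<bar> + norm (snd q - snd p)) powr g"
        using p C(2)[of "fst q" "fst p" "snd q" "snd p"] by (simp only: case_prod_beta mem_Times_iff real_norm_def)
    qed
    have "((\<lambda>q. (\<lambda>(t, x). Y [] t x) q - (\<lambda>(t, x). Y [] t x) p) \<longlongrightarrow> 0) ?F"
      by (rule Lim_null_comparison[OF ev lim[unfolded mult_zero_right]])
    then show "((\<lambda>(t, x). Y [] t x) \<longlongrightarrow> (\<lambda>(t, x). Y [] t x) p) ?F"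
      by (rule LIM_zero_cancel)
  qed
qed

lemma Y_holder_minus_space: "holder_minus_space T H (\<eta> / 2) (\<lambda>t x. Y [] t x)"
  unfolding holder_minus_space_def
proof (intro conjI allI impI ballI)
  fix a x assume a: "0 < a \<and> a < H" and x: "x \<in> S2"
  obtain C where "\<forall>x\<in>S2. \<forall>s\<in>{0..T}. \<forall>t\<in>{0..T}. \<bar>Y [] t x - Y [] s x\<bar> \<le> C * \<bar>t - s\<bar> powr a"
    using Y_holder_time[of a] a by blast
  then show "holder_on (\<lambda>s t. \<bar>s - t\<bar>) {0..T} a (\<lambda>t. Y [] t x)"
    unfolding holder_on_def using x by (intro exI[of _ C]) simp
next
  fix b t assume b: "0 < b \<and> b < \<eta> / 2" and t: "t \<in> {0..T}"
  define k where "k = nat (\<lceil>b\<rceil> - 1)"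
  have "real k = of_int \<lceil>b\<rceil> - 1" using b by (simp add: k_def)
  then have k: "real k < b" "b \<le> real k + 1" by linarith+
  have "Ck_holder k (b - real k) (Y [] t)" using k t b by (intro Y_Ck_holder) auto
  then show "sphere_holder b (\<lambda>x. Y [] t x)"
    by (simp add: sphere_holder_def Let_def k_def[symmetric] Y_normalize)
next
  fix g assume "0 < g \<and> g < min H (\<eta> / 2)"
  then have g: "0 < g" "g < min H (\<eta> / 2)" by auto
  obtain C where C: "C \<ge> 0" "\<And>s t x y. s \<in> {0..T} \<Longrightarrow> t \<in> {0..T} \<Longrightarrow> x \<in> S2 \<Longrightarrow> y \<in> S2 \<Longrightarrow>
     \<bar>Y [] s x - Y [] t y\<bar> \<le> C * (\<bar>s - t\<bar> + norm (x - y)) powr g"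
    using Y_holder_joint[OF g] by blast
  have "\<bar>Y [] s x - Y [] t y\<bar> \<le> C * (\<bar>s - t\<bar> + sph_dist x y) powr g"
    if "s \<in> {0..T}" "t \<in> {0..T}" "x \<in> S2" "y \<in> S2" for s t x y
    by (rule order_trans[OF C(2)[OF that]])
      (use C(1) g norm_le_sph_dist[OF that(3,4)] in \<open>intro mult_left_mono powr_mono2, auto\<close>)
  then show "holder_on (\<lambda>(s, x) (t, y). \<bar>s - t\<bar> + sph_dist x y) ({0..T} \<times> S2) g (\<lambda>(t, x). Y [] t x)"
    unfolding holder_on_def by (intro exI[of _ C]) auto
qed

end

section \<open>The modification\<close>

lemma sum_dyadic_block: "(\<Sum>j<J. \<Sum>l\<in>dyadic_block j. f l) = (\<Sum>l<2 ^ J - 1. f l)"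
proof (induction J)
  case (Suc J)
  have "(1::nat) \<le> 2 ^ J" by simp
  then have le: "2 ^ J - 1 \<le> (2 ^ Suc J - 1 :: nat)" by simp
  have "(\<Sum>j<Suc J. \<Sum>l\<in>dyadic_block j. f l) = sum f {0..<2 ^ J - 1} + sum f {2 ^ J - 1..<2 ^ Suc J - 1}"
    using Suc by (simp add: dyadic_block_def lessThan_atLeast0 del: power_Suc)
  also have "\<dots> = sum f {0..<2 ^ Suc J - 1}" by (rule sum.atLeastLessThan_concat) (use le in auto)
  finally show ?case by (simp add: lessThan_atLeast0 del: power_Suc)
qed simp

lemma sum_block_sum_eq_qfbm_partial:
  assumes "x \<in> S2"
  shows "(\<Sum>j<J. block_sum A (\<lambda>l m. \<beta> l m t \<omega>) [] j x) = qfbm_partial A \<beta> (2 ^ J - 1) t x \<omega>"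
  using assms by (simp add: block_sum_def sum_dyadic_block qfbm_partial_def sph_ext_def S2_iff_norm)

context qfbm
begin

lemma AE_path_regular:
  "AE \<omega> in M. (\<forall>l m. \<bar>m\<bar> \<le> int l \<longrightarrow> \<beta> l m 0 \<omega> = 0) \<and>
    (\<forall>w a \<epsilon>. 0 < a \<longrightarrow> a < H \<longrightarrow> 0 < \<epsilon> \<longrightarrow>
      (\<exists>C\<ge>0. \<forall>j. \<forall>x\<in>S2. \<forall>s\<in>{0..T}. \<forall>t\<in>{0..T}.
        \<bar>X w j t x \<omega> - X w j s x \<omega>\<bar> \<le> C * 2 powr (real j * (real (length w) - \<eta> / 2 + \<epsilon>)) * \<bar>t - s\<bar> powr a))"
proof -
  have "AE \<omega> in M. \<bar>m\<bar> \<le> int l \<longrightarrow> \<beta> l m 0 \<omega> = 0" for l m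
    using is_fbm_zero[OF fbm, of m l] T by (cases "\<bar>m\<bar> \<le> int l") auto
  then have zero: "AE \<omega> in M. \<forall>l m. \<bar>m\<bar> \<le> int l \<longrightarrow> \<beta> l m 0 \<omega> = 0"
    by (simp add: AE_all_countable)
  define a' where "a' n = H - H / (real n + 2)" for n
  define \<epsilon>' where "\<epsilon>' n = 1 / (real n + 1)" for n
  have a': "0 < a' n" "a' n < H" for n using H by (auto simp: a'_def field_simps intro!: add_pos_nonneg)
  have \<epsilon>': "0 < \<epsilon>' n" for n by (simp add: \<epsilon>'_def)
  have "AE \<omega> in M. \<forall>w n k. \<exists>C\<ge>0. \<forall>j. \<forall>x\<in>S2. \<forall>s\<in>{0..T}. \<forall>t\<in>{0..T}.
        \<bar>X w j t x \<omega> - X w j s x \<omega>\<bar> \<le> C * 2 powr (real j * (real (length w) - \<eta> / 2 + \<epsilon>' k)) * \<bar>t - s\<bar> powr a' n"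
    unfolding AE_all_countable using X_holder[OF a' \<epsilon>'] by blast
  with zero show ?thesis
  proof eventually_elim
    fix \<omega>
    assume z: "\<forall>l m. \<bar>m\<bar> \<le> int l \<longrightarrow> \<beta> l m 0 \<omega> = 0"
      and *: "\<forall>w n k. \<exists>C\<ge>0. \<forall>j. \<forall>x\<in>S2. \<forall>s\<in>{0..T}. \<forall>t\<in>{0..T}.
        \<bar>X w j t x \<omega> - X w j s x \<omega>\<bar> \<le> C * 2 powr (real j * (real (length w) - \<eta> / 2 + \<epsilon>' k)) * \<bar>t - s\<bar> powr a' n"
    have "\<exists>C\<ge>0. \<forall>j. \<forall>x\<in>S2. \<forall>s\<in>{0..T}. \<forall>t\<in>{0..T}.
        \<bar>X w j t x \<omega> - X w j s x \<omega>\<bar> \<le> C * 2 powr (real j * (real (length w) - \<eta> / 2 + \<epsilon>)) * \<bar>t - s\<bar> powr a"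
      if a: "0 < a" "a < H" and \<epsilon>: "0 < \<epsilon>" for w a \<epsilon>
    proof -
      obtain n :: nat where "H / (H - a) < real n" using reals_Archimedean2 by blast
      then have n: "a < a' n" using a H by (simp add: a'_def field_simps)
      obtain k :: nat where "1 / \<epsilon> < real k" using reals_Archimedean2 by blast
      then have k: "\<epsilon>' k < \<epsilon>" using \<epsilon> by (simp add: \<epsilon>'_def field_simps)
      obtain C where C: "C \<ge> 0" and C': "\<forall>j. \<forall>x\<in>S2. \<forall>s\<in>{0..T}. \<forall>t\<in>{0..T}.
        \<bar>X w j t x \<omega> - X w j s x \<omega>\<bar> \<le> C * 2 powr (real j * (real (length w) - \<eta> / 2 + \<epsilon>' k)) * \<bar>t - s\<bar> powr a' n"
        using *[rule_format, of w k n] by blast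
      have "\<bar>X w j t x \<omega> - X w j s x \<omega>\<bar> \<le>
          C * T powr (a' n - a) * 2 powr (real j * (real (length w) - \<eta> / 2 + \<epsilon>)) * \<bar>t - s\<bar> powr a"
        if "x \<in> S2" "s \<in> {0..T}" "t \<in> {0..T}" for j x s t
      proof -
        have "\<bar>t - s\<bar> powr a' n = \<bar>t - s\<bar> powr (a' n - a) * \<bar>t - s\<bar> powr a"
          by (cases "t = s") (simp_all add: powr_add[symmetric])
        also have "\<dots> \<le> T powr (a' n - a) * \<bar>t - s\<bar> powr a"
          using n that by (intro mult_right_mono powr_mono2) auto
        finally have 1: "\<bar>t - s\<bar> powr a' n \<le> T powr (a' n - a) * \<bar>t - s\<bar> powr a" .
        have 2: "2 powr (real j * (real (length w) - \<eta> / 2 + \<epsilon>' k)) \<le> 2 powr (real j * (real (length w) - \<eta> / 2 + \<epsilon>))"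
          using k by (intro powr_mono mult_left_mono) auto
        have "\<bar>X w j t x \<omega> - X w j s x \<omega>\<bar> \<le> C * 2 powr (real j * (real (length w) - \<eta> / 2 + \<epsilon>' k)) * \<bar>t - s\<bar> powr a' n"
          using C'[rule_format, OF that] .
        also have "\<dots> \<le> C * 2 powr (real j * (real (length w) - \<eta> / 2 + \<epsilon>)) * (T powr (a' n - a) * \<bar>t - s\<bar> powr a)"
          using C by (intro mult_mono 1 2) auto
        finally show ?thesis by (simp add: mult_ac)
      qed
      then show ?thesis using C by (intro exI[of _ "C * T powr (a' n - a)"]) auto
    qed
    then show "(\<forall>l m. \<bar>m\<bar> \<le> int l \<longrightarrow> \<beta> l m 0 \<omega> = 0) \<and>
      (\<forall>w a \<epsilon>. 0 < a \<longrightarrow> a < H \<longrightarrow> 0 < \<epsilon> \<longrightarrow>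
        (\<exists>C\<ge>0. \<forall>j. \<forall>x\<in>S2. \<forall>s\<in>{0..T}. \<forall>t\<in>{0..T}.
        \<bar>X w j t x \<omega> - X w j s x \<omega>\<bar> \<le> C * 2 powr (real j * (real (length w) - \<eta> / 2 + \<epsilon>)) * \<bar>t - s\<bar> powr a))"
      using z by blast
  qed
qed

lemma exists_regular_version:
  assumes H1: "H < 1"
  shows "\<exists>B'. (\<forall>t\<in>{0..T}. \<forall>x\<in>S2. B' t x \<in> borel_measurable M \<and>
       (AE \<omega> in M. (\<lambda>J. qfbm_partial A \<beta> (2 ^ J - 1) t x \<omega>) \<longlonglongrightarrow> B' t x \<omega>)) \<and>
     (\<forall>\<omega>\<in>space M. continuous_on ({0..T} \<times> S2) (\<lambda>(t, x). B' t x \<omega>) \<and>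
       holder_minus_space T H (\<eta> / 2) (\<lambda>t x. B' t x \<omega>))"
proof -
  let ?good = "\<lambda>\<omega>. (\<forall>l m. \<bar>m\<bar> \<le> int l \<longrightarrow> \<beta> l m 0 \<omega> = 0) \<and>
    (\<forall>w a \<epsilon>. 0 < a \<longrightarrow> a < H \<longrightarrow> 0 < \<epsilon> \<longrightarrow>
      (\<exists>C\<ge>0. \<forall>j. \<forall>x\<in>S2. \<forall>s\<in>{0..T}. \<forall>t\<in>{0..T}.
        \<bar>X w j t x \<omega> - X w j s x \<omega>\<bar> \<le> C * 2 powr (real j * (real (length w) - \<eta> / 2 + \<epsilon>)) * \<bar>t - s\<bar> powr a))"
  obtain N where N: "{\<omega> \<in> space M. \<not> ?good \<omega>} \<subseteq> N" "emeasure M N = 0" "N \<in> sets M"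
    using AE_E[OF AE_path_regular] .
  define b where "b \<omega> l m t = (if \<omega> \<in> N then 0 else \<beta> l m t \<omega>)" for \<omega> l m t
  have path: "qfbm_path T H \<eta> A (b \<omega>)" if \<omega>: "\<omega> \<in> space M" for \<omega>
  proof (cases "\<omega> \<in> N")
    case True
    then show ?thesis using T H \<eta> H1 by unfold_locales (auto simp: b_def block_sum_def intro!: exI[of _ 0])
  next
    case False
    then have "?good \<omega>" using N(1) \<omega> by blast
    moreover have "b \<omega> = (\<lambda>l m t. \<beta> l m t \<omega>)" using False by (simp add: b_def fun_eq_iff)
    ultimately show ?thesis using T H \<eta> H1 by unfold_locales auto
  qed
  define B' where "B' t x \<omega> = (\<Sum>j. block_sum A (\<lambda>l m. b \<omega> l m t) [] j x)" for t x \<omega>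
  have Y: "B' t x \<omega> = qfbm_path.Y A (b \<omega>) [] t x" if "\<omega> \<in> space M" for t x \<omega>
    by (simp add: B'_def qfbm_path.Y_def[OF path[OF that]])
  have "B' t x \<in> borel_measurable M" if "t \<in> {0..T}" for t x
  proof -
    have "(\<lambda>\<omega>. b \<omega> l m t) \<in> borel_measurable M" if m: "m \<in> {- int l..int l}" for l m
      unfolding b_def using is_fbm_square_integrable(1)[OF fbm \<open>t \<in> {0..T}\<close>, of m l] N(3) m
      by (intro measurable_If_set) auto
    then show ?thesis unfolding B'_def block_sum_def
      by (intro borel_measurable_suminf borel_measurable_sum borel_measurable_times borel_measurable_const)
  qed
  moreover have "AE \<omega> in M. (\<lambda>J. qfbm_partial A \<beta> (2 ^ J - 1) t x \<omega>) \<longlonglongrightarrow> B' t x \<omega>"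
    if t: "t \<in> {0..T}" and x: "x \<in> S2" for t x
  proof -
    have "AE \<omega> in M. \<omega> \<notin> N" using N(2,3) by (intro AE_not_in) auto
    then show ?thesis
    proof (rule AE_mp[OF _ AE_I2], intro impI)
      fix \<omega> assume \<omega>: "\<omega> \<in> space M" "\<omega> \<notin> N"
      have "(\<lambda>j. block_sum A (\<lambda>l m. b \<omega> l m t) [] j x) sums B' t x \<omega>"
        unfolding B'_def using qfbm_path.X_summable[OF path[OF \<omega>(1)] _ x t, of "[]"] \<eta>
        by (intro summable_sums) simp
      then show "(\<lambda>J. qfbm_partial A \<beta> (2 ^ J - 1) t x \<omega>) \<longlonglongrightarrow> B' t x \<omega>"
        using \<omega>(2) x by (simp add: sums_def b_def sum_block_sum_eq_qfbm_partial)
    qed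
  qed
  moreover have "continuous_on ({0..T} \<times> S2) (\<lambda>(t, x). B' t x \<omega>) \<and>
       holder_minus_space T H (\<eta> / 2) (\<lambda>t x. B' t x \<omega>)" if "\<omega> \<in> space M" for \<omega>
    unfolding Y[OF that] using qfbm_path.Y_continuous[OF path[OF that]]
      qfbm_path.Y_holder_minus_space[OF path[OF that]] by blast
  ultimately show ?thesis by blast
qed

end

lemma AE_eq_of_L2_limit:
  fixes f :: "'a \<Rightarrow> real" and g :: "'a \<Rightarrow> real" and S :: "nat \<Rightarrow> 'a \<Rightarrow> real"
  assumes [measurable]: "f \<in> borel_measurable M" "g \<in> borel_measurable M" "\<And>n. S n \<in> borel_measurable M"
    and L2: "(\<lambda>n. \<integral>\<^sup>+\<omega>. ennreal ((f \<omega> - S n \<omega>)\<^sup>2) \<partial>M) \<longlonglongrightarrow> 0"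
    and lim: "AE \<omega> in M. (\<lambda>n. S n \<omega>) \<longlonglongrightarrow> g \<omega>"
  shows "AE \<omega> in M. g \<omega> = f \<omega>"
proof -
  have "(\<integral>\<^sup>+\<omega>. ennreal ((f \<omega> - g \<omega>)\<^sup>2) \<partial>M) = (\<integral>\<^sup>+\<omega>. liminf (\<lambda>n. ennreal ((f \<omega> - S n \<omega>)\<^sup>2)) \<partial>M)"
  proof (rule nn_integral_cong_AE, use lim in eventually_elim)
    fix \<omega> assume "(\<lambda>n. S n \<omega>) \<longlonglongrightarrow> g \<omega>"
    then have "(\<lambda>n. ennreal ((f \<omega> - S n \<omega>)\<^sup>2)) \<longlonglongrightarrow> ennreal ((f \<omega> - g \<omega>)\<^sup>2)"
      by (intro tendsto_ennrealI tendsto_intros)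
    then show "ennreal ((f \<omega> - g \<omega>)\<^sup>2) = liminf (\<lambda>n. ennreal ((f \<omega> - S n \<omega>)\<^sup>2))"
      by (rule lim_imp_Liminf[OF trivial_limit_sequentially, symmetric])
  qed
  also have "\<dots> \<le> liminf (\<lambda>n. \<integral>\<^sup>+\<omega>. ennreal ((f \<omega> - S n \<omega>)\<^sup>2) \<partial>M)"
    by (rule nn_integral_liminf) measurable
  also have "\<dots> = 0" by (rule lim_imp_Liminf[OF trivial_limit_sequentially L2])
  finally have "(\<integral>\<^sup>+\<omega>. ennreal ((f \<omega> - g \<omega>)\<^sup>2) \<partial>M) = 0" by simp
  then have "AE \<omega> in M. ennreal ((f \<omega> - g \<omega>)\<^sup>2) = 0" by (subst (asm) nn_integral_0_iff_AE) auto
  then show ?thesis by eventually_elim (auto simp: ennreal_eq_0_iff)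
qed

theorem theorem3p3:
  fixes M :: "'w measure" and T H \<eta> :: real
    and A :: "nat \<Rightarrow> real"
    and \<beta> :: "nat \<Rightarrow> int \<Rightarrow> real \<Rightarrow> 'w \<Rightarrow> real"
    and B :: "real \<Rightarrow> real^3 \<Rightarrow> 'w \<Rightarrow> real"
  assumes "prob_space M"
    and "0 < T"
    and "0 < H" and "H < 1"
    and "0 < \<eta>"
    and "\<And>l. 0 \<le> A l"
    and "summable (\<lambda>l. A l * real l powr (1 + \<eta>))"
    and "\<And>l m. \<bar>m\<bar> \<le> int l \<Longrightarrow> is_fbm M T H (\<beta> l m)"
    and "prob_space.indep_vars M (\<lambda>_. Pi\<^sub>M {0..T} (\<lambda>_. borel))
           (\<lambda>(l, m) \<omega>. restrict (\<lambda>t. \<beta> l m t \<omega>) {0..T}) {(l, m). \<bar>m\<bar> \<le> int l}"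
    and "\<And>t x. t \<in> {0..T} \<Longrightarrow> x \<in> S2 \<Longrightarrow> B t x \<in> borel_measurable M"
    and "\<And>t x. t \<in> {0..T} \<Longrightarrow> x \<in> S2 \<Longrightarrow>
           (\<lambda>L. \<integral>\<^sup>+ \<omega>. ennreal ((B t x \<omega> - qfbm_partial A \<beta> L t x \<omega>)\<^sup>2) \<partial>M) \<longlonglongrightarrow> 0"
  shows "\<exists>B'. (\<forall>t\<in>{0..T}. \<forall>x\<in>S2.
                 B' t x \<in> borel_measurable M \<and> (AE \<omega> in M. B' t x \<omega> = B t x \<omega>)) \<and>
              (\<forall>\<omega>\<in>space M. continuous_on ({0..T} \<times> S2) (\<lambda>(t, x). B' t x \<omega>) \<and>
                 holder_minus_space T H (\<eta> / 2) (\<lambda>t x. B' t x \<omega>))"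
proof -
  interpret prob_space M by fact
  interpret qfbm M T H \<eta> A \<beta>
    by unfold_locales (use assms in auto)
  obtain B' where B': "\<forall>t\<in>{0..T}. \<forall>x\<in>S2. B' t x \<in> borel_measurable M \<and>
       (AE \<omega> in M. (\<lambda>J. qfbm_partial A \<beta> (2 ^ J - 1) t x \<omega>) \<longlonglongrightarrow> B' t x \<omega>)"
    "\<forall>\<omega>\<in>space M. continuous_on ({0..T} \<times> S2) (\<lambda>(t, x). B' t x \<omega>) \<and>
       holder_minus_space T H (\<eta> / 2) (\<lambda>t x. B' t x \<omega>)"
    using exists_regular_version[OF \<open>H < 1\<close>] by (elim exE conjE)
  have "AE \<omega> in M. B' t x \<omega> = B t x \<omega>" if t: "t \<in> {0..T}" and x: "x \<in> S2" for t x
  proof (rule AE_eq_of_L2_limit)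
    show "B t x \<in> borel_measurable M" by (rule assms(10)[OF t x])
    show "B' t x \<in> borel_measurable M"
      "AE \<omega> in M. (\<lambda>J. qfbm_partial A \<beta> (2 ^ J - 1) t x \<omega>) \<longlonglongrightarrow> B' t x \<omega>"
      by (rule B'(1)[rule_format, OF t x, THEN conjunct1] B'(1)[rule_format, OF t x, THEN conjunct2])+
    show "qfbm_partial A \<beta> (2 ^ J - 1) t x \<in> borel_measurable M" for J
      unfolding qfbm_partial_def[abs_def] using is_fbm_square_integrable(1)[OF fbm t]
      by (intro borel_measurable_sum borel_measurable_times borel_measurable_const) auto
    have "filterlim (\<lambda>J. 2 ^ J - 1 :: nat) at_top sequentially"
    proof (rule filterlim_at_top_mono[OF filterlim_ident always_eventually], rule allI)
      fix J :: nat
      have "Suc J \<le> 2 ^ J" by (rule Suc_leI[OF less_exp])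
      then show "J \<le> 2 ^ J - 1" by (metis diff_Suc_1 diff_le_mono)
    qed
    from filterlim_compose[OF assms(11)[OF t x] this]
    show "(\<lambda>J. \<integral>\<^sup>+ \<omega>. ennreal ((B t x \<omega> - qfbm_partial A \<beta> (2 ^ J - 1) t x \<omega>)\<^sup>2) \<partial>M) \<longlonglongrightarrow> 0" .
  qed
  then show ?thesis using B' by (intro exI[of _ B']) blast
qed

end
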